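(* Let $d\ge 1$, $T>0$, $\sigma\geq 0$ and $p\in\mathbb{N}$, $p\ge 1$. Consider the linear stochastic Schr\"odinger equation $\mathrm{i}\,\mathrm{d}u-\Delta u\,\mathrm{d}t=\mathrm{d}W$ on $\mathbb{R}^d\times(0,\infty)$ with $u(0)=u_0$, where $u_0$ is $\mathcal{F}_0$-measurable and $W$ is a $Q$-Wiener process, and let $u(t)=S(t)u_0-\mathrm{i}\int_0^tS(t-r)\,\mathrm{d}W(r)$ be its mild solution. For an integer $N\ge1$ let $k=T/N$, $t_n=nk$, and let $u^n$ be the exponential integrator approximation defined by $u^0=u_0$ and $$u^n=S(k)u^{n-1}-\mathrm{i}S(k)\bigl(W(t_n)-W(t_{n-1})\bigr),\qquad n=1,\dots,N.$$ Assume that $u_0\in H^\sigma$ almost surely and $Q^{1/2}\in\mathcal{L}_2^{\sigma+2}$. Then there exists a constant $C$, independent of $N$ (equivalently of $k$), such that $$\mathbb{E}\Bigl[\max_{n=1,\ldots,N}\|u^n-u(t_n)\|_\sigma^{2p}\Bigr]\leq C\,k^{2p}\,\|Q^{1/2}\|_{\mathcal{L}_2^{\sigma+2}}^{2p}.$$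
   Context: $L^2=L^2(\mathbb{R}^d)$ is the space of complex-valued square integrable functions, with inner product $(u,v)=\mathrm{Re}\int_{\mathbb{R}^d}u\bar v\,\mathrm{d}x$. $H^\sigma=H^\sigma(\mathbb{R}^d)$ is the (complex-valued, $L^2$-based) fractional Sobolev space of order $\sigma$ with norm $\|\cdot\|_\sigma$. $\mathcal{L}_2^\sigma=\mathcal{L}_2(L^2,H^\sigma)$ is the space of Hilbert--Schmidt operators from $L^2$ to $H^\sigma$, with norm $\|\Phi\|_{\mathcal{L}_2^\sigma}=(\sum_j\|\Phi e_j\|_\sigma^2)^{1/2}$ for any orthonormal basis $(e_j)$ of $L^2$. $S(t)=\mathrm{e}^{-\mathrm{i}t\Delta}$ is the unitary group generated by $-\mathrm{i}\Delta$. $(\Omega,\mathcal{F},\mathbb{P},\{\mathcal{F}_t\}_{t\ge0})$ is a filtered probability space with a normal filtration; $Q$ is a nonnegative self-adjoint trace-class operator on $L^2$, and $W$ is a complex-valued (i.e. $L^2$-valued), square integrable $Q$-Wiener process with respect to $\{\mathcal{F}_t\}$, so $W(t)=\sum_j\beta_j(t)Q^{1/2}e_j$ with independent standard real Brownian motions $\beta_j$. *)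

theory Defs
  imports "HOL-Probability.Probability"
begin

section \<open>The real Hilbert space of complex-valued square integrable functions\<close>

definition sq_integrable :: "('a::euclidean_space \<Rightarrow> complex) \<Rightarrow> bool" where
  "sq_integrable f \<longleftrightarrow>
     f \<in> borel_measurable lborel \<and> integrable lborel (\<lambda>x. (cmod (f x))\<^sup>2)"

definition L2_eq :: "('a::euclidean_space \<Rightarrow> complex) \<Rightarrow> ('a \<Rightarrow> complex) \<Rightarrow> bool" where
  "L2_eq f g \<longleftrightarrow> sq_integrable f \<and> sq_integrable g \<and> (AE x in lborel. f x = g x)"

lemma sq_integrable_measurable: "sq_integrable f \<Longrightarrow> f \<in> borel_measurable lborel"
  by (simp add: sq_integrable_def)

lemma sq_integrable_zero: "sq_integrable (\<lambda>x. 0)"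
  by (simp add: sq_integrable_def)

lemma sq_integrable_cmult:
  assumes "sq_integrable f"
  shows "sq_integrable (\<lambda>x. c * f x)"
  using assms unfolding sq_integrable_def
  by (auto simp: norm_mult power_mult_distrib)

lemma sq_integrable_add:
  assumes f: "sq_integrable f" and g: "sq_integrable g"
  shows "sq_integrable (\<lambda>x. f x + g x)"
proof -
  have m: "f \<in> borel_measurable lborel" "g \<in> borel_measurable lborel"
    and i: "integrable lborel (\<lambda>x. (cmod (f x))\<^sup>2)" "integrable lborel (\<lambda>x. (cmod (g x))\<^sup>2)"
    using f g by (auto simp: sq_integrable_def)
  have bound: "(cmod (f x + g x))\<^sup>2 \<le> 2 * (cmod (f x))\<^sup>2 + 2 * (cmod (g x))\<^sup>2" for x
  proof -
    have "(cmod (f x + g x))\<^sup>2 \<le> (cmod (f x) + cmod (g x))\<^sup>2"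
      by (intro power_mono norm_triangle_ineq norm_ge_zero)
    also have "\<dots> \<le> 2 * (cmod (f x))\<^sup>2 + 2 * (cmod (g x))\<^sup>2"
      using zero_le_power2[of "cmod (f x) - cmod (g x)"]
      by (simp add: power2_sum power2_diff)
    finally show ?thesis .
  qed
  have "integrable lborel (\<lambda>x. (cmod (f x + g x))\<^sup>2)"
    by (rule Bochner_Integration.integrable_bound
        [where f="\<lambda>x. 2 * (cmod (f x))\<^sup>2 + 2 * (cmod (g x))\<^sup>2"])
       (use m i bound in auto)
  with m show ?thesis by (simp add: sq_integrable_def)
qed

lemma integrable_mult_cnj:
  assumes f: "sq_integrable f" and g: "sq_integrable g"
  shows "integrable lborel (\<lambda>x. f x * cnj (g x))"
proof -
  have m: "f \<in> borel_measurable lborel" "g \<in> borel_measurable lborel"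
    and i: "integrable lborel (\<lambda>x. (cmod (f x))\<^sup>2)" "integrable lborel (\<lambda>x. (cmod (g x))\<^sup>2)"
    using f g by (auto simp: sq_integrable_def)
  have mc: "(\<lambda>x. cnj (g x)) \<in> borel_measurable lborel"
    by (rule measurable_compose[OF m(2)]) (intro borel_measurable_continuous_onI continuous_intros)
  have bound: "cmod (f x * cnj (g x)) \<le> (cmod (f x))\<^sup>2 + (cmod (g x))\<^sup>2" for x
  proof -
    have "2 * (cmod (f x) * cmod (g x)) \<le> (cmod (f x))\<^sup>2 + (cmod (g x))\<^sup>2"
      using zero_le_power2[of "cmod (f x) - cmod (g x)"] by (simp add: power2_diff)
    moreover have "0 \<le> cmod (f x) * cmod (g x)" by simp
    ultimately show ?thesis unfolding norm_mult complex_mod_cnj by linarith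
  qed
  show ?thesis
    by (rule Bochner_Integration.integrable_bound
        [where f="\<lambda>x. (cmod (f x))\<^sup>2 + (cmod (g x))\<^sup>2"])
       (use m mc i bound in auto)
qed

lemma part_equivp_L2_eq: "part_equivp (L2_eq :: ('a::euclidean_space \<Rightarrow> complex) \<Rightarrow> _)"
proof (rule part_equivpI)
  show "\<exists>f::'a \<Rightarrow> complex. L2_eq f f"
    using sq_integrable_zero by (auto simp: L2_eq_def)
  show "symp (L2_eq :: ('a \<Rightarrow> complex) \<Rightarrow> _)"
    by (rule sympI) (auto simp: L2_eq_def)
  show "transp (L2_eq :: ('a \<Rightarrow> complex) \<Rightarrow> _)"
    by (rule transpI) (auto simp: L2_eq_def)
qed

quotient_type (overloaded) 'a L2 = "'a::euclidean_space \<Rightarrow> complex" / partial: L2_eq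
  by (rule part_equivp_L2_eq)

text \<open>Multiplication by complex scalars; the vector space structure below is the real one.\<close>

lift_definition cscale :: "complex \<Rightarrow> 'a::euclidean_space L2 \<Rightarrow> 'a L2"
  is "\<lambda>c f x. c * f x"
  unfolding L2_eq_def using sq_integrable_cmult by auto

instantiation L2 :: (euclidean_space) real_inner
begin

lift_definition zero_L2 :: "'a L2" is "\<lambda>x. 0"
  by (simp add: L2_eq_def sq_integrable_zero)

lift_definition plus_L2 :: "'a L2 \<Rightarrow> 'a L2 \<Rightarrow> 'a L2" is "\<lambda>f g x. f x + g x"
  unfolding L2_eq_def using sq_integrable_add by auto

lift_definition scaleR_L2 :: "real \<Rightarrow> 'a L2 \<Rightarrow> 'a L2" is "\<lambda>r f x. of_real r * f x"
  unfolding L2_eq_def using sq_integrable_cmult by auto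

lift_definition uminus_L2 :: "'a L2 \<Rightarrow> 'a L2" is "\<lambda>f x. (-1) * f x"
  unfolding L2_eq_def using sq_integrable_cmult[of _ "-1"] by auto

definition minus_L2 :: "'a L2 \<Rightarrow> 'a L2 \<Rightarrow> 'a L2" where
  "minus_L2 u v = u + (- v)"

lift_definition inner_L2 :: "'a L2 \<Rightarrow> 'a L2 \<Rightarrow> real"
  is "\<lambda>f g. Re (LINT x|lborel. f x * cnj (g x))"
proof -
  fix f f' g g' :: "'a \<Rightarrow> complex"
  assume a: "L2_eq f f'" "L2_eq g g'"
  have "(LINT x|lborel. f x * cnj (g x)) = (LINT x|lborel. f' x * cnj (g' x))"
  proof (rule integral_cong_AE)
    show "(\<lambda>x. f x * cnj (g x)) \<in> borel_measurable lborel"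
      "(\<lambda>x. f' x * cnj (g' x)) \<in> borel_measurable lborel"
      by (rule borel_measurable_integrable, rule integrable_mult_cnj; use a in \<open>simp add: L2_eq_def\<close>)+
    show "AE x in lborel. f x * cnj (g x) = f' x * cnj (g' x)"
      using a unfolding L2_eq_def by auto
  qed
  then show "Re (LINT x|lborel. f x * cnj (g x)) = Re (LINT x|lborel. f' x * cnj (g' x))"
    by simp
qed

definition norm_L2 :: "'a L2 \<Rightarrow> real" where
  "norm_L2 u = sqrt (inner u u)"

definition dist_L2 :: "'a L2 \<Rightarrow> 'a L2 \<Rightarrow> real" where
  "dist_L2 u v = norm (u - v)"

definition sgn_L2 :: "'a L2 \<Rightarrow> 'a L2" where
  "sgn_L2 u = inverse (norm u) *\<^sub>R u"

definition uniformity_L2 :: "('a L2 \<times> 'a L2) filter" where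
  "uniformity_L2 = (INF e\<in>{0<..}. principal {(x, y). dist x y < e})"

definition open_L2 :: "'a L2 set \<Rightarrow> bool" where
  "open_L2 U \<longleftrightarrow> (\<forall>x\<in>U. \<forall>\<^sub>F (x', y) in uniformity. x' = x \<longrightarrow> y \<in> U)"

instance
proof
  fix u v w :: "'a L2" and a b :: real
  show "u + v + w = u + (v + w)"
    by transfer (simp add: L2_eq_def add.assoc sq_integrable_add)
  show "u + v = v + u"
    by transfer (simp add: L2_eq_def sq_integrable_add add.commute)
  show "0 + u = u"
    by transfer (simp add: L2_eq_def)
  show "- u + u = 0"
    by transfer (simp add: L2_eq_def sq_integrable_zero)
  show "u - v = u + - v"
    by (rule minus_L2_def)
  show "a *\<^sub>R (u + v) = a *\<^sub>R u + a *\<^sub>R v"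
    by transfer (simp add: L2_eq_def distrib_left sq_integrable_add sq_integrable_cmult)
  show "(a + b) *\<^sub>R u = a *\<^sub>R u + b *\<^sub>R u"
  proof transfer
    fix a b :: real and u :: "'a \<Rightarrow> complex"
    assume "L2_eq u u"
    then have u: "sq_integrable u" by (simp add: L2_eq_def)
    have "(\<lambda>x. of_real (a + b) * u x) = (\<lambda>x. of_real a * u x + of_real b * u x)"
      by (simp add: distrib_right)
    then show "L2_eq (\<lambda>x. of_real (a + b) * u x) (\<lambda>x. of_real a * u x + of_real b * u x)"
      using sq_integrable_cmult[OF u, of "of_real (a + b)"] by (simp add: L2_eq_def)
  qed
  show "a *\<^sub>R b *\<^sub>R u = (a * b) *\<^sub>R u"
  proof transfer
    fix a b :: real and u :: "'a \<Rightarrow> complex"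
    assume "L2_eq u u"
    then have u: "sq_integrable u" by (simp add: L2_eq_def)
    show "L2_eq (\<lambda>x. of_real a * (of_real b * u x)) (\<lambda>x. of_real (a * b) * u x)"
      using sq_integrable_cmult[OF u, of "of_real (a * b)"] by (simp add: L2_eq_def mult.assoc)
  qed
  show "1 *\<^sub>R u = u"
    by transfer (simp add: L2_eq_def)
  show "dist u v = norm (u - v)"
    by (rule dist_L2_def)
  show "sgn u = inverse (norm u) *\<^sub>R u"
    by (rule sgn_L2_def)
  show "uniformity = (INF e\<in>{0<..}. principal {(x, y). dist (x::'a L2) y < e})"
    by (rule uniformity_L2_def)
  show "open U \<longleftrightarrow> (\<forall>x\<in>U. \<forall>\<^sub>F (x', y) in uniformity. x' = x \<longrightarrow> y \<in> U)" for U :: "'a L2 set"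
    by (rule open_L2_def)
  show "inner u v = inner v u"
  proof transfer
    fix u v :: "'a \<Rightarrow> complex"
    have "(LINT x|lborel. v x * cnj (u x)) = (LINT x|lborel. cnj (u x * cnj (v x)))"
      by (simp add: mult.commute)
    also have "\<dots> = cnj (LINT x|lborel. u x * cnj (v x))"
      by (rule Bochner_Integration.integral_cnj)
    finally show "Re (LINT x|lborel. u x * cnj (v x)) = Re (LINT x|lborel. v x * cnj (u x))"
      by simp
  qed
  show "inner (u + v) w = inner u w + inner v w"
    by transfer (simp add: L2_eq_def distrib_right integrable_mult_cnj)
  show "inner (a *\<^sub>R u) v = a * inner u v"
    by transfer (simp add: mult.assoc)
  have sq: "Re (LINT x|lborel. f x * cnj (f x)) = (LINT x|lborel. (cmod (f x))\<^sup>2)"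
    if "sq_integrable f" for f :: "'a \<Rightarrow> complex"
  proof -
    have "Re (f x * cnj (f x)) = (cmod (f x))\<^sup>2" for x
      by (simp add: complex_norm_square[symmetric])
    then show ?thesis
      using integral_Re[OF integrable_mult_cnj[OF that that]] by simp
  qed
  show "0 \<le> inner u u"
    by transfer (simp add: L2_eq_def sq)
  show "inner u u = 0 \<longleftrightarrow> u = 0"
  proof transfer
    fix u :: "'a \<Rightarrow> complex"
    assume "L2_eq u u"
    then have u: "sq_integrable u" by (simp add: L2_eq_def)
    then have i: "integrable lborel (\<lambda>x. (cmod (u x))\<^sup>2)" by (simp add: sq_integrable_def)
    have "(LINT x|lborel. (cmod (u x))\<^sup>2) = 0 \<longleftrightarrow> (AE x in lborel. (cmod (u x))\<^sup>2 = 0)"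
      by (rule integral_nonneg_eq_0_iff_AE[OF i]) simp
    then show "Re (LINT x|lborel. u x * cnj (u x)) = 0 \<longleftrightarrow> L2_eq u (\<lambda>x. 0)"
      unfolding sq[OF u] by (simp add: L2_eq_def u sq_integrable_zero)
  qed
  show "norm u = sqrt (inner u u)"
    by (rule norm_L2_def)
qed

end


section \<open>Fourier transform and Sobolev norms\<close>

definition fourier_integral :: "('a::euclidean_space \<Rightarrow> complex) \<Rightarrow> 'a \<Rightarrow> complex" where
  "fourier_integral f \<xi> = of_real ((2 * pi) powr (- real DIM('a) / 2)) *
     (LINT x|lborel. exp (- \<i> * of_real (inner x \<xi>)) * f x)"

text \<open>The Fourier--Plancherel transform: the limit in \<open>L2\<close>, as the radius tends to infinity, of
  the Fourier integrals of the truncations to balls.\<close>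

definition fourier :: "'a::euclidean_space L2 \<Rightarrow> 'a L2" where
  "fourier u = (THE v.
     ((\<lambda>r. \<integral>\<^sup>+\<xi>. ennreal ((cmod (fourier_integral (\<lambda>x. indicator (cball 0 r) x * rep_L2 u x) \<xi>
            - rep_L2 v \<xi>))\<^sup>2) \<partial>lborel) \<longlongrightarrow> 0) at_top)"

definition esqrt :: "ennreal \<Rightarrow> ennreal" where
  "esqrt x = (if x = \<top> then \<top> else ennreal (sqrt (enn2real x)))"

text \<open>The norm of the Sobolev space of order \<open>\<sigma>\<close>; it is infinite outside that space.\<close>

definition sobolev_norm :: "real \<Rightarrow> 'a::euclidean_space L2 \<Rightarrow> ennreal" where
  "sobolev_norm \<sigma> u = esqrt (\<integral>\<^sup>+\<xi>. ennreal ((1 + (norm \<xi>)\<^sup>2) powr \<sigma> *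
     (cmod (rep_L2 (fourier u) \<xi>))\<^sup>2) \<partial>lborel)"

definition sobolev :: "real \<Rightarrow> 'a::euclidean_space L2 set" where
  "sobolev \<sigma> = {u. sobolev_norm \<sigma> u < \<top>}"

text \<open>The graph of the Laplacian on \<open>L2\<close>, with domain the Sobolev space of order 2.\<close>

definition has_laplacian :: "'a::euclidean_space L2 \<Rightarrow> 'a L2 \<Rightarrow> bool" where
  "has_laplacian u w \<longleftrightarrow> u \<in> sobolev 2 \<and>
     (AE \<xi> in lborel. rep_L2 (fourier w) \<xi> = - of_real ((norm \<xi>)\<^sup>2) * rep_L2 (fourier u) \<xi>)"

definition unitary_group :: "(real \<Rightarrow> 'a::euclidean_space L2 \<Rightarrow>\<^sub>L 'a L2) \<Rightarrow> bool" where
  "unitary_group S \<longleftrightarrow>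
     S 0 = id_blinfun \<and> (\<forall>s t. S (s + t) = S s o\<^sub>L S t) \<and>
     (\<forall>u. continuous_on UNIV (\<lambda>t. S t u)) \<and>
     (\<forall>t c u. S t (cscale c u) = cscale c (S t u)) \<and>
     (\<forall>t u. norm (S t u) = norm u)"

text \<open>\<open>S\<close> is the unitary group with generator \<open>- \<i> \<Delta>\<close>, including equality of domains.\<close>

definition schroedinger_group :: "(real \<Rightarrow> 'a::euclidean_space L2 \<Rightarrow>\<^sub>L 'a L2) \<Rightarrow> bool" where
  "schroedinger_group S \<longleftrightarrow> unitary_group S \<and>
     (\<forall>u v. ((\<lambda>h. (1 / h) *\<^sub>R (S h u - u)) \<longlongrightarrow> v) (at 0) \<longleftrightarrow>
            (\<exists>w. has_laplacian u w \<and> v = cscale (- \<i>) w))"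


section \<open>Trace-class and Hilbert--Schmidt operators\<close>

definition orthonormal_basis :: "(nat \<Rightarrow> 'h::real_inner) \<Rightarrow> bool" where
  "orthonormal_basis e \<longleftrightarrow>
     (\<forall>i j. inner (e i) (e j) = (if i = j then 1 else 0)) \<and> closure (span (range e)) = UNIV"

definition nonneg_selfadjoint :: "('h::real_inner \<Rightarrow>\<^sub>L 'h) \<Rightarrow> bool" where
  "nonneg_selfadjoint A \<longleftrightarrow>
     (\<forall>x y. inner (A x) y = inner x (A y)) \<and> (\<forall>x. 0 \<le> inner (A x) x)"

text \<open>For nonnegative self-adjoint operators only.\<close>

definition trace_class :: "(nat \<Rightarrow> 'h::real_inner) \<Rightarrow> ('h \<Rightarrow>\<^sub>L 'h) \<Rightarrow> bool" where
  "trace_class e A \<longleftrightarrow> summable (\<lambda>j. inner (A (e j)) (e j))"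

definition is_sqrt_op :: "('h::real_inner \<Rightarrow>\<^sub>L 'h) \<Rightarrow> ('h \<Rightarrow>\<^sub>L 'h) \<Rightarrow> bool" where
  "is_sqrt_op R Q \<longleftrightarrow> nonneg_selfadjoint R \<and> R o\<^sub>L R = Q"

text \<open>The Hilbert--Schmidt norm of an operator into the Sobolev space of order \<open>\<sigma>\<close>, computed in
  the orthonormal basis \<open>e\<close>, and membership in the corresponding Hilbert--Schmidt class.\<close>

definition hs_norm :: "(nat \<Rightarrow> 'a::euclidean_space L2) \<Rightarrow> real \<Rightarrow> ('a L2 \<Rightarrow>\<^sub>L 'a L2) \<Rightarrow> ennreal" where
  "hs_norm e \<sigma> A = esqrt (\<Sum>j. (sobolev_norm \<sigma> (A (e j)))\<^sup>2)"

definition hilbert_schmidt ::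
  "(nat \<Rightarrow> 'a::euclidean_space L2) \<Rightarrow> real \<Rightarrow> ('a L2 \<Rightarrow>\<^sub>L 'a L2) \<Rightarrow> bool" where
  "hilbert_schmidt e \<sigma> A \<longleftrightarrow> (\<forall>x. A x \<in> sobolev \<sigma>) \<and> hs_norm e \<sigma> A < \<top>"


section \<open>Filtrations and Wiener processes\<close>

text \<open>Only times \<open>t \<ge> 0\<close> matter.\<close>

definition normal_filtration :: "'w measure \<Rightarrow> (real \<Rightarrow> 'w measure) \<Rightarrow> bool" where
  "normal_filtration M F \<longleftrightarrow>
     (\<forall>t\<ge>0. subalgebra M (F t)) \<and>
     (\<forall>s t. 0 \<le> s \<longrightarrow> s \<le> t \<longrightarrow> sets (F s) \<subseteq> sets (F t)) \<and>
     null_sets M \<subseteq> sets (F 0) \<and>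
     (\<forall>t\<ge>0. sets (F t) = (\<Inter>s\<in>{t<..}. sets (F s)))"

definition centered_normal :: "'w measure \<Rightarrow> ('w \<Rightarrow> real) \<Rightarrow> real \<Rightarrow> bool" where
  "centered_normal M X v \<longleftrightarrow>
     (if v = 0 then AE \<omega> in M. X \<omega> = 0
      else 0 < v \<and> distributed M lborel X (\<lambda>x. ennreal (normal_density 0 (sqrt v) x)))"

definition gaussian_with_covariance ::
  "'w measure \<Rightarrow> ('w \<Rightarrow> 'h::real_inner) \<Rightarrow> ('h \<Rightarrow>\<^sub>L 'h) \<Rightarrow> bool" where
  "gaussian_with_covariance M X Q \<longleftrightarrow>
     X \<in> borel_measurable M \<and>
     (\<forall>h. centered_normal M (\<lambda>\<omega>. inner (X \<omega>) h) (inner (Q h) h))"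

definition wiener_process ::
  "'w measure \<Rightarrow> (real \<Rightarrow> 'w measure) \<Rightarrow> ('h::real_inner \<Rightarrow>\<^sub>L 'h) \<Rightarrow> (real \<Rightarrow> 'w \<Rightarrow> 'h) \<Rightarrow> bool" where
  "wiener_process M F Q W \<longleftrightarrow>
     (AE \<omega> in M. W 0 \<omega> = 0) \<and>
     (AE \<omega> in M. continuous_on {0..} (\<lambda>t. W t \<omega>)) \<and>
     (\<forall>t\<ge>0. W t \<in> borel_measurable (F t)) \<and>
     (\<forall>s t. 0 \<le> s \<longrightarrow> s \<le> t \<longrightarrow>
        gaussian_with_covariance M (\<lambda>\<omega>. W t \<omega> - W s \<omega>) ((t - s) *\<^sub>R Q) \<and>
        prob_space.indep_set M (sets (F s))
          {(\<lambda>\<omega>. W t \<omega> - W s \<omega>) -` A \<inter> space M | A. A \<in> sets borel})"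


section \<open>The stochastic integral\<close>

text \<open>An elementary process on \<open>(0, t]\<close> takes the operator value \<open>\<Phi> m\<close> on
  \<open>(\<tau> m, \<tau> (Suc m)]\<close> for \<open>m < K\<close>.\<close>

definition elementary_process ::
  "(real \<Rightarrow> 'w measure) \<Rightarrow> real \<Rightarrow> nat \<Rightarrow> (nat \<Rightarrow> real) \<Rightarrow>
     (nat \<Rightarrow> 'w \<Rightarrow> 'h::real_normed_vector \<Rightarrow>\<^sub>L 'h) \<Rightarrow> bool" where
  "elementary_process F t K \<tau> \<Phi> \<longleftrightarrow>
     \<tau> 0 = 0 \<and> \<tau> K = t \<and>
     (\<forall>m<K. \<tau> m \<le> \<tau> (Suc m) \<and> simple_function (F (\<tau> m)) (\<Phi> m))"

definition elementary_value ::
  "nat \<Rightarrow> (nat \<Rightarrow> real) \<Rightarrow> (nat \<Rightarrow> 'w \<Rightarrow> 'h::real_normed_vector \<Rightarrow>\<^sub>L 'h) \<Rightarrow> real \<Rightarrow> 'w \<Rightarrow> 'h \<Rightarrow>\<^sub>L 'h" where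
  "elementary_value K \<tau> \<Phi> r \<omega> = (\<Sum>m<K. indicat_real {\<tau> m<..\<tau> (Suc m)} r *\<^sub>R \<Phi> m \<omega>)"

definition elementary_integral ::
  "(real \<Rightarrow> 'w \<Rightarrow> 'h) \<Rightarrow> nat \<Rightarrow> (nat \<Rightarrow> real) \<Rightarrow>
     (nat \<Rightarrow> 'w \<Rightarrow> 'h::real_normed_vector \<Rightarrow>\<^sub>L 'h) \<Rightarrow> 'w \<Rightarrow> 'h" where
  "elementary_integral W K \<tau> \<Phi> \<omega> = (\<Sum>m<K. \<Phi> m \<omega> (W (\<tau> (Suc m)) \<omega> - W (\<tau> m) \<omega>))"

text \<open>\<open>I\<close> is (a version of) the Ito integral of \<open>\<Psi>\<close> against \<open>W\<close> over \<open>[0, t]\<close>, where \<open>R\<close> is the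
  square root of the covariance operator and \<open>e\<close> an orthonormal basis: \<open>I\<close> is the mean square
  limit of integrals of elementary processes that converge to \<open>\<Psi>\<close> in the norm
  \<open>(E \<integral>\<^sub>0\<^sup>t \<parallel>\<Psi>(r) R\<parallel>\<^sup>2 dr)\<close> to the power \<open>1/2\<close>, the inner norm being the Hilbert--Schmidt norm.\<close>

definition has_stochastic_integral ::
  "'w measure \<Rightarrow> (real \<Rightarrow> 'w measure) \<Rightarrow> (real \<Rightarrow> 'w \<Rightarrow> 'h::real_inner) \<Rightarrow> ('h \<Rightarrow>\<^sub>L 'h) \<Rightarrow>
     (nat \<Rightarrow> 'h) \<Rightarrow> real \<Rightarrow> (real \<Rightarrow> 'w \<Rightarrow> 'h \<Rightarrow>\<^sub>L 'h) \<Rightarrow> ('w \<Rightarrow> 'h) \<Rightarrow> bool" where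
  "has_stochastic_integral M F W R e t \<Psi> I \<longleftrightarrow>
     I \<in> borel_measurable M \<and>
     (\<exists>K \<tau> \<Phi>.
        (\<forall>n. elementary_process F t (K n) (\<tau> n) (\<Phi> n)) \<and>
        (\<lambda>n. \<integral>\<^sup>+\<omega>. (\<integral>\<^sup>+r\<in>{0..t}. (\<Sum>j. ennreal ((norm
            ((elementary_value (K n) (\<tau> n) (\<Phi> n) r \<omega> - \<Psi> r \<omega>) (R (e j))))\<^sup>2)) \<partial>lborel) \<partial>M)
          \<longlonglongrightarrow> 0 \<and>
        (\<lambda>n. \<integral>\<^sup>+\<omega>. ennreal ((norm (elementary_integral W (K n) (\<tau> n) (\<Phi> n) \<omega> - I \<omega>))\<^sup>2) \<partial>M)
          \<longlonglongrightarrow> 0)"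


section \<open>The equation and its time discretisation\<close>

definition mild_solution ::
  "'w measure \<Rightarrow> (real \<Rightarrow> 'w measure) \<Rightarrow> (real \<Rightarrow> 'w \<Rightarrow> 'a::euclidean_space L2) \<Rightarrow>
     ('a L2 \<Rightarrow>\<^sub>L 'a L2) \<Rightarrow> (nat \<Rightarrow> 'a L2) \<Rightarrow> (real \<Rightarrow> 'a L2 \<Rightarrow>\<^sub>L 'a L2) \<Rightarrow>
     ('w \<Rightarrow> 'a L2) \<Rightarrow> (real \<Rightarrow> 'w \<Rightarrow> 'a L2) \<Rightarrow> bool" where
  "mild_solution M F W R e S u0 u \<longleftrightarrow>
     (\<forall>t\<ge>0. \<exists>I. has_stochastic_integral M F W R e t (\<lambda>r \<omega>. S (t - r)) I \<and>
        (AE \<omega> in M. u t \<omega> = S t (u0 \<omega>) - cscale \<i> (I \<omega>)))"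

primrec exp_integrator ::
  "(real \<Rightarrow> 'a::euclidean_space L2 \<Rightarrow>\<^sub>L 'a L2) \<Rightarrow> (real \<Rightarrow> 'w \<Rightarrow> 'a L2) \<Rightarrow> ('w \<Rightarrow> 'a L2) \<Rightarrow>
     real \<Rightarrow> nat \<Rightarrow> 'w \<Rightarrow> 'a L2" where
  "exp_integrator S W u0 k 0 \<omega> = u0 \<omega>"
| "exp_integrator S W u0 k (Suc n) \<omega> =
     S k (exp_integrator S W u0 k n \<omega>)
       - cscale \<i> (S k (W (real (Suc n) * k) \<omega> - W (real n * k) \<omega>))"

end

theory Submission
  imports Defs
begin

text \<open>The error at time \<open>t\<^sub>n\<close> is \<open>- \<i> S(t\<^sub>n) E\<^sub>n\<close>, where \<open>E\<^sub>n\<close> is the stochastic integral over \<open>[0, t\<^sub>n]\<close> of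
  the deterministic integrand equal to \<open>S(- t\<^sub>j) - S(- r)\<close> for \<open>r\<close> in \<open>(t\<^sub>j, t\<^bsub>j+1\<^esub>]\<close>. As \<open>S(t\<^sub>n)\<close> preserves
  the Sobolev norm, \<open>E\<^sub>n\<close> may be estimated instead, and it is a martingale in \<open>n\<close>. On the Fourier side \<open>S(t)\<close> is
  multiplication by \<open>exp (\<i> t |\<xi>|\<^sup>2)\<close>, so the integrand is bounded by \<open>k\<close> as an operator from order
  \<open>\<sigma> + 2\<close> to order \<open>\<sigma>\<close>. Every coordinate of \<open>E\<^sub>n\<close> in (a spectral truncation of) the Sobolev space is a limit of
  Gaussian random walks, obtained from Riemann sums of the integral on finer grids. Doob's inequality and
  the Gaussian moments bound the maximum of each walk by its variance, and the variances of the
  coordinates add up to at most \<open>T k\<^sup>2\<close> times the squared Hilbert--Schmidt norm.\<close>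

section \<open>Gaussian random walks\<close>

text \<open>The integrand of the error is deterministic, so scalar functionals of the error are
  Gaussian and their moments of order 2p are governed by variances; second-moment computations thus
  do the work of a Burkholder-Davis-Gundy inequality. The obstacle is the definition of the
  stochastic integral: it is a mean square limit in \<open>L2\<close> of some unspecified elementary
  integrals, chosen separately for each final time, so neither Sobolev regularity nor a martingale
  in \<open>n\<close> is given. A frequency cutoff makes the Sobolev norm continuous on
  \<open>L2\<close>, so that it can be applied to the integral; finitely many coordinates leave
  real-valued processes; and on a fine time mesh one walk serves all times simultaneously. No bound
  depends on the cutoff, the number of coordinates or the mesh, which lets Fatou's lemma remove all
  three. Coordinates are recombined by Minkowski's inequality for their squares, so only the sum of
  the variances enters and no factor grows with the number of coordinates.\<close>

fun running_max :: "(nat \<Rightarrow> real) \<Rightarrow> nat \<Rightarrow> real" where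
  "running_max Z 0 = Z 0"
| "running_max Z (Suc n) = max (running_max Z n) (Z (Suc n))"

lemma le_running_max: "i \<le> n \<Longrightarrow> Z i \<le> running_max Z n"
proof (induction n)
  case (Suc n)
  then show ?case by (cases "i = Suc n") (auto simp: le_Suc_eq)
qed auto

text \<open>Taking expectations gives Doob's \<open>L\<^sup>2\<close> inequality: for a nonnegative submartingale the sum on the
  right is a martingale transform with nonnegative expectation.\<close>

lemma pathwise_doob:
  assumes "\<And>i. 0 \<le> Z i"
  shows "(running_max Z n)\<^sup>2 \<le> 4 * (Z n)\<^sup>2 - 4 * (\<Sum>i<n. running_max Z i * (Z (Suc i) - Z i))"
proof -
  \<comment> \<open>Discrete summation by parts: while the maximum stays put both sides grow
    equally, and when it rises to \<open>?z\<close> the right side gains an excess of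
    \<open>(?z - ?Y)\<^sup>2 / 2\<close>.\<close>
  have *: "(running_max Z n)\<^sup>2 / 2 + (\<Sum>i<n. running_max Z i * (Z (Suc i) - Z i))
      \<le> running_max Z n * Z n"
  proof (induction n)
    case 0
    then show ?case using zero_le_power2[of "Z 0"] by (simp add: power2_eq_square)
  next
    case (Suc n)
    let ?Y = "running_max Z n" and ?z = "Z (Suc n)"
    have "(max ?Y ?z)\<^sup>2 / 2 - ?Y\<^sup>2 / 2 + ?Y * ?z \<le> max ?Y ?z * ?z"
    proof (cases "?z \<le> ?Y")
      case False
      then show ?thesis
        using zero_le_power2[of "?Y - ?z"] by (simp add: max_def power2_eq_square algebra_simps)
    qed (simp add: max_def)
    with Suc.IH show ?case by (simp add: algebra_simps)
  qed
  \<comment> \<open>Young's inequality leaves a quarter of the squared maximum on the left, whence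
    the factor 4.\<close>
  have "running_max Z n * Z n \<le> (running_max Z n)\<^sup>2 / 4 + (Z n)\<^sup>2"
    using zero_le_power2[of "running_max Z n / 2 - Z n"]
    by (simp add: power2_eq_square algebra_simps)
  with * show ?thesis by linarith
qed

text \<open>Tangent line of a convex function at \<open>a\<close>; dividing by
  \<open>\<bar>a\<bar> ^ p\<close> reduces it to Bernoulli's inequality. It serves twice, for the
  increments of powers of a walk and for Jensen's inequality.\<close>

lemma abs_power_tangent:
  fixes a b :: real
  assumes "p \<ge> 1"
  shows "\<bar>a\<bar> ^ p + real p * (\<bar>a\<bar> ^ (p - 1) * sgn a) * b \<le> \<bar>a + b\<bar> ^ p"
proof (cases "a = 0")
  case False
  define x where "x = b / a"
  have b: "b = a * x" using False by (simp add: x_def)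
  have sa: "sgn a * a = \<bar>a\<bar>" by (simp add: abs_sgn mult.commute)
  have ap: "\<bar>a\<bar> ^ p = \<bar>a\<bar> ^ (p - 1) * \<bar>a\<bar>"
    using assms by (cases p) auto
  have "real p * (\<bar>a\<bar> ^ (p - 1) * sgn a) * b = real p * x * \<bar>a\<bar> ^ (p - 1) * (sgn a * a)"
    by (simp add: b)
  also have "\<dots> = real p * x * \<bar>a\<bar> ^ p"
    unfolding sa ap by simp
  finally have l: "\<bar>a\<bar> ^ p + real p * (\<bar>a\<bar> ^ (p - 1) * sgn a) * b = \<bar>a\<bar> ^ p * (1 + real p * x)"
    by (simp add: algebra_simps)
  have r: "\<bar>a + b\<bar> ^ p = \<bar>a\<bar> ^ p * \<bar>1 + x\<bar> ^ p"
    by (simp add: b power_mult_distrib[symmetric] abs_mult[symmetric] distrib_left)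
  \<comment> \<open>Bernoulli covers \<open>x \<ge> -1\<close>; below that the left side is at most
    \<open>1 + x\<close>, hence negative.\<close>
  have "1 + real p * x \<le> \<bar>1 + x\<bar> ^ p"
  proof (cases "x \<ge> -1")
    case True
    then show ?thesis using Bernoulli_inequality[of x p] by simp
  next
    case False
    then have "1 + real p * x \<le> 1 + 1 * x"
      using assms by (intro add_left_mono mult_right_mono_neg) auto
    also have "\<dots> \<le> 0" using False by simp
    also have "0 \<le> \<bar>1 + x\<bar> ^ p" by simp
    finally show ?thesis .
  qed
  then show ?thesis unfolding l r by (intro mult_left_mono) auto
next
  case True
  then show ?thesis using assms by (auto simp: zero_power)
qed

section \<open>Random variables with finite moments of every order\<close>

text \<open>Demanding all moments at once gives a class closed under sums, products and maxima, so
  integrability of the polynomial expressions below follows from their shape.\<close>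

definition has_moments :: "'w measure \<Rightarrow> ('w \<Rightarrow> real) \<Rightarrow> bool" where
  "has_moments M X \<longleftrightarrow> X \<in> borel_measurable M \<and> (\<forall>k. integrable M (\<lambda>\<omega>. \<bar>X \<omega>\<bar> ^ k))"

lemma has_moments_measurable: "has_moments M X \<Longrightarrow> X \<in> borel_measurable M"
  by (simp add: has_moments_def)

lemma has_moments_integrable_power: "has_moments M X \<Longrightarrow> integrable M (\<lambda>\<omega>. \<bar>X \<omega>\<bar> ^ k)"
  unfolding has_moments_def by blast

lemma has_moments_bound:
  assumes "has_moments M X" "Y \<in> borel_measurable M" "\<And>\<omega>. \<bar>Y \<omega>\<bar> \<le> \<bar>X \<omega>\<bar>"
  shows "has_moments M Y"
  unfolding has_moments_def
proof (intro conjI allI)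
  fix k
  have "norm (\<bar>Y \<omega>\<bar> ^ k) \<le> norm (\<bar>X \<omega>\<bar> ^ k)" for \<omega>
    unfolding norm_power by (rule power_mono) (use assms(3) in auto)
  then show "integrable M (\<lambda>\<omega>. \<bar>Y \<omega>\<bar> ^ k)"
    by (intro Bochner_Integration.integrable_bound[OF has_moments_integrable_power[OF assms(1)]]
        AE_I2 borel_measurable_power borel_measurable_abs assms(2))
qed (fact assms)

lemma has_moments_add:
  assumes "has_moments M X" "has_moments M Y"
  shows "has_moments M (\<lambda>\<omega>. X \<omega> + Y \<omega>)"
  unfolding has_moments_def
proof (intro conjI allI)
  fix k
  have [measurable]: "X \<in> borel_measurable M" "Y \<in> borel_measurable M"
    using assms by (auto simp: has_moments_def)
  have "\<bar>x + y\<bar> ^ k \<le> 2 ^ k * (\<bar>x\<bar> ^ k + \<bar>y\<bar> ^ k)" for x y :: real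
  proof -
    have "\<bar>x + y\<bar> ^ k \<le> (2 * max \<bar>x\<bar> \<bar>y\<bar>) ^ k" by (intro power_mono) auto
    also have "\<dots> = 2 ^ k * max \<bar>x\<bar> \<bar>y\<bar> ^ k" by (simp add: power_mult_distrib)
    also have "\<dots> \<le> 2 ^ k * (\<bar>x\<bar> ^ k + \<bar>y\<bar> ^ k)"
      by (intro mult_left_mono) (auto simp: max_def)
    finally show ?thesis .
  qed
  then have *: "norm (\<bar>x + y\<bar> ^ k) \<le> norm (2 ^ k * (\<bar>x\<bar> ^ k + \<bar>y\<bar> ^ k))" for x y :: real
    by (smt (verit) abs_ge_zero real_norm_def zero_le_power)
  have "integrable M (\<lambda>\<omega>. 2 ^ k * (\<bar>X \<omega>\<bar> ^ k + \<bar>Y \<omega>\<bar> ^ k))"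
    by (intro integrable_mult_right Bochner_Integration.integrable_add)
       (intro has_moments_integrable_power assms)+
  then show "integrable M (\<lambda>\<omega>. \<bar>X \<omega> + Y \<omega>\<bar> ^ k)"
    by (rule Bochner_Integration.integrable_bound) (measurable, rule AE_I2, rule *)
qed (use assms in \<open>auto simp: has_moments_def\<close>)

lemma has_moments_mult:
  assumes "has_moments M X" "has_moments M Y"
  shows "has_moments M (\<lambda>\<omega>. X \<omega> * Y \<omega>)"
  unfolding has_moments_def
proof (intro conjI allI)
  fix k
  have [measurable]: "X \<in> borel_measurable M" "Y \<in> borel_measurable M"
    using assms by (auto simp: has_moments_def)
  have "\<bar>x * y\<bar> ^ k \<le> \<bar>x\<bar> ^ (2 * k) + \<bar>y\<bar> ^ (2 * k)" for x y :: real
  proof -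
    have "0 \<le> \<bar>x\<bar> ^ k * \<bar>y\<bar> ^ k" by simp
    then show ?thesis using zero_le_power2[of "\<bar>x\<bar> ^ k - \<bar>y\<bar> ^ k"]
      unfolding power2_diff power_even_eq abs_mult power_mult_distrib by linarith
  qed
  then have *: "norm (\<bar>x * y\<bar> ^ k) \<le> norm (\<bar>x\<bar> ^ (2 * k) + \<bar>y\<bar> ^ (2 * k))" for x y :: real
    by (smt (verit) abs_ge_zero real_norm_def zero_le_power)
  have "integrable M (\<lambda>\<omega>. \<bar>X \<omega>\<bar> ^ (2 * k) + \<bar>Y \<omega>\<bar> ^ (2 * k))"
    by (intro Bochner_Integration.integrable_add)
       (intro has_moments_integrable_power assms)+
  then show "integrable M (\<lambda>\<omega>. \<bar>X \<omega> * Y \<omega>\<bar> ^ k)"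
    by (rule Bochner_Integration.integrable_bound) (measurable, rule AE_I2, rule *)
qed (use assms in \<open>auto simp: has_moments_def\<close>)

lemma has_moments_abs: "has_moments M X \<Longrightarrow> has_moments M (\<lambda>\<omega>. \<bar>X \<omega>\<bar>)"
  by (rule has_moments_bound) (auto simp: has_moments_def)

lemma has_moments_max:
  assumes "has_moments M X" "has_moments M Y"
  shows "has_moments M (\<lambda>\<omega>. max (X \<omega>) (Y \<omega>))"
  by (rule has_moments_bound[OF has_moments_add[OF assms[THEN has_moments_abs]]])
     (use assms in \<open>auto simp: has_moments_def\<close>)

lemma (in prob_space) has_moments_const: "has_moments M (\<lambda>_. c)"
  by (auto simp: has_moments_def)

lemma (in prob_space) has_moments_power:
  "has_moments M X \<Longrightarrow> has_moments M (\<lambda>\<omega>. X \<omega> ^ k)"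
  by (induction k) (auto intro: has_moments_const has_moments_mult)

lemma (in prob_space) has_moments_cmult: "has_moments M X \<Longrightarrow> has_moments M (\<lambda>\<omega>. c * X \<omega>)"
  by (intro has_moments_mult has_moments_const)

lemma (in prob_space) has_moments_diff:
  "has_moments M X \<Longrightarrow> has_moments M Y \<Longrightarrow> has_moments M (\<lambda>\<omega>. X \<omega> - Y \<omega>)"
  using has_moments_add[of M X "\<lambda>\<omega>. -1 * Y \<omega>"] has_moments_cmult[of Y "-1"] by simp

lemma (in prob_space) has_moments_sgn:
  "X \<in> borel_measurable M \<Longrightarrow> has_moments M (\<lambda>\<omega>. sgn (X \<omega>) :: real)"
  by (rule has_moments_bound[OF has_moments_const[of 1]]) (auto simp: abs_sgn_eq)

lemma (in prob_space) has_moments_indicator: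
  "A \<in> events \<Longrightarrow> has_moments M (indicator A)"
  by (rule has_moments_bound[OF has_moments_const[of 1]]) (auto simp: indicator_def)

lemma (in prob_space) has_moments_sum:
  "(\<And>i. i \<in> I \<Longrightarrow> has_moments M (X i)) \<Longrightarrow> has_moments M (\<lambda>\<omega>. \<Sum>i\<in>I. X i \<omega>)"
  by (induction I rule: infinite_finite_induct) (auto intro: has_moments_const has_moments_add)

lemma has_moments_integrable: "has_moments M X \<Longrightarrow> integrable M X"
proof -
  assume *: "has_moments M X"
  then have "integrable M (\<lambda>\<omega>. \<bar>X \<omega>\<bar> ^ 1)" unfolding has_moments_def by blast
  with * show "integrable M X" by (simp add: has_moments_def integrable_abs_iff)
qed

section \<open>Moments and sums of centred normal variables\<close>

text \<open>The double factorial (2p - 1)!!, which is the moment of order 2p of the standard normal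
  law.\<close>

definition gauss_moment :: "nat \<Rightarrow> real" where
  "gauss_moment p = fact (2 * p) / (2 ^ p * fact p)"

lemma gauss_moment_nonneg: "0 \<le> gauss_moment p"
  by (simp add: gauss_moment_def)

context prob_space
begin

lemma centered_normal_has_moments:
  assumes "centered_normal M X v" and [measurable]: "X \<in> borel_measurable M"
  shows "has_moments M X"
proof (cases "v = 0")
  case True
  then have ae: "AE \<omega> in M. X \<omega> = 0" using assms by (simp add: centered_normal_def)
  have "integrable M (\<lambda>\<omega>. \<bar>X \<omega>\<bar> ^ k)" for k
  proof -
    have "integrable M (\<lambda>\<omega>. \<bar>0::real\<bar> ^ k)" by simp
    moreover have "AE \<omega> in M. \<bar>0::real\<bar> ^ k = \<bar>X \<omega>\<bar> ^ k" using ae by auto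
    ultimately show ?thesis
      by (subst integrable_cong_AE[where g="\<lambda>\<omega>. \<bar>0::real\<bar> ^ k"]) auto
  qed
  then show ?thesis by (simp add: has_moments_def)
next
  case False
  then have v: "0 < v" and d: "distributed M lborel X (\<lambda>x. ennreal (normal_density 0 (sqrt v) x))"
    using assms by (auto simp: centered_normal_def)
  have "integrable M (\<lambda>\<omega>. \<bar>X \<omega>\<bar> ^ k)" for k
    using distributed_integrable[OF d, of "\<lambda>x. \<bar>x\<bar> ^ k"]
      integrable_normal_moment_abs[of "sqrt v" 0 k] v by simp
  then show ?thesis by (simp add: has_moments_def)
qed

lemma centered_normal_even_moment:
  assumes "centered_normal M X v" and [measurable]: "X \<in> borel_measurable M" and p: "p \<ge> 1"
  shows "(\<integral>\<omega>. X \<omega> ^ (2 * p) \<partial>M) = gauss_moment p * v ^ p"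
proof (cases "v = 0")
  case True
  then have ae: "AE \<omega> in M. X \<omega> = 0" using assms by (simp add: centered_normal_def)
  have "(\<integral>\<omega>. X \<omega> ^ (2 * p) \<partial>M) = (\<integral>\<omega>. 0 \<partial>M)"
    by (rule integral_cong_AE) (use ae p in auto)
  then show ?thesis using True p by simp
next
  case False
  then have v: "0 < v" and d: "distributed M lborel X (\<lambda>x. ennreal (normal_density 0 (sqrt v) x))"
    using assms by (auto simp: centered_normal_def)
  have "(\<integral>\<omega>. X \<omega> ^ (2 * p) \<partial>M) = (\<integral>x. normal_density 0 (sqrt v) x * (x - 0) ^ (2 * p) \<partial>lborel)"
    using distributed_integral[OF d, of "\<lambda>x. x ^ (2 * p)"] by simp
  also have "\<dots> = fact (2 * p) / ((2 / (sqrt v)\<^sup>2) ^ p * fact p)"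
    by (rule integral_normal_moment_even) (use v in simp)
  finally show ?thesis using v by (simp add: gauss_moment_def power_divide field_simps)
qed

lemma centered_normal_mean:
  assumes "centered_normal M X v" and [measurable]: "X \<in> borel_measurable M"
  shows "(\<integral>\<omega>. X \<omega> \<partial>M) = 0"
proof (cases "v = 0")
  case True
  then have ae: "AE \<omega> in M. X \<omega> = 0" using assms by (simp add: centered_normal_def)
  have "(\<integral>\<omega>. X \<omega> \<partial>M) = (\<integral>\<omega>. 0 \<partial>M)"
    by (rule integral_cong_AE) (use ae in auto)
  then show ?thesis by simp
next
  case False
  then have v: "0 < v" and d: "distributed M lborel X (\<lambda>x. ennreal (normal_density 0 (sqrt v) x))"
    using assms by (auto simp: centered_normal_def)
  have "(\<integral>\<omega>. X \<omega> \<partial>M) = (\<integral>x. normal_density 0 (sqrt v) x * x \<partial>lborel)"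
    using distributed_integral[OF d, of "\<lambda>x. x"] by simp
  also have "\<dots> = 0" using integral_normal_moment_nz_1[of "sqrt v" 0] v by simp
  finally show ?thesis .
qed

lemma centered_normal_cong_AE:
  assumes "centered_normal M X v" "AE \<omega> in M. X \<omega> = Y \<omega>"
    and [measurable]: "X \<in> borel_measurable M" "Y \<in> borel_measurable M"
  shows "centered_normal M Y v"
proof (cases "v = 0")
  case True
  have "AE \<omega> in M. X \<omega> = 0" using assms True by (simp add: centered_normal_def)
  with assms(2) have "AE \<omega> in M. Y \<omega> = 0" by eventually_elim simp
  with True show ?thesis by (simp add: centered_normal_def)
next
  case False
  have "distr M lborel X = distr M lborel Y"
    by (rule distr_cong_AE) (use assms in auto)
  with False assms(1) show ?thesis
    by (auto simp: centered_normal_def distributed_def)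
qed

text \<open>The case split isolates variance zero, where there is no density and the sum agrees
  almost surely with the other summand.\<close>

lemma centered_normal_add:
  assumes "indep_var borel X borel Y" "centered_normal M X v" "centered_normal M Y w"
  shows "centered_normal M (\<lambda>\<omega>. X \<omega> + Y \<omega>) (v + w)"
proof -
  have [measurable]: "X \<in> borel_measurable M" "Y \<in> borel_measurable M"
    using assms(1) by (auto dest: indep_var_rv1 indep_var_rv2)
  consider "v = 0" | "w = 0" | "v \<noteq> 0" "w \<noteq> 0" by blast
  then show ?thesis
  proof cases
    case 1
    then have "AE \<omega> in M. X \<omega> = 0" using assms by (simp add: centered_normal_def)
    then have "AE \<omega> in M. Y \<omega> = X \<omega> + Y \<omega>" by eventually_elim simp
    from centered_normal_cong_AE[OF assms(3) this] 1 show ?thesis by simp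
  next
    case 2
    then have "AE \<omega> in M. Y \<omega> = 0" using assms by (simp add: centered_normal_def)
    then have "AE \<omega> in M. X \<omega> = X \<omega> + Y \<omega>" by eventually_elim simp
    from centered_normal_cong_AE[OF assms(2) this] 2 show ?thesis by simp
  next
    case 3
    then have p: "0 < v" "0 < w"
      and d: "distributed M lborel X (\<lambda>x. ennreal (normal_density 0 (sqrt v) x))"
        "distributed M lborel Y (\<lambda>x. ennreal (normal_density 0 (sqrt w) x))"
      using assms(2,3) by (auto simp: centered_normal_def)
    from add_indep_normal[OF assms(1) _ _ d] p show ?thesis
      by (auto simp: centered_normal_def)
  qed
qed

lemma indep_var_expectation_zero:
  assumes "indep_var borel X borel Y" "has_moments M X" "has_moments M Y" "(\<integral>\<omega>. Y \<omega> \<partial>M) = 0"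
  shows "(\<integral>\<omega>. X \<omega> * Y \<omega> \<partial>M) = 0"
  using indep_var_lebesgue_integral[OF assms(1)] has_moments_integrable[OF assms(2)]
    has_moments_integrable[OF assms(3)] assms(4) by simp

end

section \<open>Doob's inequality for Gaussian walks\<close>

lemma measurable_filtration_mono:
  assumes "\<And>i. sets (G i) \<subseteq> sets (G (Suc i))" "\<And>i. space (G i) = A"
    and "i \<le> j" "X \<in> borel_measurable (G i)"
  shows "X \<in> borel_measurable (G j)"
proof -
  have "sets (G i) \<subseteq> sets (G j)"
    by (rule lift_Suc_mono_le[of "\<lambda>i. sets (G i)"]) (use assms in auto)
  then show ?thesis
    using assms(4) unfolding measurable_def by (auto simp: assms(2))
qed

lemma running_max_measurable:
  assumes "\<And>i. i \<le> n \<Longrightarrow> Z i \<in> borel_measurable N"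
  shows "(\<lambda>\<omega>. running_max (\<lambda>i. Z i \<omega>) n) \<in> borel_measurable N"
  using assms by (induction n) auto

text \<open>Independence is required from everything measurable at time \<open>i\<close>, because
  the martingale transform in Doob's inequality multiplies \<open>z i\<close> by a function of the
  whole past.\<close>

locale gaussian_walk = prob_space +
  fixes G :: "nat \<Rightarrow> 'a measure" and z :: "nat \<Rightarrow> 'a \<Rightarrow> real" and v :: "nat \<Rightarrow> real"
  assumes G_sub: "subalgebra M (G i)"
    and G_mono: "sets (G i) \<subseteq> sets (G (Suc i))"
    and z_adapted: "z i \<in> borel_measurable (G (Suc i))"
    and z_normal: "centered_normal M (z i) (v i)"
    and z_indep: "X \<in> borel_measurable (G i) \<Longrightarrow> indep_var borel X borel (z i)"
begin

abbreviation walk :: "nat \<Rightarrow> 'a \<Rightarrow> real" where "walk n \<omega> \<equiv> \<Sum>i<n. z i \<omega>"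

lemma G_measurable: "i \<le> j \<Longrightarrow> X \<in> borel_measurable (G i) \<Longrightarrow> X \<in> borel_measurable (G j)"
  using measurable_filtration_mono[of G "space M" i j X] G_sub G_mono
  by (auto simp: subalgebra_def)

lemma z_measurable: "z i \<in> borel_measurable M"
  using measurable_from_subalg[OF G_sub z_adapted] .

lemma walk_adapted: "walk n \<in> borel_measurable (G n)"
proof (rule borel_measurable_sum)
  fix i assume "i \<in> {..<n}"
  then show "z i \<in> borel_measurable (G n)" by (intro G_measurable[OF _ z_adapted]) simp
qed

lemma walk_measurable: "walk n \<in> borel_measurable M"
  using measurable_from_subalg[OF G_sub walk_adapted] .

lemma walk_normal: "centered_normal M (walk n) (\<Sum>i<n. v i)"
proof (induction n)
  case 0
  then show ?case by (simp add: centered_normal_def)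
next
  case (Suc n)
  from centered_normal_add[OF z_indep[OF walk_adapted] this z_normal] show ?case by simp
qed

lemma walk_has_moments: "has_moments M (walk n)"
  using centered_normal_has_moments[OF walk_normal walk_measurable] .

text \<open>Doob's inequality for the submartingale \<open>\<bar>walk i\<bar> ^ p\<close>. The
  tangent line replaces its increments by multiples of \<open>z i\<close> whose coefficients
  \<open>D i\<close> are known at time \<open>i\<close>, so the transform has mean zero, and the
  terminal term is a Gaussian moment.\<close>

lemma walk_max_expectation:
  assumes p: "p \<ge> 1"
  shows "has_moments M (\<lambda>\<omega>. (running_max (\<lambda>i. \<bar>walk i \<omega>\<bar> ^ p) n)\<^sup>2)"
    and "(\<integral>\<omega>. (running_max (\<lambda>i. \<bar>walk i \<omega>\<bar> ^ p) n)\<^sup>2 \<partial>M)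
      \<le> 4 * gauss_moment p * (\<Sum>i<n. v i) ^ p"
proof -
  let ?Z = "\<lambda>\<omega> i. \<bar>walk i \<omega>\<bar> ^ p"
  define Y where "Y = (\<lambda>i \<omega>. running_max (?Z \<omega>) i)"
  define D where "D = (\<lambda>i \<omega>. Y i \<omega> * (real p * (\<bar>walk i \<omega>\<bar> ^ (p - 1) * sgn (walk i \<omega>))))"
  let ?S = "\<lambda>\<omega>. \<Sum>i<n. Y i \<omega> * (\<bar>walk (Suc i) \<omega>\<bar> ^ p - \<bar>walk i \<omega>\<bar> ^ p)"
  have hp: "has_moments M (\<lambda>\<omega>. \<bar>walk i \<omega>\<bar> ^ p)" for i p
    by (intro has_moments_power has_moments_abs walk_has_moments)
  have hY: "has_moments M (Y i)" for i
    unfolding Y_def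
  proof (induction i)
    case (Suc i)
    then show ?case using has_moments_max[OF Suc hp[of "Suc i" p]] by simp
  qed (use hp[of 0 p] in simp)
  show "has_moments M (\<lambda>\<omega>. (running_max (?Z \<omega>) n)\<^sup>2)"
    using has_moments_power[OF hY[of n], of 2] by (simp add: Y_def)
  have Dm: "D i \<in> borel_measurable (G i)" for i
  proof -
    have w: "walk j \<in> borel_measurable (G i)" if "j \<le> i" for j
      using G_measurable[OF that walk_adapted] .
    have "Y i \<in> borel_measurable (G i)"
      unfolding Y_def
      by (rule running_max_measurable, intro borel_measurable_power borel_measurable_abs w)
    moreover note w[of i]
    ultimately show ?thesis unfolding D_def by (intro borel_measurable_times) auto
  qed
  have hD: "has_moments M (D i)" for i
    unfolding D_def
    by (intro has_moments_mult has_moments_const hY hp has_moments_sgn walk_measurable)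
  have hz: "has_moments M (z i)" for i
    using centered_normal_has_moments[OF z_normal z_measurable] .
  have zero: "(\<integral>\<omega>. D i \<omega> * z i \<omega> \<partial>M) = 0" for i
    by (rule indep_var_expectation_zero[OF z_indep[OF Dm] hD hz
          centered_normal_mean[OF z_normal z_measurable]])
  have Y0: "0 \<le> Y i \<omega>" for i \<omega>
    using le_running_max[of 0 i "?Z \<omega>"] p
    unfolding Y_def by (simp add: zero_power)
  have "(Y n \<omega>)\<^sup>2 \<le> 4 * walk n \<omega> ^ (2 * p) - 4 * (\<Sum>i<n. D i \<omega> * z i \<omega>)" for \<omega>
  proof -
    have "(Y n \<omega>)\<^sup>2 \<le> 4 * (\<bar>walk n \<omega>\<bar> ^ p)\<^sup>2
        - 4 * ?S \<omega>"
      unfolding Y_def by (rule pathwise_doob) simp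
    also have "(\<bar>walk n \<omega>\<bar> ^ p)\<^sup>2 = walk n \<omega> ^ (2 * p)"
      by (simp add: power_even_eq flip: power_abs)
    finally have 1: "(Y n \<omega>)\<^sup>2 \<le> 4 * walk n \<omega> ^ (2 * p)
        - 4 * ?S \<omega>" .
    \<comment> \<open>As \<open>Y i\<close> is nonnegative, the tangent inequality survives
      multiplication by it. The sum occurs with a minus sign in the pathwise bound, so a lower bound
      is what is wanted.\<close>
    have "(\<Sum>i<n. D i \<omega> * z i \<omega>) \<le> ?S \<omega>"
    proof (rule sum_mono)
      fix i
      have "\<bar>walk i \<omega>\<bar> ^ p + real p * (\<bar>walk i \<omega>\<bar> ^ (p - 1) * sgn (walk i \<omega>)) * z i \<omega>
          \<le> \<bar>walk (Suc i) \<omega>\<bar> ^ p"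
        using abs_power_tangent[OF p, of "walk i \<omega>" "z i \<omega>"] by simp
      then have "Y i \<omega> * (real p * (\<bar>walk i \<omega>\<bar> ^ (p - 1) * sgn (walk i \<omega>)) * z i \<omega>)
          \<le> Y i \<omega> * (\<bar>walk (Suc i) \<omega>\<bar> ^ p - \<bar>walk i \<omega>\<bar> ^ p)"
        by (intro mult_left_mono Y0) linarith
      then show "D i \<omega> * z i \<omega> \<le> Y i \<omega> * (\<bar>walk (Suc i) \<omega>\<bar> ^ p - \<bar>walk i \<omega>\<bar> ^ p)"
        by (simp add: D_def mult.assoc)
    qed
    with 1 show ?thesis by linarith
  qed
  moreover have "has_moments M (\<lambda>\<omega>. (Y n \<omega>)\<^sup>2)" using has_moments_power[OF hY] .
  moreover have h1: "has_moments M (\<lambda>\<omega>. walk n \<omega> ^ (2 * p))"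
    using has_moments_power[OF walk_has_moments] .
  moreover have h2: "has_moments M (\<lambda>\<omega>. D i \<omega> * z i \<omega>)" for i
    by (rule has_moments_mult[OF hD hz])
  ultimately have "(\<integral>\<omega>. (Y n \<omega>)\<^sup>2 \<partial>M)
      \<le> (\<integral>\<omega>. 4 * walk n \<omega> ^ (2 * p) - 4 * (\<Sum>i<n. D i \<omega> * z i \<omega>) \<partial>M)"
    by (intro integral_mono has_moments_integrable has_moments_diff has_moments_cmult has_moments_sum)
  also have "\<dots> = 4 * (\<integral>\<omega>. walk n \<omega> ^ (2 * p) \<partial>M) - 4 * (\<Sum>i<n. \<integral>\<omega>. D i \<omega> * z i \<omega> \<partial>M)"
    using has_moments_integrable[OF h1] has_moments_integrable[OF h2] by simp
  also have "\<dots> = 4 * gauss_moment p * (\<Sum>i<n. v i) ^ p"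
    using centered_normal_even_moment[OF walk_normal walk_measurable p] by (simp add: zero)
  finally show "(\<integral>\<omega>. (running_max (?Z \<omega>) n)\<^sup>2 \<partial>M)
      \<le> 4 * gauss_moment p * (\<Sum>i<n. v i) ^ p"
    by (simp add: Y_def)
qed

end

section \<open>Convexity and the sum over coordinates\<close>

text \<open>Jensen's inequality for the weights \<open>w m / W\<close>: the tangent is taken at the
  weighted mean \<open>t\<close> of the quotients \<open>a m / w m\<close>, and its linear part
  cancels in the sum.\<close>

lemma power_sum_le_weighted:
  fixes a w :: "nat \<Rightarrow> real"
  assumes p: "p \<ge> 1" and w: "\<And>m. m < J \<Longrightarrow> 0 < w m" and a: "\<And>m. m < J \<Longrightarrow> 0 \<le> a m"
    and W: "W = (\<Sum>m<J. w m)" and J: "0 < J"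
  shows "(\<Sum>m<J. a m) ^ p \<le> W ^ (p - 1) * (\<Sum>m<J. w m * (a m / w m) ^ p)"
proof -
  have W0: "0 < W" unfolding W using w J by (intro sum_pos) auto
  define t where "t = (\<Sum>m<J. a m) / W"
  have t0: "0 \<le> t" using W0 a by (auto simp: t_def intro!: divide_nonneg_pos sum_nonneg)
  have "(\<Sum>m<J. w m * (t ^ p + real p * t ^ (p - 1) * (a m / w m - t))) \<le> (\<Sum>m<J. w m * (a m / w m) ^ p)"
  proof (intro sum_mono mult_left_mono)
    fix m assume m: "m \<in> {..<J}"
    then have x: "0 \<le> a m / w m" using a w by (auto intro!: divide_nonneg_pos)
    \<comment> \<open>At \<open>t = 0\<close> the factor \<open>sgn t\<close> of the tangent
      inequality vanishes, which for p = 1 is the wrong slope; that case is checked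
      directly.\<close>
    have "t ^ (p - 1) * sgn t * (a m / w m - t) * real p \<ge> t ^ (p - 1) * (a m / w m - t) * real p
      \<or> t = 0" using t0 by auto
    then show "t ^ p + real p * t ^ (p - 1) * (a m / w m - t) \<le> (a m / w m) ^ p"
    proof
      assume "t = 0"
      show ?thesis
      proof (cases "p = 1")
        case False
        with p \<open>t = 0\<close> x show ?thesis by (simp add: zero_power)
      qed (use \<open>t = 0\<close> in simp)
    next
      assume "t ^ (p - 1) * (a m / w m - t) * real p \<le> t ^ (p - 1) * sgn t * (a m / w m - t) * real p"
      then show ?thesis
        using abs_power_tangent[OF p, of t "a m / w m - t"] t0
        abs_of_nonneg[OF x] by (simp add: mult_ac del: abs_divide)
    qed
  qed (use w in \<open>auto intro: less_imp_le\<close>)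
  also have "(\<Sum>m<J. w m * (t ^ p + real p * t ^ (p - 1) * (a m / w m - t)))
      = (\<Sum>m<J. w m * t ^ p + real p * t ^ (p - 1) * (a m - t * w m))"
    by (intro sum.cong refl) (use w in \<open>fastforce simp: field_simps\<close>)
  also have "\<dots> = W * t ^ p + real p * t ^ (p - 1) * ((\<Sum>m<J. a m) - t * W)"
    unfolding W by (simp add: sum.distrib sum_distrib_left sum_distrib_right sum_subtractf right_diff_distrib)
  also have "(\<Sum>m<J. a m) - t * W = 0" using W0 by (simp add: t_def)
  finally have "W ^ (p - 1) * (W * t ^ p) \<le> W ^ (p - 1) * (\<Sum>m<J. w m * (a m / w m) ^ p)"
    using W0 by (intro mult_left_mono) auto
  moreover have "W ^ (p - 1) * (W * t ^ p) = (W * t) ^ p"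
    using p by (cases p) (auto simp: power_mult_distrib)
  moreover have "W * t = (\<Sum>m<J. a m)" using W0 by (simp add: t_def)
  ultimately show ?thesis by simp
qed

text \<open>Minkowski's inequality in \<open>L\<^sup>p\<close> for the squares of the coordinates, obtained from convexity with
  weights proportional to the variances; the \<open>\<epsilon>\<close> takes care of vanishing variances.\<close>

lemma (in prob_space) nn_integral_Max_sum_power_le:
  fixes a :: "nat \<Rightarrow> 'i \<Rightarrow> 'a \<Rightarrow> real" and v :: "nat \<Rightarrow> real"
  assumes p: "p \<ge> 1" and A: "finite A" "A \<noteq> {}" and c: "0 \<le> c"
    and X: "\<And>m. m < J \<Longrightarrow> integrable M (X m)" "\<And>m. m < J \<Longrightarrow> (\<integral>\<omega>. X m \<omega> \<partial>M) \<le> c * v m ^ p"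
    and v: "\<And>m. m < J \<Longrightarrow> 0 \<le> v m" "(\<Sum>m<J. v m) \<le> V"
    and a: "\<And>m n \<omega>. m < J \<Longrightarrow> n \<in> A \<Longrightarrow> 0 \<le> a m n \<omega>"
      "\<And>m n \<omega>. m < J \<Longrightarrow> n \<in> A \<Longrightarrow> a m n \<omega> ^ p \<le> X m \<omega>"
  shows "(\<integral>\<^sup>+\<omega>. (MAX n\<in>A. ennreal ((\<Sum>m<J. a m n \<omega>) ^ p)) \<partial>M) \<le> ennreal (c * V ^ p)"
  (is "?I \<le> _")
proof (cases "J = 0")
  case True
  then show ?thesis using p A by (simp add: zero_power)
next
  case False
  then have J: "0 < J" by simp
  have eps: "?I \<le> ennreal (c * (V + real J * \<epsilon>) ^ p)"
    if e: "0 < \<epsilon>" for \<epsilon>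
  proof -
    define w where "w = (\<lambda>m. v m + \<epsilon>)"
    define W where "W = (\<Sum>m<J. w m)"
    have w: "0 < w m" if "m < J" for m using v(1)[OF that] e by (simp add: w_def)
    have W0: "0 < W" unfolding W_def using w J by (intro sum_pos) auto
    have WV: "W \<le> V + real J * \<epsilon>" using v(2) by (simp add: W_def w_def sum.distrib)
    \<comment> \<open>A single integrable majorant for all \<open>n\<close>: each \<open>X m\<close>
      bounds its coordinate for every \<open>n\<close>, so the maximum disappears before the
      expectation is taken.\<close>
    define H where "H = (\<lambda>\<omega>. W ^ (p - 1) * (\<Sum>m<J. w m / w m ^ p * X m \<omega>))"
    have le: "(\<Sum>m<J. a m n \<omega>) ^ p \<le> H \<omega>" if n: "n \<in> A" for n \<omega>
    proof -
      have "(\<Sum>m<J. a m n \<omega>) ^ p \<le> W ^ (p - 1) * (\<Sum>m<J. w m * (a m n \<omega> / w m) ^ p)"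
        by (rule power_sum_le_weighted[OF p w a(1)[OF _ n] W_def J])
      also have "\<dots> \<le> H \<omega>"
        unfolding H_def
      proof (intro mult_left_mono sum_mono)
        fix m assume "m \<in> {..<J}"
        then have m: "m < J" by simp
        have "w m * (a m n \<omega> / w m) ^ p = w m / w m ^ p * a m n \<omega> ^ p"
          by (simp add: power_divide)
        also have "\<dots> \<le> w m / w m ^ p * X m \<omega>"
          using w[OF m] by (intro mult_left_mono a(2) m n) auto
        finally show "w m * (a m n \<omega> / w m) ^ p \<le> w m / w m ^ p * X m \<omega>" .
      qed (use W0 in auto)
      finally show ?thesis .
    qed
    have iH: "integrable M H"
      unfolding H_def by (intro integrable_mult_right Bochner_Integration.integrable_sum X) auto
    obtain n0 where n0: "n0 \<in> A" using A by auto
    have H0: "0 \<le> H \<omega>" for \<omega>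
      using le[OF n0, of \<omega>] a(1)[OF _ n0] by (smt (verit) lessThan_iff sum_nonneg zero_le_power)
    have "?I \<le> (\<integral>\<^sup>+\<omega>. ennreal (H \<omega>) \<partial>M)"
      by (intro nn_integral_mono Max.boundedI) (use A le in \<open>auto intro: ennreal_leI\<close>)
    also have "\<dots> = ennreal (\<integral>\<omega>. H \<omega> \<partial>M)"
      by (rule nn_integral_eq_integral[OF iH]) (use H0 in auto)
    also have "(\<integral>\<omega>. H \<omega> \<partial>M) = W ^ (p - 1) * (\<Sum>m<J. w m / w m ^ p * (\<integral>\<omega>. X m \<omega> \<partial>M))"
      unfolding H_def using X(1) by (simp add: Bochner_Integration.integral_sum)
    \<comment> \<open>Since \<open>w m\<close> is at least \<open>v m\<close>, the moment bound
      cancels the factor \<open>w m ^ p\<close> in the denominator and leaves a multiple of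
      \<open>w m\<close>; the sum restores the missing power of \<open>W\<close>.\<close>
    also have "\<dots> \<le> W ^ (p - 1) * (\<Sum>m<J. c * w m)"
    proof (intro mult_left_mono sum_mono)
      fix m assume "m \<in> {..<J}"
      then have m: "m < J" by simp
      have "(\<integral>\<omega>. X m \<omega> \<partial>M) \<le> c * v m ^ p" using X(2) m .
      also have "\<dots> \<le> c * w m ^ p"
        using c v(1)[OF m] e by (intro mult_left_mono power_mono) (auto simp: w_def)
      finally have "w m / w m ^ p * (\<integral>\<omega>. X m \<omega> \<partial>M) \<le> w m / w m ^ p * (c * w m ^ p)"
        using w[OF m] by (intro mult_left_mono) auto
      then show "w m / w m ^ p * (\<integral>\<omega>. X m \<omega> \<partial>M) \<le> c * w m" using w[OF m] by (simp add: mult.commute)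
    qed (use W0 in auto)
    also have "\<dots> = c * W ^ p"
      using p by (cases p) (auto simp: W_def sum_distrib_left[symmetric])
    also have "\<dots> \<le> c * (V + real J * \<epsilon>) ^ p"
      using c W0 WV by (intro mult_left_mono power_mono) auto
    finally show ?thesis by (simp add: ennreal_leI)
  qed
  have "(\<lambda>n. ennreal (c * (V + real J * (1 / real (Suc n))) ^ p)) \<longlonglongrightarrow> ennreal (c * (V + real J * 0) ^ p)"
    by (intro tendsto_ennrealI tendsto_intros LIMSEQ_inverse_real_of_nat[unfolded inverse_eq_divide])
  then have "?I \<le> ennreal (c * (V + real J * 0) ^ p)"
    by (rule LIMSEQ_le_const) (intro exI allI impI eps, simp)
  then show ?thesis by simp
qed

section \<open>Scalar stochastic integrals\<close>

text \<open>The integrands in the definition of the stochastic integral need not be measurable, and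
  \<open>nn_integral\<close> is a lower integral, which is not subadditive in general.\<close>

lemma nn_integral_affine_le:
  fixes f :: "'b \<Rightarrow> ennreal" and g :: "'b \<Rightarrow> real"
  assumes c: "0 \<le> c" and [measurable]: "g \<in> borel_measurable N"
  shows "(\<integral>\<^sup>+x. ennreal c * f x + ennreal (g x) \<partial>N) \<le> ennreal c * (\<integral>\<^sup>+x. f x \<partial>N) + (\<integral>\<^sup>+x. ennreal (g x) \<partial>N)"
proof (cases "c = 0")
  case False
  with c have c: "0 < c" by simp
  show ?thesis
    unfolding nn_integral_def[of N "\<lambda>x. ennreal c * f x + ennreal (g x)"]
  proof (rule SUP_least)
    fix s assume "s \<in> {s. simple_function N s \<and> s \<le> (\<lambda>x. ennreal c * f x + ennreal (g x))}"
    then have s: "simple_function N s" and le: "\<And>x. s x \<le> ennreal c * f x + ennreal (g x)"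
      by (auto simp: le_fun_def)
    have [measurable]: "s \<in> borel_measurable N" using s by (rule borel_measurable_simple_function)
    \<comment> \<open>A measurable minorant of \<open>f\<close>: truncated subtraction keeps it
      nonnegative, and it is built from \<open>s\<close> and \<open>g\<close> alone, so
      measurability of \<open>f\<close> is never invoked.\<close>
    define u where "u = (\<lambda>x. (s x - ennreal (g x)) / ennreal c)"
    have [measurable]: "u \<in> borel_measurable N" unfolding u_def by measurable
    have "s x - ennreal (g x) \<le> ennreal c * f x" for x
      using le[of x] by (simp add: ennreal_minus_le_iff add.commute)
    then have uf: "u x \<le> f x" for x
      unfolding u_def using c by (intro divide_le_posI_ennreal) auto
    have su: "s x \<le> ennreal c * u x + ennreal (g x)" for x
    proof -
      have "ennreal c * u x = s x - ennreal (g x)"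
        using mult_divide_eq_ennreal[of "ennreal c" "s x - ennreal (g x)"] c
        by (simp add: u_def ennreal_times_divide mult.commute)
      then show ?thesis
        by (metis add.commute ennreal_minus_le_iff ennreal_neq_top order_refl)
    qed
    have "integral\<^sup>S N s = (\<integral>\<^sup>+x. s x \<partial>N)" using s by (simp add: nn_integral_eq_simple_integral)
    also have "\<dots> \<le> (\<integral>\<^sup>+x. ennreal c * u x + ennreal (g x) \<partial>N)" by (intro nn_integral_mono su)
    also have "\<dots> = ennreal c * (\<integral>\<^sup>+x. u x \<partial>N) + (\<integral>\<^sup>+x. ennreal (g x) \<partial>N)"
      by (subst nn_integral_add) (auto simp: nn_integral_cmult)
    also have "\<dots> \<le> ennreal c * (\<integral>\<^sup>+x. f x \<partial>N) + (\<integral>\<^sup>+x. ennreal (g x) \<partial>N)"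
      by (intro add_right_mono mult_left_mono nn_integral_mono uf) auto
    finally show "integral\<^sup>S N s \<le> ennreal c * (\<integral>\<^sup>+x. f x \<partial>N) + (\<integral>\<^sup>+x. ennreal (g x) \<partial>N)" .
  qed
qed simp

lemma measurable_larger_algebra:
  assumes "X \<in> measurable A C" "sets A \<subseteq> sets B" "space A = space B"
  shows "X \<in> measurable B C"
  using assms unfolding measurable_def by auto

section \<open>Orthonormal expansions and the Riesz representation\<close>

lemma orthonormal_basis_inner_sum:
  assumes e: "orthonormal_basis (e :: nat \<Rightarrow> 'h::real_inner)" and "finite A"
  shows "inner (\<Sum>i\<in>A. c i *\<^sub>R e i) (e j) = (if j \<in> A then c j else 0)"
proof -
  have "inner (\<Sum>i\<in>A. c i *\<^sub>R e i) (e j) = (\<Sum>i\<in>A. if i = j then c i else 0)"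
    using e by (auto simp: inner_sum_left orthonormal_basis_def intro!: sum.cong)
  then show ?thesis using assms(2) by simp
qed

lemma orthonormal_basis_norm_sum:
  assumes e: "orthonormal_basis (e :: nat \<Rightarrow> 'h::real_inner)" and "finite A"
  shows "(norm (\<Sum>j\<in>A. c j *\<^sub>R e j))\<^sup>2 = (\<Sum>j\<in>A. (c j)\<^sup>2)"
proof -
  have "(norm (\<Sum>j\<in>A. c j *\<^sub>R e j))\<^sup>2 = (\<Sum>j\<in>A. c j * inner (\<Sum>i\<in>A. c i *\<^sub>R e i) (e j))"
    unfolding power2_norm_eq_inner by (subst inner_sum_right) simp
  then show ?thesis
    by (simp add: orthonormal_basis_inner_sum[OF assms] power2_eq_square)
qed

text \<open>The partial sum is the orthogonal projection onto the span of the first \<open>n\<close>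
  vectors, so by Pythagoras it is at least as close to \<open>x\<close> as any element of that span;
  density of the full span finishes.\<close>

lemma orthonormal_basis_expansion:
  assumes e: "orthonormal_basis (e :: nat \<Rightarrow> 'h::real_inner)"
  shows "(\<lambda>n. \<Sum>j<n. inner x (e j) *\<^sub>R e j) \<longlonglongrightarrow> x"
proof (rule LIMSEQ_I)
  fix r :: real assume r: "0 < r"
  have on: "inner (e i) (e j) = (if i = j then 1 else 0)" for i j
    using e by (simp add: orthonormal_basis_def)
  have "x \<in> closure (span (range e))" using e by (simp add: orthonormal_basis_def)
  then obtain y where y: "y \<in> span (range e)" "dist y x < r"
    using r by (meson closure_approachable)
  from y(1) obtain T c where T: "finite T" "T \<subseteq> range e" "y = (\<Sum>a\<in>T. c a *\<^sub>R a)"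
    unfolding span_explicit by blast
  from finite_subset_image[OF T(1,2)] obtain A where A: "finite A" "T = e ` A" by blast
  have "inj e"
  proof (rule injI)
    fix i j assume "e i = e j"
    then have "inner (e i) (e j) = inner (e i) (e i)" by simp
    then show "i = j" unfolding on by (auto split: if_splits)
  qed
  then have ye: "y = (\<Sum>j\<in>A. c (e j) *\<^sub>R e j)"
    unfolding T(3) A(2) by (subst sum.reindex) (auto intro: inj_on_subset)
  obtain n0 where n0: "A \<subseteq> {..<n0}" using A(1) finite_nat_iff_bounded by blast
  show "\<exists>no. \<forall>n\<ge>no. norm ((\<Sum>j<n. inner x (e j) *\<^sub>R e j) - x) < r"
  proof (intro exI allI impI)
    fix n assume "n0 \<le> n"
    then have An: "A \<subseteq> {..<n}" using n0 by auto
    define s where "s = (\<Sum>j<n. inner x (e j) *\<^sub>R e j)"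
    have orth: "inner (x - s) (e j) = 0" if "j < n" for j
      using that by (simp add: s_def inner_diff_left orthonormal_basis_inner_sum[OF e])
    have "inner (x - s) (s - y) = 0"
      unfolding ye s_def[symmetric]
    proof -
      have "inner (x - s) s = 0"
        by (subst (2) s_def) (simp add: inner_sum_right orth)
      moreover have "inner (x - s) (\<Sum>j\<in>A. c (e j) *\<^sub>R e j) = 0"
        using An by (auto simp: inner_sum_right orth intro!: sum.neutral)
      ultimately show "inner (x - s) (s - (\<Sum>j\<in>A. c (e j) *\<^sub>R e j)) = 0" by (simp add: inner_diff_right)
    qed
    then have "(norm (x - y))\<^sup>2 = (norm (x - s))\<^sup>2 + (norm (s - y))\<^sup>2"
      using norm_add_Pythagorean[of "x - s" "s - y"] by (simp add: orthogonal_def)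
    then have "(norm (x - s))\<^sup>2 \<le> (norm (x - y))\<^sup>2" by simp
    then have "norm (x - s) \<le> norm (x - y)" by (rule power2_le_imp_le) simp
    then show "norm ((\<Sum>j<n. inner x (e j) *\<^sub>R e j) - x) < r"
      using y(2) by (simp add: s_def[symmetric] dist_norm norm_minus_commute)
  qed
qed

lemma orthonormal_basis_parseval:
  assumes e: "orthonormal_basis (e :: nat \<Rightarrow> 'h::real_inner)"
  shows "(\<lambda>j. (inner x (e j))\<^sup>2) sums (norm x)\<^sup>2"
  unfolding sums_def orthonormal_basis_norm_sum[OF e finite_lessThan, symmetric]
  by (intro tendsto_intros orthonormal_basis_expansion[OF e])

lemma orthonormal_basis_parseval_ennreal:
  assumes e: "orthonormal_basis (e :: nat \<Rightarrow> 'h::real_inner)"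
  shows "(\<Sum>j. ennreal ((inner x (e j))\<^sup>2)) = ennreal ((norm x)\<^sup>2)"
  using orthonormal_basis_parseval[OF e, of x]
  by (subst suminf_ennreal2) (auto simp: sums_iff)

text \<open>The coordinates of the vector can only be \<open>\<phi> (e j)\<close>; completeness
  turns their square summability into convergence of \<open>s\<close>, and continuity extends the
  identity from the basis.\<close>

lemma riesz_representation:
  fixes \<phi> :: "'h::{real_inner,complete_space} \<Rightarrow> real"
  assumes e: "orthonormal_basis (e :: nat \<Rightarrow> 'h)" and \<phi>: "bounded_linear \<phi>"
  shows "\<exists>h. \<forall>x. \<phi> x = inner x h"
proof -
  interpret bounded_linear \<phi> by fact
  obtain K where K: "\<And>x. norm (\<phi> x) \<le> norm x * K" "0 < K"
    using pos_bounded by blast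
  define s where "s = (\<lambda>n. \<Sum>j<n. \<phi> (e j) *\<^sub>R e j)"
  have ns: "(norm (s n))\<^sup>2 = (\<Sum>j<n. (\<phi> (e j))\<^sup>2)" for n
    unfolding s_def by (rule orthonormal_basis_norm_sum[OF e]) simp
  have bd: "(\<Sum>j<n. (\<phi> (e j))\<^sup>2) \<le> K\<^sup>2" for n
  proof -
    \<comment> \<open>The functional is tested on its own partial sums, so its bound
      \<open>K\<close> is also a bound for their norms.\<close>
    have "\<phi> (s n) = (norm (s n))\<^sup>2"
      unfolding ns by (simp add: s_def sum scaleR power2_eq_square)
    then have "norm (s n) * norm (s n) \<le> norm (s n) * K"
      using K(1)[of "s n"] by (simp add: power2_eq_square)
    then have "norm (s n) \<le> K"
      using K(2) by (cases "norm (s n) = 0") auto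
    then show ?thesis unfolding ns[symmetric] by (intro power_mono) auto
  qed
  have sm: "summable (\<lambda>j. (\<phi> (e j))\<^sup>2)"
    by (rule summableI_nonneg_bounded[OF _ bd]) simp
  have "Cauchy s"
  proof (rule metric_CauchyI)
    fix r :: real assume r: "0 < r"
    from sm have "Cauchy (\<lambda>n. \<Sum>j<n. (\<phi> (e j))\<^sup>2)"
      using summable_iff_convergent convergent_Cauchy by blast
    then obtain N where N: "\<And>m n. N \<le> m \<Longrightarrow> N \<le> n \<Longrightarrow>
        dist (\<Sum>j<m. (\<phi> (e j))\<^sup>2) (\<Sum>j<n. (\<phi> (e j))\<^sup>2) < r\<^sup>2"
      using r by (metis metric_CauchyD zero_less_power)
    have *: "dist (s m) (s n) < r" if "N \<le> n" "n \<le> m" for m n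
    proof -
      have d: "{..<m} - {..<n} = {n..<m}" by auto
      have "s m - s n = (\<Sum>j=n..<m. \<phi> (e j) *\<^sub>R e j)"
        unfolding s_def using that by (subst sum_diff[symmetric]) (auto simp: d)
      then have "(norm (s m - s n))\<^sup>2 = (\<Sum>j=n..<m. (\<phi> (e j))\<^sup>2)"
        using orthonormal_basis_norm_sum[OF e, of "{n..<m}"] by simp
      also have "\<dots> = (\<Sum>j<m. (\<phi> (e j))\<^sup>2) - (\<Sum>j<n. (\<phi> (e j))\<^sup>2)"
        using that by (subst sum_diff[symmetric]) (auto simp: d)
      also have "\<dots> < r\<^sup>2" using N[of m n] that by (simp add: dist_real_def)
      finally show ?thesis using r by (simp add: dist_norm power_less_imp_less_base)
    qed
    show "\<exists>N. \<forall>m\<ge>N. \<forall>n\<ge>N. dist (s m) (s n) < r"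
      by (metis "*" dist_commute nle_le)
  qed
  then obtain h where h: "s \<longlonglongrightarrow> h"
    using Cauchy_convergent_iff convergent_def by blast
  have he: "inner (e j) h = \<phi> (e j)" for j
  proof -
    have "(\<lambda>n. inner (e j) (s n)) \<longlonglongrightarrow> inner (e j) h" by (intro tendsto_intros h)
    moreover have "\<forall>\<^sub>F n in sequentially. inner (e j) (s n) = \<phi> (e j)"
      using eventually_gt_at_top[of j]
      by eventually_elim (simp add: s_def inner_commute[of "e j"] orthonormal_basis_inner_sum[OF e])
    ultimately show ?thesis
      using LIMSEQ_unique[OF _ tendsto_eventually] by blast
  qed
  have "\<phi> x = inner x h" for x
  proof -
    let ?x = "\<lambda>n. \<Sum>j<n. inner x (e j) *\<^sub>R e j"
    have "(\<lambda>n. \<phi> (?x n)) \<longlonglongrightarrow> \<phi> x" by (intro tendsto orthonormal_basis_expansion[OF e])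
    moreover have "(\<lambda>n. inner (?x n) h) \<longlonglongrightarrow> inner x h"
      by (intro tendsto_intros orthonormal_basis_expansion[OF e])
    moreover have "\<phi> (?x n) = inner (?x n) h" for n
      by (simp add: sum scaleR inner_sum_left he)
    ultimately have "(\<lambda>n. inner (?x n) h) \<longlonglongrightarrow> \<phi> x" "(\<lambda>n. inner (?x n) h) \<longlonglongrightarrow> inner x h"
      by simp_all
    then show ?thesis by (rule LIMSEQ_unique)
  qed
  then show ?thesis by blast
qed

lemma chain_le:
  fixes g :: "nat \<Rightarrow> real"
  assumes "\<And>i. i < n \<Longrightarrow> g i \<le> g (Suc i)" and "i \<le> j" "j \<le> n"
  shows "g i \<le> g j"
  using assms(2,3)
proof (induction rule: dec_induct)
  case (step m)
  then show ?case using assms(1)[of m] by simp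
qed simp

lemma chain_interval:
  fixes g :: "nat \<Rightarrow> real"
  assumes "g 0 < r" "r \<le> g n"
  shows "\<exists>i<n. g i < r \<and> r \<le> g (Suc i)"
  using assms
proof (induction n)
  case (Suc n)
  then show ?case by (cases "r \<le> g n") (use less_Suc_eq in \<open>auto intro: exI[of _ n]\<close>)
qed simp

lemma (in prob_space) indep_set_mono:
  assumes "indep_set A B" "A' \<subseteq> A" "B' \<subseteq> B"
  shows "indep_set A' B'"
proof (rule indep_setI)
  show "A' \<subseteq> events" "B' \<subseteq> events"
    using indep_setD_ev1[OF assms(1)] indep_setD_ev2[OF assms(1)] assms(2,3) by auto
  show "prob (a \<inter> b) = prob a * prob b" if "a \<in> A'" "b \<in> B'" for a b
    using indep_setD[OF assms(1)] that assms(2,3) by auto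
qed

section \<open>Increments of the Wiener process\<close>

locale wiener = prob_space M
  for M :: "'w measure" +
  fixes F :: "real \<Rightarrow> 'w measure" and Q R :: "'h::{real_inner,complete_space} \<Rightarrow>\<^sub>L 'h"
    and W :: "real \<Rightarrow> 'w \<Rightarrow> 'h" and e :: "nat \<Rightarrow> 'h"
  assumes filt: "normal_filtration M F" and wien: "wiener_process M F Q W"
    and sqrtR: "is_sqrt_op R Q" and onb: "orthonormal_basis e"
begin

lemma R_selfadjoint: "inner (R x) y = inner x (R y)"
  using sqrtR by (auto simp: is_sqrt_op_def nonneg_selfadjoint_def)

lemma inner_Q: "inner (Q x) y = inner (R x) (R y)"
  using sqrtR by (auto simp: is_sqrt_op_def R_selfadjoint)

definition incr :: "real \<Rightarrow> real \<Rightarrow> 'h \<Rightarrow> 'w \<Rightarrow> real" where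
  "incr a b h \<omega> = inner (W b \<omega> - W a \<omega>) h"

lemma F_subalgebra: "0 \<le> a \<Longrightarrow> subalgebra M (F a)"
  using filt[unfolded normal_filtration_def, THEN conjunct1] by simp

lemma F_space: "0 \<le> a \<Longrightarrow> space (F a) = space M"
  using F_subalgebra by (auto simp: subalgebra_def)

lemma F_sets_mono: "0 \<le> a \<Longrightarrow> a \<le> b \<Longrightarrow> A \<in> sets (F a) \<Longrightarrow> A \<in> sets (F b)"
  using filt[unfolded normal_filtration_def, THEN conjunct2, THEN conjunct1] by (meson subsetD)

lemma F_events: "0 \<le> a \<Longrightarrow> A \<in> sets (F a) \<Longrightarrow> A \<in> events"
  using F_subalgebra by (auto simp: subalgebra_def)

lemma F_measurable_mono:
  "0 \<le> a \<Longrightarrow> a \<le> b \<Longrightarrow> X \<in> borel_measurable (F a) \<Longrightarrow> X \<in> borel_measurable (F b)"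
  by (rule measurable_larger_algebra[of X "F a"]) (auto simp: F_space intro: F_sets_mono)

lemma F_measurable: "0 \<le> a \<Longrightarrow> X \<in> borel_measurable (F a) \<Longrightarrow> X \<in> borel_measurable M"
  using measurable_from_subalg[OF F_subalgebra] .

lemma incr_adapted:
  assumes "0 \<le> a" "a \<le> b" shows "incr a b h \<in> borel_measurable (F b)"
proof -
  have "W a \<in> borel_measurable (F a)" "W b \<in> borel_measurable (F b)"
    using wien assms by (auto simp: wiener_process_def)
  then have m: "W a \<in> borel_measurable (F b)" "W b \<in> borel_measurable (F b)"
    using assms F_measurable_mono by auto
  have c: "(\<lambda>x. inner x h) \<in> borel_measurable borel"
    by (intro borel_measurable_continuous_onI continuous_intros)
  have "(\<lambda>\<omega>. inner (W b \<omega>) h - inner (W a \<omega>) h) \<in> borel_measurable (F b)"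
    by (intro borel_measurable_diff measurable_compose[OF m(1) c] measurable_compose[OF m(2) c])
  then show ?thesis by (simp add: incr_def[abs_def] inner_diff_left)
qed

lemma incr_measurable: "0 \<le> a \<Longrightarrow> a \<le> b \<Longrightarrow> incr a b h \<in> borel_measurable M"
  using F_measurable[OF _ incr_adapted] by auto

lemma incr_normal:
  assumes "0 \<le> a" "a \<le> b"
  shows "centered_normal M (incr a b h) ((b - a) * (norm (R h))\<^sup>2)"
proof -
  have "gaussian_with_covariance M (\<lambda>\<omega>. W b \<omega> - W a \<omega>) ((b - a) *\<^sub>R Q)"
    using wien assms by (auto simp: wiener_process_def)
  then show ?thesis
    by (auto simp: gaussian_with_covariance_def incr_def[abs_def] blinfun.scaleR_left inner_Q
        power2_norm_eq_inner)
qed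

lemma incr_has_moments: "0 \<le> a \<Longrightarrow> a \<le> b \<Longrightarrow> has_moments M (incr a b h)"
  using centered_normal_has_moments[OF incr_normal incr_measurable] by auto

lemma incr_add: "incr a b h \<omega> + incr b c h \<omega> = incr a c h \<omega>"
  by (simp add: incr_def inner_diff_left)

text \<open>A general Borel \<open>f\<close> covers both linear functionals of an increment and
  products of two of them, as the covariance formula requires.\<close>

lemma increment_indep_var:
  assumes ab: "0 \<le> a" "a \<le> b" and X: "X \<in> borel_measurable (F a)"
    and f: "(f :: 'h \<Rightarrow> real) \<in> borel_measurable borel"
  shows "indep_var borel (X :: 'w \<Rightarrow> real) borel (\<lambda>\<omega>. f (W b \<omega> - W a \<omega>))"
proof -
  have ind: "indep_set (sets (F a)) {(\<lambda>\<omega>. W b \<omega> - W a \<omega>) -` A \<inter> space M | A. A \<in> sets borel}"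
    using wien ab by (auto simp: wiener_process_def)
  have Wm: "(\<lambda>\<omega>. W b \<omega> - W a \<omega>) \<in> borel_measurable M"
    using wien ab by (auto simp: wiener_process_def gaussian_with_covariance_def)
  have "indep_set {X -` A \<inter> space M | A. A \<in> sets borel}
      {(\<lambda>\<omega>. f (W b \<omega> - W a \<omega>)) -` A \<inter> space M | A. A \<in> sets borel}"
  proof -
    have sub1: "{X -` A \<inter> space M | A. A \<in> sets borel} \<subseteq> sets (F a)"
      using measurable_sets[OF X] F_space[OF ab(1)] by auto
    have sub2: "{(\<lambda>\<omega>. f (W b \<omega> - W a \<omega>)) -` A \<inter> space M | A. A \<in> sets borel}
      \<subseteq> {(\<lambda>\<omega>. W b \<omega> - W a \<omega>) -` A \<inter> space M | A. A \<in> sets borel}"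
    proof
      fix B assume "B \<in> {(\<lambda>\<omega>. f (W b \<omega> - W a \<omega>)) -` A \<inter> space M | A. A \<in> sets borel}"
      then obtain A where A: "A \<in> sets borel" "B = (\<lambda>\<omega>. f (W b \<omega> - W a \<omega>)) -` A \<inter> space M" by auto
      have "f -` A \<in> sets borel" using measurable_sets[OF f A(1)] by simp
      moreover have "B = (\<lambda>\<omega>. W b \<omega> - W a \<omega>) -` (f -` A) \<inter> space M" using A(2) by auto
      ultimately show "B \<in> {(\<lambda>\<omega>. W b \<omega> - W a \<omega>) -` A \<inter> space M | A. A \<in> sets borel}" by blast
    qed
    show ?thesis
      by (rule indep_set_mono[OF ind sub1 sub2])
  qed
  moreover have "Int_stable {Z -` A \<inter> space M | A. A \<in> sets borel}" for Z :: "'w \<Rightarrow> real"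
  proof (rule Int_stableI, clarify)
    fix A B :: "real set" assume "A \<in> sets borel" "B \<in> sets borel"
    then show "\<exists>C. (Z -` A \<inter> space M) \<inter> (Z -` B \<inter> space M) = Z -` C \<inter> space M \<and> C \<in> sets borel"
      by (intro exI[of _ "A \<inter> B"]) auto
  qed
  ultimately show ?thesis
    unfolding indep_var_eq
    using F_measurable[OF ab(1) X] measurable_compose[OF Wm f] by (auto intro!: indep_set_sigma_sets)
qed

lemma incr_indep_var:
  assumes "0 \<le> a" "a \<le> b" "X \<in> borel_measurable (F a)"
  shows "indep_var borel X borel (incr a b h)"
  using increment_indep_var[OF assms, of "\<lambda>x. inner x h"]
  by (simp add: incr_def[abs_def] borel_measurable_continuous_onI continuous_intros)

lemma incr_orthogonal:
  assumes "0 \<le> a" "a \<le> b" "X \<in> borel_measurable (F a)" "has_moments M X"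
  shows "(\<integral>\<omega>. X \<omega> * incr a b h \<omega> \<partial>M) = 0"
  by (rule indep_var_expectation_zero[OF incr_indep_var assms(4) incr_has_moments
        centered_normal_mean[OF incr_normal incr_measurable]]) (use assms in auto)

text \<open>Polarisation: normality gives the variance of each single functional, and the mixed
  moment is recovered from \<open>h + g\<close> and \<open>h - g\<close>.\<close>

lemma incr_second_moment:
  assumes ab: "0 \<le> a" "a \<le> b"
  shows "(\<integral>\<omega>. incr a b h \<omega> * incr a b g \<omega> \<partial>M) = (b - a) * inner (R h) (R g)"
proof -
  have m: "(\<integral>\<omega>. (incr a b x \<omega>)\<^sup>2 \<partial>M) = (b - a) * (norm (R x))\<^sup>2" for x
    using centered_normal_even_moment[OF incr_normal[OF ab] incr_measurable[OF ab], of 1 x]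
    by (simp add: gauss_moment_def)
  have i: "integrable M (\<lambda>\<omega>. (incr a b x \<omega>)\<^sup>2)" for x
    using has_moments_integrable[OF has_moments_power[OF incr_has_moments[OF ab]]] .
  have eq: "incr a b h \<omega> * incr a b g \<omega> = ((incr a b (h + g) \<omega>)\<^sup>2 - (incr a b (h - g) \<omega>)\<^sup>2) / 4" for \<omega>
    by (simp add: incr_def inner_add_right inner_diff_right power2_eq_square algebra_simps)
  have "(\<integral>\<omega>. incr a b h \<omega> * incr a b g \<omega> \<partial>M)
      = ((b - a) * (norm (R (h + g)))\<^sup>2 - (b - a) * (norm (R (h - g)))\<^sup>2) / 4"
    unfolding eq using i by (simp add: m)
  also have "\<dots> = (b - a) * inner (R h) (R g)"
    by (simp add: power2_norm_eq_inner blinfun.add_right blinfun.diff_right inner_add_left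
        inner_diff_left inner_add_right inner_diff_right inner_commute field_simps)
  finally show ?thesis .
qed

lemma incr_covariation:
  assumes ab: "0 \<le> a" "a \<le> b" and X: "X \<in> borel_measurable (F a)" "has_moments M X"
  shows "(\<integral>\<omega>. X \<omega> * (incr a b h \<omega> * incr a b g \<omega>) \<partial>M)
    = (\<integral>\<omega>. X \<omega> \<partial>M) * ((b - a) * inner (R h) (R g))"
proof -
  have "indep_var borel X borel (\<lambda>\<omega>. inner (W b \<omega> - W a \<omega>) h * inner (W b \<omega> - W a \<omega>) g)"
    by (rule increment_indep_var[OF ab X(1)])
       (intro borel_measurable_continuous_onI continuous_intros)
  then have "indep_var borel X borel (\<lambda>\<omega>. incr a b h \<omega> * incr a b g \<omega>)"
    by (simp add: incr_def)
  from indep_var_lebesgue_integral[OF this] show ?thesis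
    using has_moments_integrable[OF X(2)]
      has_moments_integrable[OF has_moments_mult[OF incr_has_moments[OF ab] incr_has_moments[OF ab]]]
    by (simp add: incr_second_moment[OF ab])
qed

text \<open>Elementary integrals and Riemann sums, tested with a functional, are both sums of bricks. The
  covariance formula below allows overlapping intervals, so the isometry for their difference needs
  no common refinement of the two partitions.\<close>

definition brick :: "real \<Rightarrow> real \<Rightarrow> 'w set \<Rightarrow> 'h \<Rightarrow> 'w \<Rightarrow> real" where
  "brick a b B h \<omega> = indicat_real B \<omega> * incr a b h \<omega>"

lemma brick_has_moments:
  "0 \<le> a \<Longrightarrow> a \<le> b \<Longrightarrow> B \<in> sets (F a) \<Longrightarrow> has_moments M (brick a b B h)"
  unfolding brick_def[abs_def]
  by (intro has_moments_mult has_moments_indicator incr_has_moments) (auto intro: F_events)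

text \<open>Both events are known at time \<open>c\<close>. Splitting the intervals at
  \<open>c\<close> and at the earlier endpoint \<open>m\<close> leaves one contributing piece, from
  \<open>c\<close> to \<open>m\<close>, where both increments live; every other product contains an
  increment independent of the remaining factors and of mean zero.\<close>

lemma brick_covariance_ordered:
  assumes ab: "0 \<le> a" "a \<le> b" "B \<in> sets (F a)" and cd: "a \<le> c" "c \<le> d" "C \<in> sets (F c)"
  shows "(\<integral>\<omega>. brick a b B h \<omega> * brick c d C g \<omega> \<partial>M)
    = prob (B \<inter> C) * inner (R h) (R g) * max 0 (min b d - c)"
proof -
  have c0: "0 \<le> c" using ab cd by linarith
  have BC: "B \<inter> C \<in> sets (F c)" using F_sets_mono[OF ab(1) cd(1) ab(3)] cd(3) by auto
  define D where "D = indicat_real (B \<inter> C)"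
  have Dc: "D \<in> borel_measurable (F s)" if "c \<le> s" for s
    using F_sets_mono[OF c0 that BC] by (simp add: D_def)
  have Dm: "has_moments M D" unfolding D_def by (intro has_moments_indicator F_events[OF c0 BC])
  have ED: "(\<integral>\<omega>. D \<omega> \<partial>M) = prob (B \<inter> C)"
    unfolding D_def using F_events[OF c0 BC] by simp
  have pr: "brick a b B h \<omega> * brick c d C g \<omega> = D \<omega> * (incr a b h \<omega> * incr c d g \<omega>)" for \<omega>
    by (simp add: brick_def D_def indicator_def)
  have adX: "(\<lambda>\<omega>. D \<omega> * incr s t x \<omega>) \<in> borel_measurable (F u)"
    if "0 \<le> s" "s \<le> t" "t \<le> u" "c \<le> u" for s t u x
    using Dc[OF that(4)] F_measurable_mono[OF _ that(3) incr_adapted[OF that(1,2)]] that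
    by (intro borel_measurable_times) auto
  have moX: "has_moments M (\<lambda>\<omega>. D \<omega> * incr s t x \<omega>)" if "0 \<le> s" "s \<le> t" for s t x
    by (intro has_moments_mult Dm incr_has_moments that)
  have orth: "(\<integral>\<omega>. D \<omega> * incr s t x \<omega> * incr u v y \<omega> \<partial>M) = 0"
    if "0 \<le> s" "s \<le> t" "t \<le> u" "c \<le> u" "u \<le> v" for s t u v x y
    by (rule incr_orthogonal[OF _ that(5) adX moX]) (use that in auto)
  show ?thesis
  proof (cases "b \<le> c")
    case True
    then have "min b d - c \<le> 0" by linarith
    then have "max 0 (min b d - c) = 0" by linarith
    moreover have "(\<integral>\<omega>. brick a b B h \<omega> * brick c d C g \<omega> \<partial>M) = 0"
      using orth[of a b c d h g] ab cd True unfolding pr by (simp add: mult.assoc)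
    ultimately show ?thesis by simp
  next
    case False
    define m where "m = min b d"
    have m: "c \<le> m" "m \<le> b" "m \<le> d" "m = b \<or> m = d" using False cd by (auto simp: m_def)
    \<comment> \<open>One of the two intervals ends at \<open>m\<close>, so at most one of these
      leftover increments is nonzero.\<close>
    have prod0: "incr m b h \<omega> * incr m d g \<omega> = 0" for \<omega>
      using m(4) by (auto simp: incr_def)
    have "brick a b B h \<omega> * brick c d C g \<omega> =
        D \<omega> * incr a c h \<omega> * incr c d g \<omega> + D \<omega> * (incr c m h \<omega> * incr c m g \<omega>)
        + D \<omega> * incr c m h \<omega> * incr m d g \<omega> + D \<omega> * incr c m g \<omega> * incr m b h \<omega>" for \<omega>
    proof -
      have 1: "incr a b h \<omega> = incr a c h \<omega> + incr c m h \<omega> + incr m b h \<omega>"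
        and 2: "incr c d g \<omega> = incr c m g \<omega> + incr m d g \<omega>"
        by (auto simp: incr_add)
      have "brick a b B h \<omega> * brick c d C g \<omega> =
        D \<omega> * incr a c h \<omega> * incr c d g \<omega> + D \<omega> * ((incr c m h \<omega> + incr m b h \<omega>) * (incr c m g \<omega> + incr m d g \<omega>))"
        unfolding pr 1 by (simp add: 2 algebra_simps)
      also have "(incr c m h \<omega> + incr m b h \<omega>) * (incr c m g \<omega> + incr m d g \<omega>) =
        incr c m h \<omega> * incr c m g \<omega> + incr c m h \<omega> * incr m d g \<omega> + incr c m g \<omega> * incr m b h \<omega>"
        using prod0[of \<omega>] by (simp add: algebra_simps)
      finally show ?thesis by (simp add: algebra_simps)
    qed
    moreover have "integrable M (\<lambda>\<omega>. D \<omega> * incr s t x \<omega> * incr u v y \<omega>)"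
      if "0 \<le> s" "s \<le> t" "0 \<le> u" "u \<le> v" for s t u v x y
      by (intro has_moments_integrable has_moments_mult moX incr_has_moments Dm that)
    moreover have "integrable M (\<lambda>\<omega>. D \<omega> * (incr c m h \<omega> * incr c m g \<omega>))"
      by (intro has_moments_integrable has_moments_mult incr_has_moments Dm c0 m)
    ultimately have "(\<integral>\<omega>. brick a b B h \<omega> * brick c d C g \<omega> \<partial>M) =
        (\<integral>\<omega>. D \<omega> * incr a c h \<omega> * incr c d g \<omega> \<partial>M) + (\<integral>\<omega>. D \<omega> * (incr c m h \<omega> * incr c m g \<omega>) \<partial>M)
        + (\<integral>\<omega>. D \<omega> * incr c m h \<omega> * incr m d g \<omega> \<partial>M) + (\<integral>\<omega>. D \<omega> * incr c m g \<omega> * incr m b h \<omega> \<partial>M)"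
      using ab cd c0 m by (simp del: mult_eq_0_iff)
    also have "\<dots> = prob (B \<inter> C) * ((m - c) * inner (R h) (R g))"
      using orth[of a c c d h g] orth[of c m m d h g] orth[of c m m b g h]
        incr_covariation[OF c0 m(1) Dc[OF order_refl] Dm] ab cd c0 m by (simp add: ED)
    also have "m - c = max 0 (min b d - c)" using m(1) by (simp add: m_def)
    finally show ?thesis by (simp add: mult_ac)
  qed
qed

lemma brick_covariance:
  assumes ab: "0 \<le> a" "a \<le> b" "B \<in> sets (F a)" and cd: "0 \<le> c" "c \<le> d" "C \<in> sets (F c)"
  shows "(\<integral>\<omega>. brick a b B h \<omega> * brick c d C g \<omega> \<partial>M)
    = prob (B \<inter> C) * inner (R h) (R g) * max 0 (min b d - max a c)"
proof (cases "a \<le> c")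
  case True
  then show ?thesis using brick_covariance_ordered[OF ab True cd(2,3)] by (simp add: max_def)
next
  case False
  then have ca: "c \<le> a" by simp
  show ?thesis
    using brick_covariance_ordered[OF cd ca ab(2,3), of g h] ca
    by (simp add: max_def mult.commute inner_commute Int_commute min.commute)
qed

text \<open>Squares on both sides expand into the same double sum: on the left by the covariance
  formula, on the right because \<open>len i j\<close> is the length of the intersection of the two
  time intervals.\<close>

lemma brick_isometry:
  assumes I: "finite I" and ab: "\<And>i. i \<in> I \<Longrightarrow> 0 \<le> a i" "\<And>i. i \<in> I \<Longrightarrow> a i \<le> b i"
    and B: "\<And>i. i \<in> I \<Longrightarrow> B i \<in> sets (F (a i))"
  shows "(\<integral>\<^sup>+\<omega>. ennreal ((\<Sum>i\<in>I. brick (a i) (b i) (B i) (h i) \<omega>)\<^sup>2) \<partial>M)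
    = (\<integral>\<^sup>+\<omega>. (\<integral>\<^sup>+r. ennreal ((norm (\<Sum>i\<in>I. (indicat_real (B i) \<omega> * indicat_real {a i<..b i} r)
         *\<^sub>R R (h i)))\<^sup>2) \<partial>lborel) \<partial>M)"
proof -
  define len where "len = (\<lambda>i j. max 0 (min (b i) (b j) - max (a i) (a j)))"
  let ?Y = "\<lambda>i. brick (a i) (b i) (B i) (h i)"
  let ?S = "\<Sum>i\<in>I. \<Sum>j\<in>I. prob (B i \<inter> B j) * inner (R (h i)) (R (h j)) * len i j"
  let ?T = "\<lambda>\<omega>. \<Sum>i\<in>I. \<Sum>j\<in>I. indicat_real (B i \<inter> B j) \<omega> * inner (R (h i)) (R (h j)) * len i j"
  have Be: "B i \<in> events" if "i \<in> I" for i using F_events[OF ab(1) B] that by blast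
  have 1: "(\<integral>\<omega>. (\<Sum>i\<in>I. ?Y i \<omega>)\<^sup>2 \<partial>M)
      = ?S"
  proof -
    have "(\<integral>\<omega>. (\<Sum>i\<in>I. ?Y i \<omega>)\<^sup>2 \<partial>M)
        = (\<integral>\<omega>. (\<Sum>i\<in>I. \<Sum>j\<in>I. ?Y i \<omega> * ?Y j \<omega>) \<partial>M)"
      by (simp add: power2_eq_square sum_product)
    also have "\<dots> = (\<Sum>i\<in>I. \<Sum>j\<in>I. \<integral>\<omega>. ?Y i \<omega> * ?Y j \<omega> \<partial>M)"
      using ab B
      by (simp add: Bochner_Integration.integral_sum has_moments_integrable has_moments_mult
          has_moments_sum brick_has_moments)
    also have "\<dots> = ?S"
      unfolding len_def by (intro sum.cong refl brick_covariance ab B)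
    finally show ?thesis .
  qed
  have i1: "integrable M (\<lambda>\<omega>. (\<Sum>i\<in>I. ?Y i \<omega>)\<^sup>2)"
    by (intro has_moments_integrable has_moments_power has_moments_sum brick_has_moments ab B)
  let ?n = "\<lambda>\<omega> r. (norm (\<Sum>i\<in>I. (indicat_real (B i) \<omega> * indicat_real {a i<..b i} r) *\<^sub>R R (h i)))\<^sup>2"
  have n: "?n \<omega> r = (\<Sum>i\<in>I. \<Sum>j\<in>I. indicat_real (B i \<inter> B j) \<omega> * inner (R (h i)) (R (h j))
      * indicat_real ({a i<..b i} \<inter> {a j<..b j}) r)" for \<omega> r
    unfolding power2_norm_eq_inner inner_sum_left inner_sum_right
    by (intro sum.cong refl)
       (simp only: inner_scaleR_left inner_scaleR_right indicator_inter_arith inner_commute mult_ac)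
  have int: "{a i<..b i} \<inter> {a j<..b j} = {max (a i) (a j)<..min (b i) (b j)}" for i j by auto
  have lm: "has_bochner_integral lborel (indicat_real ({a i<..b i} \<inter> {a j<..b j})) (len i j)" for i j
    using has_bochner_integral_real_indicator[of "{a i<..b i} \<inter> {a j<..b j}" lborel]
    unfolding int len_def by (cases "max (a i) (a j) \<le> min (b i) (b j)") (auto simp: max_def emeasure_lborel_Ioc)
  have inner_int: "has_bochner_integral lborel (?n \<omega>)
      (?T \<omega>)" for \<omega>
    unfolding n by (intro has_bochner_integral_sum has_bochner_integral_mult_right lm)
  have "(\<integral>\<^sup>+r. ennreal (?n \<omega> r) \<partial>lborel) =
      ennreal (?T \<omega>)" for \<omega>
    using inner_int[of \<omega>] by (subst nn_integral_eq_integral) (auto simp: has_bochner_integral_iff)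
  moreover have "0 \<le> (?T \<omega>)" for \<omega>
    using inner_int[of \<omega>] by (auto simp: has_bochner_integral_iff intro!: Bochner_Integration.integral_nonneg
        elim: subst)
  moreover have "has_bochner_integral M
      (\<lambda>\<omega>. ?T \<omega>)
      ?S"
    by (intro has_bochner_integral_sum has_bochner_integral_mult_left)
       (auto intro!: has_bochner_integral_real_indicator simp: Be emeasure_eq_measure)
  ultimately have "(\<integral>\<^sup>+\<omega>. (\<integral>\<^sup>+r. ennreal (?n \<omega> r) \<partial>lborel) \<partial>M)
      = ennreal ?S"
    by (simp add: nn_integral_eq_integral has_bochner_integral_iff)
  then show ?thesis
    unfolding 1[symmetric] using i1 by (simp add: nn_integral_eq_integral)
qed

section \<open>Elementary integrals and Riemann sums tested with a functional\<close>

definition rep_vec :: "('h \<Rightarrow> real) \<Rightarrow> 'h" where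
  "rep_vec \<phi> = (SOME h. \<forall>x. \<phi> x = inner x h)"

lemma inner_rep_vec: "bounded_linear \<phi> \<Longrightarrow> inner x (rep_vec \<phi>) = \<phi> x"
  using someI_ex[OF riesz_representation[OF onb]] unfolding rep_vec_def by metis

text \<open>A simple operator value takes finitely many values; splitting the sample space by the
  value \<open>A\<close> gives one brick for each pair of step and value, carried by the event that
  \<open>\<Phi> m\<close> equals \<open>A\<close>. Self-adjointness of \<open>R\<close> moves it
  onto the Riesz vector, so the integrand becomes an inner product too.\<close>

lemma elementary_bricks:
  assumes el: "elementary_process F t K \<tau> \<Phi>" and \<psi>: "bounded_linear \<psi>" and \<omega>: "\<omega> \<in> space M"
    and L: "L = Sigma {..<K} (\<lambda>m. \<Phi> m ` space M)"
  shows "\<psi> (elementary_integral W K \<tau> \<Phi> \<omega>) = (\<Sum>(m, A)\<in>L.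
      brick (\<tau> m) (\<tau> (Suc m)) (\<Phi> m -` {A} \<inter> space M) (rep_vec (\<lambda>x. \<psi> (blinfun_apply A x))) \<omega>)"
    and "\<psi> (elementary_value K \<tau> \<Phi> r \<omega> (R x)) = inner (\<Sum>(m, A)\<in>L.
      (indicat_real (\<Phi> m -` {A} \<inter> space M) \<omega> * indicat_real {\<tau> m<..\<tau> (Suc m)} r)
        *\<^sub>R R (rep_vec (\<lambda>x. \<psi> (blinfun_apply A x)))) x"
    and "finite L"
proof -
  let ?i = "\<lambda>m A. indicat_real (\<Phi> m -` {A} \<inter> space M) \<omega>"
  let ?v = "\<lambda>A. rep_vec (\<lambda>x. \<psi> (blinfun_apply A x))"
  interpret \<psi>: bounded_linear \<psi> by fact
  have bl: "bounded_linear (\<lambda>x. \<psi> (blinfun_apply A x))" for A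
    by (rule bounded_linear_compose[OF \<psi> blinfun.bounded_linear_right])
  have fin: "finite (\<Phi> m ` space M)" if "m < K" for m
  proof -
    have "0 \<le> \<tau> m"
      using chain_le[of K \<tau> 0 m] el that by (auto simp: elementary_process_def)
    then show ?thesis
      using el that F_space[of "\<tau> m"] by (auto simp: elementary_process_def simple_function_def)
  qed
  then show "finite L" unfolding L by auto
  have single: "(\<Sum>A\<in>\<Phi> m ` space M. ?i m A * f A) = f (\<Phi> m \<omega>)"
    if "m < K" for m and f :: "('h \<Rightarrow>\<^sub>L 'h) \<Rightarrow> real"
  proof -
    have "(\<Sum>A\<in>\<Phi> m ` space M. ?i m A * f A)
      = (\<Sum>A\<in>\<Phi> m ` space M. if A = \<Phi> m \<omega> then f A else 0)"
      using \<omega> by (intro sum.cong) (auto simp: indicator_def)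
    then show ?thesis using fin[OF that] \<omega> by simp
  qed
  have "\<psi> (elementary_integral W K \<tau> \<Phi> \<omega>) = (\<Sum>m<K. \<psi> (\<Phi> m \<omega> (W (\<tau> (Suc m)) \<omega> - W (\<tau> m) \<omega>)))"
    by (simp add: elementary_integral_def \<psi>.sum)
  also have "\<dots> = (\<Sum>m<K. \<Sum>A\<in>\<Phi> m ` space M. ?i m A
      * incr (\<tau> m) (\<tau> (Suc m)) (?v A) \<omega>)"
    by (intro sum.cong refl) (simp add: single incr_def inner_rep_vec[OF bl])
  finally show "\<psi> (elementary_integral W K \<tau> \<Phi> \<omega>) = (\<Sum>(m, A)\<in>L.
      brick (\<tau> m) (\<tau> (Suc m)) (\<Phi> m -` {A} \<inter> space M) (?v A) \<omega>)"
    unfolding L brick_def by (subst sum.Sigma[symmetric]) (auto simp: fin)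
  have "\<psi> (elementary_value K \<tau> \<Phi> r \<omega> (R x)) = (\<Sum>m<K. indicat_real {\<tau> m<..\<tau> (Suc m)} r * \<psi> (\<Phi> m \<omega> (R x)))"
    by (simp add: elementary_value_def blinfun.sum_left blinfun.scaleR_left \<psi>.sum \<psi>.scaleR)
  also have "\<dots> = (\<Sum>m<K. \<Sum>A\<in>\<Phi> m ` space M. ?i m A
      * (indicat_real {\<tau> m<..\<tau> (Suc m)} r * inner (R (?v A)) x))"
    by (intro sum.cong refl)
       (simp add: single R_selfadjoint inner_commute[of _ "R x"] inner_rep_vec[OF bl])
  also have "\<dots> = (\<Sum>(m, A)\<in>L. ?i m A
      * (indicat_real {\<tau> m<..\<tau> (Suc m)} r * inner (R (?v A)) x))"
    unfolding L by (subst sum.Sigma[symmetric]) (auto simp: fin)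
  finally show "\<psi> (elementary_value K \<tau> \<Phi> r \<omega> (R x)) = inner (\<Sum>(m, A)\<in>L.
      (?i m A * indicat_real {\<tau> m<..\<tau> (Suc m)} r)
        *\<^sub>R R (?v A)) x"
    by (simp add: inner_sum_left case_prod_beta mult.assoc)
qed

text \<open>The elementary processes provided by the definition cannot be chosen, so the Riemann sum
  is compared with their integrals through the isometry. Their approximation errors vanish in the
  limit, and using \<open>(x + y)\<^sup>2 \<le> 2 * x\<^sup>2 + 2 * y\<^sup>2\<close> twice leaves
  the factor 4.\<close>

lemma stochastic_integral_riemann_sum:
  assumes int: "has_stochastic_integral M F W R e t (\<lambda>r \<omega>. \<Psi> r) J" and \<psi>: "bounded_linear \<psi>"
    and t: "0 \<le> t" and c: "0 \<le> c"
    and g: "g 0 = 0" "g n = t" "\<And>i. i < n \<Longrightarrow> g i \<le> g (Suc i)"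
    and close: "\<And>i r. i < n \<Longrightarrow> g i < r \<Longrightarrow> r \<le> g (Suc i) \<Longrightarrow>
      (\<Sum>j. ennreal ((\<psi> (\<Psi> r (R (e j))) - inner (R (e j)) (h i))\<^sup>2)) \<le> ennreal c"
  shows "(\<integral>\<^sup>+\<omega>. ennreal ((\<psi> (J \<omega>) - (\<Sum>i<n. incr (g i) (g (Suc i)) (h i) \<omega>))\<^sup>2) \<partial>M) \<le> ennreal (4 * c * t)"
proof -
  interpret \<psi>: bounded_linear \<psi> by fact
  obtain C where C: "\<And>x. norm (\<psi> x) \<le> norm x * C" "0 < C" using \<psi>.pos_bounded by blast
  have sqC: "(\<psi> x)\<^sup>2 \<le> C\<^sup>2 * (norm x)\<^sup>2" for x
    using power_mono[OF C(1)[of x], of 2] by (simp add: power_mult_distrib mult.commute)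
  define V where "V = (\<lambda>\<omega>. \<Sum>i<n. incr (g i) (g (Suc i)) (h i) \<omega>)"
  obtain K \<tau> \<Phi> where el: "\<And>\<nu>. elementary_process F t (K \<nu>) (\<tau> \<nu>) (\<Phi> \<nu>)"
    and l1: "(\<lambda>\<nu>. \<integral>\<^sup>+\<omega>. (\<integral>\<^sup>+r\<in>{0..t}. (\<Sum>j. ennreal ((norm
            ((elementary_value (K \<nu>) (\<tau> \<nu>) (\<Phi> \<nu>) r \<omega> - \<Psi> r) (R (e j))))\<^sup>2)) \<partial>lborel) \<partial>M) \<longlonglongrightarrow> 0"
    and l2: "(\<lambda>\<nu>. \<integral>\<^sup>+\<omega>. ennreal ((norm (elementary_integral W (K \<nu>) (\<tau> \<nu>) (\<Phi> \<nu>) \<omega> - J \<omega>))\<^sup>2) \<partial>M) \<longlonglongrightarrow> 0"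
    using int unfolding has_stochastic_integral_def by blast
  let ?EV = "\<lambda>\<nu>. elementary_value (K \<nu>) (\<tau> \<nu>) (\<Phi> \<nu>)"
  define D where "D = (\<lambda>\<nu> r \<omega>. (\<Sum>j. ennreal ((norm
            ((?EV \<nu> r \<omega> - \<Psi> r) (R (e j))))\<^sup>2)))"
  define EI where "EI = (\<lambda>\<nu>. elementary_integral W (K \<nu>) (\<tau> \<nu>) (\<Phi> \<nu>))"
  let ?D = "\<lambda>\<nu>. \<integral>\<^sup>+\<omega>. (\<integral>\<^sup>+r\<in>{0..t}. D \<nu> r \<omega> \<partial>lborel) \<partial>M"
  let ?B = "\<lambda>\<nu>. \<integral>\<^sup>+\<omega>. ennreal ((norm (EI \<nu> \<omega> - J \<omega>))\<^sup>2) \<partial>M"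
  let ?V = "\<lambda>\<nu>. \<integral>\<^sup>+\<omega>. ennreal ((\<psi> (EI \<nu> \<omega>) - V \<omega>)\<^sup>2) \<partial>M"
  let ?c = "ennreal (2 * C\<^sup>2)"
  have g0: "0 \<le> g i" "g i \<le> t" if "i \<le> n" for i
    using chain_le[of n g 0 i] chain_le[of n g i n] g that by auto
  have EVm: "(\<lambda>\<omega>. \<psi> (EI \<nu> \<omega>) - V \<omega>) \<in> borel_measurable M"
    and bound: "?V \<nu>
      \<le> ?c * ?D \<nu> + ennreal (2 * c * t)" for \<nu>
  proof -
    have \<tau>: "\<tau> \<nu> 0 = 0" "\<tau> \<nu> (K \<nu>) = t" "\<And>m. m < K \<nu> \<Longrightarrow> \<tau> \<nu> m \<le> \<tau> \<nu> (Suc m)"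
      "\<And>m. m < K \<nu> \<Longrightarrow> simple_function (F (\<tau> \<nu> m)) (\<Phi> \<nu> m)"
      using el[of \<nu>] by (auto simp: elementary_process_def)
    have \<tau>0: "0 \<le> \<tau> \<nu> m" "\<tau> \<nu> m \<le> t" if "m \<le> K \<nu>" for m
      using chain_le[of "K \<nu>" "\<tau> \<nu>" 0 m] chain_le[of "K \<nu>" "\<tau> \<nu>" m "K \<nu>"] \<tau> that by auto
    define L where "L = Sigma {..<K \<nu>} (\<lambda>m. \<Phi> \<nu> m ` space M)"
    note el_bricks = elementary_bricks[OF el[of \<nu>] \<psi> _ L_def]
    obtain \<omega>0 where \<omega>0: "\<omega>0 \<in> space M" using not_empty by blast
    have finL: "finite L" using el_bricks(3)[OF \<omega>0] .
    \<comment> \<open>The difference of the two integrals as one family of bricks: elementary steps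
      on the left of the disjoint sum, Riemann cells on the right with the sure event and the
      negated vectors \<open>- h i\<close>.\<close>
    define I where "I = L <+> {..<n}"
    define a where "a = case_sum (\<lambda>(m, A::'h \<Rightarrow>\<^sub>L 'h). \<tau> \<nu> m) g"
    define b where "b = case_sum (\<lambda>(m, A::'h \<Rightarrow>\<^sub>L 'h). \<tau> \<nu> (Suc m)) (\<lambda>i. g (Suc i))"
    define B where "B = case_sum (\<lambda>(m, A::'h \<Rightarrow>\<^sub>L 'h). \<Phi> \<nu> m -` {A} \<inter> space M) (\<lambda>i::nat. space M)"
    define k where "k = case_sum (\<lambda>(m::nat, A::'h \<Rightarrow>\<^sub>L 'h). rep_vec (\<lambda>x. \<psi> (blinfun_apply A x))) (\<lambda>i. - h i)"
    have I: "finite I" using finL by (simp add: I_def)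
    have ab: "0 \<le> a i" "a i \<le> b i" if "i \<in> I" for i
      using that g0 \<tau>0 \<tau>(3) g(3) by (auto simp: I_def L_def a_def b_def)
    have BF: "B i \<in> sets (F (a i))" if i: "i \<in> I" for i
    proof (cases i)
      case (Inl p)
      obtain m A where p: "p = (m, A)" by fastforce
      have m: "m < K \<nu>" using i by (auto simp: I_def L_def Inl p)
      have "\<Phi> \<nu> m -` {A} \<inter> space (F (\<tau> \<nu> m)) \<in> sets (F (\<tau> \<nu> m))"
        using \<tau>(4)[OF m] by (rule simple_functionD(2))
      then show ?thesis using F_space[of "\<tau> \<nu> m"] \<tau>0[of m] m by (simp add: Inl p B_def a_def)
    next
      case (Inr j)
      then have "j < n" using i by (auto simp: I_def)
      then show ?thesis using F_space[of "g j"] g0[of j] sets.top[of "F (g j)"] by (simp add: Inr B_def a_def)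
    qed
    have sum_split: "(\<Sum>i\<in>I. f i) = (\<Sum>p\<in>L. f (Inl p)) + (\<Sum>i<n. f (Inr i))"
      for f :: "(nat \<times> ('h \<Rightarrow>\<^sub>L 'h)) + nat \<Rightarrow> 'z::comm_monoid_add"
      unfolding I_def using finL by (simp add: sum.Plus)
    have lhs: "\<psi> (EI \<nu> \<omega>) - V \<omega> = (\<Sum>i\<in>I. brick (a i) (b i) (B i) (k i) \<omega>)" if \<omega>: "\<omega> \<in> space M" for \<omega>
    proof -
      have "(\<Sum>i<n. brick (a (Inr i)) (b (Inr i)) (B (Inr i)) (k (Inr i)) \<omega>) = - V \<omega>"
        using \<omega> by (simp add: V_def sum_negf[symmetric] brick_def a_def b_def B_def k_def incr_def)
      moreover have "(\<Sum>p\<in>L. brick (a (Inl p)) (b (Inl p)) (B (Inl p)) (k (Inl p)) \<omega>) = \<psi> (EI \<nu> \<omega>)"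
        unfolding EI_def el_bricks(1)[OF \<omega>]
        by (intro sum.cong) (auto simp: a_def b_def B_def k_def)
      ultimately show ?thesis by (simp add: sum_split)
    qed
    have "(\<lambda>\<omega>. \<Sum>i\<in>I. brick (a i) (b i) (B i) (k i) \<omega>) \<in> borel_measurable M"
      by (intro borel_measurable_sum has_moments_measurable brick_has_moments ab BF)
    then show "(\<lambda>\<omega>. \<psi> (EI \<nu> \<omega>) - V \<omega>) \<in> borel_measurable M"
      by (subst measurable_cong[OF lhs])
    define X where "X = (\<lambda>\<omega> r. \<Sum>i\<in>I. (indicat_real (B i) \<omega> * indicat_real {a i<..b i} r) *\<^sub>R R (k i))"
    have X: "inner (X \<omega> r) (e l) = \<psi> (?EV \<nu> r \<omega> (R (e l)))
        - (\<Sum>i<n. indicat_real {g i<..g (Suc i)} r * inner (R (e l)) (h i))" if \<omega>: "\<omega> \<in> space M" for \<omega> r l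
    proof -
      have "inner (\<Sum>i<n. (indicat_real (B (Inr i)) \<omega> * indicat_real {a (Inr i)<..b (Inr i)} r) *\<^sub>R R (k (Inr i))) (e l)
        = - (\<Sum>i<n. indicat_real {g i<..g (Suc i)} r * inner (R (e l)) (h i))"
        unfolding inner_sum_left sum_negf[symmetric] using \<omega>
        by (intro sum.cong refl)
           (simp add: a_def b_def B_def k_def blinfun.minus_right R_selfadjoint inner_commute[of "h _"])
      moreover have "inner (\<Sum>p\<in>L. (indicat_real (B (Inl p)) \<omega> * indicat_real {a (Inl p)<..b (Inl p)} r) *\<^sub>R R (k (Inl p))) (e l)
        = \<psi> (?EV \<nu> r \<omega> (R (e l)))"
        unfolding el_bricks(2)[OF \<omega>]
        by (intro arg_cong2[where f=inner] sum.cong) (auto simp: a_def b_def B_def k_def)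
      ultimately show ?thesis by (simp add: X_def sum_split inner_add_left)
    qed
    \<comment> \<open>Parseval reduces the norm to coordinates, and
      \<open>\<psi> (\<Psi> r (R (e l)))\<close> is inserted between the two integrands: one
      difference is dominated by the elementary error \<open>D\<close>, the other is covered by
      \<open>close\<close>. Outside the half-open cells everything is zero.\<close>
    have pt: "ennreal ((norm (X \<omega> r))\<^sup>2)
        \<le> ?c * (D \<nu> r \<omega> * indicator {0..t} r) + ennreal (2 * c * indicat_real {0..t} r)"
      if \<omega>: "\<omega> \<in> space M" for \<omega> r
    proof (cases "0 < r \<and> r \<le> t")
      case True
      then obtain i0 where i0: "i0 < n" "g i0 < r" "r \<le> g (Suc i0)"
        using chain_interval[of g r n] g by auto
      have other: "indicat_real {g i<..g (Suc i)} r = (if i = i0 then 1 else 0)" if "i < n" for i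
      proof (cases i i0 rule: linorder_cases)
        case less
        then have "g (Suc i) \<le> g i0" using chain_le[of n g "Suc i" i0] g(3) i0 by auto
        then show ?thesis using i0 less by (auto simp: indicator_def)
      next
        case greater
        then have "g (Suc i0) \<le> g i" using chain_le[of n g "Suc i0" i] g(3) that by auto
        then show ?thesis using i0 greater by (auto simp: indicator_def)
      qed (use i0 in auto)
      let ?x = "\<lambda>l. (norm ((?EV \<nu> r \<omega> - \<Psi> r) (R (e l))))\<^sup>2" and ?y = "\<lambda>l. (\<psi> (\<Psi> r (R (e l))) - inner (R (e l)) (h i0))\<^sup>2"
      have "(inner (X \<omega> r) (e l))\<^sup>2 \<le> 2 * C\<^sup>2 * ?x l
          + 2 * ?y l" for l
      proof -
        let ?X = "\<psi> (?EV \<nu> r \<omega> (R (e l)))"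
        let ?z = "\<psi> (\<Psi> r (R (e l)))" and ?Y = "inner (R (e l)) (h i0)"
        have "(\<Sum>i<n. indicat_real {g i<..g (Suc i)} r * inner (R (e l)) (h i))
            = (\<Sum>i<n. if i = i0 then inner (R (e l)) (h i) else 0)"
          by (intro sum.cong) (auto simp: other)
        then have "inner (X \<omega> r) (e l) = ?X - ?Y"
          using i0 by (simp add: X[OF \<omega>])
        moreover have "(?X - ?Y)\<^sup>2 \<le> 2 * (?X - ?z)\<^sup>2 + 2 * (?z - ?Y)\<^sup>2"
          using zero_le_power2[of "(?X - ?z) - (?z - ?Y)"] by (simp add: power2_eq_square algebra_simps)
        moreover have "(?X - ?z)\<^sup>2 \<le> C\<^sup>2 * ?x l"
          using sqC[of "(?EV \<nu> r \<omega> - \<Psi> r) (R (e l))"]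
          by (simp add: blinfun.diff_left \<psi>.diff)
        ultimately show ?thesis by simp
      qed
      then have "ennreal ((inner (X \<omega> r) (e l))\<^sup>2) \<le>
          ?c * ennreal (?x l)
          + 2 * ennreal (?y l)" for l
        by (simp add: ennreal_leI ennreal_mult[symmetric] ennreal_plus[symmetric]
            ennreal_numeral[symmetric] del: ennreal_plus ennreal_numeral)
      then have "(\<Sum>l. ennreal ((inner (X \<omega> r) (e l))\<^sup>2)) \<le> (\<Sum>l.
          ?c * ennreal (?x l)
          + 2 * ennreal (?y l))"
        by (intro suminf_le) auto
      also have "\<dots> = ?c * D \<nu> r \<omega> + 2 * (\<Sum>l. ennreal (?y l))"
        unfolding D_def by (subst suminf_add[symmetric]) (auto simp: ennreal_suminf_cmult)
      also have "\<dots> \<le> ?c * D \<nu> r \<omega> + 2 * ennreal c"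
        by (intro add_left_mono mult_left_mono close[OF i0]) auto
      also have "2 * ennreal c = ennreal (2 * c)" using c by (simp add: ennreal_mult)
      finally show ?thesis
        using True unfolding orthonormal_basis_parseval_ennreal[OF onb] by simp
    next
      case False
      have "indicat_real {a i<..b i} r = 0" if "i \<in> I" for i
      proof (cases i)
        case (Inl p)
        obtain m A where p: "p = (m, A)" by fastforce
        have m: "m < K \<nu>" using that by (auto simp: I_def L_def Inl p)
        with False \<tau>0[of m] \<tau>0[of "Suc m"] show ?thesis by (auto simp: Inl p a_def b_def indicator_def)
      next
        case (Inr j)
        then have "j < n" using that by (auto simp: I_def)
        with False g0[of j] g0[of "Suc j"] show ?thesis by (auto simp: Inr a_def b_def indicator_def)
      qed
      then have "X \<omega> r = 0" by (simp add: X_def)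
      then show ?thesis by simp
    qed
    have ct: "(\<integral>\<^sup>+r. ennreal (2 * c * indicat_real {0..t} r) \<partial>lborel) = ennreal (2 * c * t)"
    proof -
      have "(\<integral>\<^sup>+r. ennreal (2 * c * indicat_real {0..t} r) \<partial>lborel)
          = (\<integral>\<^sup>+r. ennreal (2 * c) * indicator {0..t} r \<partial>lborel)"
        using c by (intro nn_integral_cong) (simp add: indicator_def)
      also have "\<dots> = ennreal (2 * c * t)"
        using c t by (simp add: nn_integral_cmult_indicator ennreal_mult)
      finally show ?thesis .
    qed
    have "?V \<nu>
        = (\<integral>\<^sup>+\<omega>. ennreal ((\<Sum>i\<in>I. brick (a i) (b i) (B i) (k i) \<omega>)\<^sup>2) \<partial>M)"
      by (intro nn_integral_cong) (simp add: lhs)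
    also have "\<dots> = (\<integral>\<^sup>+\<omega>. (\<integral>\<^sup>+r. ennreal ((norm (X \<omega> r))\<^sup>2) \<partial>lborel) \<partial>M)"
      unfolding X_def by (rule brick_isometry[OF I ab BF])
    also have "\<dots> \<le> (\<integral>\<^sup>+\<omega>. (\<integral>\<^sup>+r. ?c * (D \<nu> r \<omega> * indicator {0..t} r)
        + ennreal (2 * c * indicat_real {0..t} r) \<partial>lborel) \<partial>M)"
      by (intro nn_integral_mono pt)
    \<comment> \<open>\<open>D \<nu>\<close> may fail to be measurable, in \<open>r\<close> as well
      as in \<open>\<omega>\<close>, so the sum is split by the affine bound in both
      integrals.\<close>
    also have "\<dots> \<le> (\<integral>\<^sup>+\<omega>. ?c * (\<integral>\<^sup>+r. D \<nu> r \<omega> * indicator {0..t} r \<partial>lborel)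
        + ennreal (2 * c * t) \<partial>M)"
      unfolding ct[symmetric] by (intro nn_integral_mono nn_integral_affine_le) auto
    also have "\<dots> \<le> ?c * (\<integral>\<^sup>+\<omega>. (\<integral>\<^sup>+r. D \<nu> r \<omega> * indicator {0..t} r \<partial>lborel) \<partial>M)
        + (\<integral>\<^sup>+\<omega>. ennreal (2 * c * t) \<partial>M)"
      by (rule nn_integral_affine_le) auto
    finally show "?V \<nu>
      \<le> ?c * ?D \<nu> + ennreal (2 * c * t)"
      by (simp add: emeasure_space_1)
  qed
  have "(\<integral>\<^sup>+\<omega>. ennreal ((\<psi> (J \<omega>) - V \<omega>)\<^sup>2) \<partial>M)
      \<le> ?c * ?B \<nu>
        + 2 * (?c * ?D \<nu> + ennreal (2 * c * t))" for \<nu>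
  proof -
    have "(\<integral>\<^sup>+\<omega>. ennreal ((\<psi> (J \<omega>) - V \<omega>)\<^sup>2) \<partial>M)
        \<le> (\<integral>\<^sup>+\<omega>. ?c * ennreal ((norm (EI \<nu> \<omega> - J \<omega>))\<^sup>2) + ennreal (2 * (\<psi> (EI \<nu> \<omega>) - V \<omega>)\<^sup>2) \<partial>M)"
    proof (intro nn_integral_mono)
      fix \<omega>
      let ?x = "\<psi> (J \<omega>)" and ?z = "\<psi> (EI \<nu> \<omega>)" and ?y = "V \<omega>"
      have "(?x - ?y)\<^sup>2 \<le> 2 * (?z - ?x)\<^sup>2 + 2 * (?z - ?y)\<^sup>2"
        using zero_le_power2[of "(?x - ?z) - (?z - ?y)"] by (simp add: power2_eq_square algebra_simps)
      moreover have "(?z - ?x)\<^sup>2 \<le> C\<^sup>2 * (norm (EI \<nu> \<omega> - J \<omega>))\<^sup>2"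
        using sqC[of "EI \<nu> \<omega> - J \<omega>"] by (simp add: \<psi>.diff)
      ultimately have "(?x - ?y)\<^sup>2 \<le> 2 * C\<^sup>2 * (norm (EI \<nu> \<omega> - J \<omega>))\<^sup>2 + 2 * (?z - ?y)\<^sup>2" by simp
      then show "ennreal ((?x - ?y)\<^sup>2) \<le> ?c * ennreal ((norm (EI \<nu> \<omega> - J \<omega>))\<^sup>2) + ennreal (2 * (?z - ?y)\<^sup>2)"
        by (simp add: ennreal_leI ennreal_mult[symmetric] ennreal_plus[symmetric] del: ennreal_plus)
    qed
    also have "\<dots> \<le> ?c * ?B \<nu>
        + (\<integral>\<^sup>+\<omega>. ennreal (2 * (\<psi> (EI \<nu> \<omega>) - V \<omega>)\<^sup>2) \<partial>M)"
      using EVm by (intro nn_integral_affine_le) auto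
    also have "(\<integral>\<^sup>+\<omega>. ennreal (2 * (\<psi> (EI \<nu> \<omega>) - V \<omega>)\<^sup>2) \<partial>M) = 2 * ?V \<nu>"
      using EVm by (subst nn_integral_cmult[symmetric]) (auto simp: ennreal_mult)
    also have "?c * ?B \<nu> + \<dots>
      \<le> ?c * ?B \<nu>
        + 2 * (?c * ?D \<nu> + ennreal (2 * c * t))"
      by (intro add_left_mono mult_left_mono bound) auto
    finally show ?thesis .
  qed
  moreover have "(\<lambda>\<nu>. ?c * ?B \<nu>
        + 2 * (?c * ?D \<nu> + ennreal (2 * c * t)))
      \<longlonglongrightarrow> ?c * 0 + 2 * (?c * 0 + ennreal (2 * c * t))"
    using l1 l2 unfolding EI_def D_def
    by (intro tendsto_add ennreal_tendsto_cmult tendsto_const) auto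
  ultimately have "(\<integral>\<^sup>+\<omega>. ennreal ((\<psi> (J \<omega>) - V \<omega>)\<^sup>2) \<partial>M)
      \<le> ?c * 0 + 2 * (?c * 0 + ennreal (2 * c * t))"
    by (intro LIMSEQ_le_const) auto
  also have "\<dots> = ennreal (4 * c * t)"
    using c t by (simp add: ennreal_mult[symmetric] ennreal_numeral[symmetric] mult.assoc del: ennreal_numeral)
  finally show ?thesis by (simp add: V_def)
qed

end

section \<open>The Plancherel bound\<close>

text \<open>Fatou's lemma, arranged for passing a uniform bound to an almost everywhere limit;
  \<open>g\<close> itself may be nonmeasurable.\<close>

lemma nn_integral_limit_le:
  fixes f :: "nat \<Rightarrow> 'b \<Rightarrow> ennreal"
  assumes "\<And>n. f n \<in> borel_measurable M" "\<And>n. (\<integral>\<^sup>+x. f n x \<partial>M) \<le> C"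
    and "AE x in M. (\<lambda>n. f n x) \<longlonglongrightarrow> g x"
  shows "(\<integral>\<^sup>+x. g x \<partial>M) \<le> C"
proof -
  have "(\<integral>\<^sup>+x. g x \<partial>M) = (\<integral>\<^sup>+x. liminf (\<lambda>n. f n x) \<partial>M)"
    by (rule nn_integral_cong_AE, use assms(3) in eventually_elim)
       (simp add: lim_imp_Liminf)
  also have "\<dots> \<le> liminf (\<lambda>n. \<integral>\<^sup>+x. f n x \<partial>M)"
    by (rule nn_integral_liminf) (rule assms)
  also have "\<dots> \<le> liminf (\<lambda>n. C)"
    by (intro Liminf_mono always_eventually allI assms)
  finally show ?thesis by (simp add: Liminf_const)
qed

section \<open>Representatives, norms and completeness of the quotient space\<close>

lemma sq_integrable_rep: "sq_integrable (rep_L2 u)"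
  using Quotient3_rep_reflp[OF Quotient3_L2] by (simp add: L2_eq_def)

lemma rep_L2_measurable [measurable]: "rep_L2 u \<in> borel_measurable borel"
  using sq_integrable_rep[of u] by (simp add: sq_integrable_def)

lemma rep_abs_L2: "sq_integrable f \<Longrightarrow> AE x in lborel. rep_L2 (abs_L2 f) x = f x"
  using Quotient3_rep_abs[OF Quotient3_L2, of f] by (simp add: L2_eq_def)

lemma L2_eqI: "(AE x in lborel. rep_L2 u x = rep_L2 v x) \<Longrightarrow> u = v"
  using Quotient3_rel[OF Quotient3_L2, of "rep_L2 u" "rep_L2 v"] Quotient3_abs_rep[OF Quotient3_L2]
  by (metis L2_eq_def sq_integrable_rep Quotient3_rel_rep Quotient3_L2)

lemma sq_integrableI:
  assumes "f \<in> borel_measurable borel" "(\<integral>\<^sup>+x. ennreal ((cmod (f x))\<^sup>2) \<partial>lborel) < \<infinity>"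
  shows "sq_integrable f"
  using assms unfolding sq_integrable_def by (auto intro!: integrableI_bounded)

lemma sq_integrable_nn: "sq_integrable f \<Longrightarrow>
    (\<integral>\<^sup>+x. ennreal ((cmod (f x))\<^sup>2) \<partial>lborel) = ennreal (LINT x|lborel. (cmod (f x))\<^sup>2)"
  unfolding sq_integrable_def by (auto intro!: nn_integral_eq_integral)

lemma inner_L2_rep: "inner u v = Re (LINT x|lborel. rep_L2 u x * cnj (rep_L2 v x))"
  by (simp add: inner_L2_def)

lemma norm_L2_sq: "(norm u)\<^sup>2 = (LINT x|lborel. (cmod (rep_L2 u x))\<^sup>2)"
proof -
  have "(norm u)\<^sup>2 = Re (LINT x|lborel. rep_L2 u x * cnj (rep_L2 u x))"
    by (simp add: power2_norm_eq_inner inner_L2_rep)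
  also have "\<dots> = (LINT x|lborel. Re (rep_L2 u x * cnj (rep_L2 u x)))"
    by (rule integral_Re[symmetric]) (rule integrable_mult_cnj[OF sq_integrable_rep sq_integrable_rep])
  also have "\<dots> = (LINT x|lborel. (cmod (rep_L2 u x))\<^sup>2)"
    by (simp add: complex_norm_square[symmetric])
  finally show ?thesis .
qed

lemma norm_L2_nn: "(\<integral>\<^sup>+x. ennreal ((cmod (rep_L2 u x))\<^sup>2) \<partial>lborel) = ennreal ((norm u)\<^sup>2)"
  unfolding norm_L2_sq by (rule sq_integrable_nn[OF sq_integrable_rep])

lemma rep_L2_plus: "AE x in lborel. rep_L2 (u + v) x = rep_L2 u x + rep_L2 v x"
  unfolding plus_L2_def map_fun_def o_def id_def
  by (rule rep_abs_L2) (intro sq_integrable_add sq_integrable_rep)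

lemma rep_L2_scaleR: "AE x in lborel. rep_L2 (c *\<^sub>R u) x = of_real c * rep_L2 u x"
  unfolding scaleR_L2_def map_fun_def o_def id_def
  by (rule rep_abs_L2) (intro sq_integrable_cmult sq_integrable_rep)

lemma rep_L2_cscale: "AE x in lborel. rep_L2 (cscale c u) x = c * rep_L2 u x"
  unfolding cscale_def map_fun_def o_def id_def
  by (rule rep_abs_L2) (intro sq_integrable_cmult sq_integrable_rep)

lemma rep_L2_diff: "AE x in lborel. rep_L2 (u - v) x = rep_L2 u x - rep_L2 v x"
proof -
  have eq: "u - v = u + (-1) *\<^sub>R v" by simp
  show ?thesis
    unfolding eq using rep_L2_plus[of u "(-1) *\<^sub>R v"] rep_L2_scaleR[of "-1" v]
    by eventually_elim simp
qed

lemma norm_diff_L2_nn: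
  "(\<integral>\<^sup>+x. ennreal ((cmod (rep_L2 u x - rep_L2 v x))\<^sup>2) \<partial>lborel) = ennreal ((norm (u - v))\<^sup>2)"
  unfolding norm_L2_nn[symmetric]
  by (rule nn_integral_cong_AE, use rep_L2_diff[of u v] in eventually_elim) simp

text \<open>The Riesz-Fischer theorem: a rapidly Cauchy subsequence converges almost everywhere, and
  Fatou's lemma shows that its pointwise limit is also the limit in norm of the whole
  sequence.\<close>

instance L2 :: (euclidean_space) complete_space
proof
  fix X :: "nat \<Rightarrow> 'a L2"
  assume X: "Cauchy X"
  have "\<exists>N. \<forall>m\<ge>N. \<forall>n\<ge>N. dist (X m) (X n) < (1/2) ^ k" for k
    by (rule metric_CauchyD[OF X]) simp
  then obtain N where N: "\<And>k m n. N k \<le> m \<Longrightarrow> N k \<le> n \<Longrightarrow> dist (X m) (X n) < (1/2) ^ k"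
    by metis
  define r where "r = (\<lambda>k. (\<Sum>i\<le>k. N i) + k)"
  have rN: "N k \<le> r k" for k unfolding r_def by (simp add: member_le_sum trans_le_add1)
  have rk: "k \<le> r k" and rS: "r k \<le> r (Suc k)" for k by (auto simp: r_def)
  define d where "d = (\<lambda>k. X (r (Suc k)) - X (r k))"
  define f where "f = (\<lambda>k. rep_L2 (X (r k)))"
  have [measurable]: "f k \<in> borel_measurable borel" for k by (simp add: f_def)
  let ?a = "\<lambda>k x. cmod (f (Suc k) x - f k x)"
  \<comment> \<open>The weight \<open>2 ^ k\<close> still leaves integrals bounded by
    \<open>(1/2) ^ k\<close>, while finiteness of the sum at a point forces increments that decay
    geometrically with ratio \<open>sqrt (1/2)\<close>.\<close>
  let ?t = "\<lambda>k x. ennreal (2 ^ k * (?a k x)\<^sup>2)"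
  have nd: "norm (d k) \<le> (1/2) ^ k" for k
    using N[of k "r (Suc k)" "r k"] rN[of k] rS[of k] by (simp add: d_def dist_norm less_imp_le)
  have "(\<integral>\<^sup>+x. (\<Sum>k. ?t k x) \<partial>lborel)
      = (\<Sum>k. \<integral>\<^sup>+x. ?t k x \<partial>lborel)"
    by (rule nn_integral_suminf) simp
  also have "\<dots> \<le> (\<Sum>k. ennreal ((1/2) ^ k))"
  proof (intro suminf_le)
    fix k
    have "(\<integral>\<^sup>+x. ?t k x \<partial>lborel)
        = ennreal (2 ^ k) * ennreal ((norm (d k))\<^sup>2)"
      unfolding d_def norm_diff_L2_nn[symmetric] f_def
      by (subst nn_integral_cmult[symmetric]) (auto simp: ennreal_mult simp del: ennreal_power)
    also have "\<dots> = ennreal (2 ^ k * (norm (d k))\<^sup>2)" by (simp add: ennreal_mult del: ennreal_power)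
    also have "\<dots> \<le> ennreal ((1/2) ^ k)"
    proof (rule ennreal_leI)
      have "2 ^ k * (norm (d k))\<^sup>2 \<le> 2 ^ k * ((1/2) ^ k)\<^sup>2"
        by (intro mult_left_mono power_mono nd) auto
      also have "\<dots> = (1/2) ^ k" by (simp add: power2_eq_square power_divide)
      finally show "2 ^ k * (norm (d k))\<^sup>2 \<le> (1/2) ^ k" .
    qed
    finally show "(\<integral>\<^sup>+x. ?t k x \<partial>lborel) \<le> ennreal ((1/2) ^ k)" .
  qed auto
  also have "\<dots> < \<infinity>"
    by (subst suminf_ennreal2) (auto intro: summable_geometric simp: ennreal_less_top)
  finally have "AE x in lborel. (\<Sum>k. ?t k x) \<noteq> \<infinity>"
    by (intro nn_integral_noteq_infinite) auto
  then have AEconv: "AE x in lborel. (\<lambda>k. f k x) \<longlonglongrightarrow> lim (\<lambda>k. f k x)"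
  proof eventually_elim
    fix x assume fin: "(\<Sum>k. ?t k x) \<noteq> \<infinity>"
    define C where "C = enn2real (\<Sum>k. ?t k x)"
    have b: "?a k x \<le> sqrt C * (sqrt (1/2)) ^ k" for k
    proof -
      have "?t k x \<le> (\<Sum>k. ?t k x)"
        by (rule order_trans[OF _ sum_le_suminf[OF summableI, of "{k}"]]) auto
      also have "\<dots> = ennreal C" using fin by (simp add: C_def ennreal_enn2real_if)
      finally have "2 ^ k * (?a k x)\<^sup>2 \<le> C"
        by (simp add: C_def ennreal_le_iff)
      then have "(?a k x)\<^sup>2 \<le> C * (1/2) ^ k"
        by (simp add: power_divide field_simps)
      then have "?a k x \<le> sqrt (C * (1/2) ^ k)"
        by (rule real_le_rsqrt)
      then show ?thesis by (simp add: real_sqrt_mult real_sqrt_power)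
    qed
    have s: "sqrt (1/2) < 1" using real_sqrt_lt_1_iff[of "1/2"] by simp
    have "summable (\<lambda>k. sqrt C * (sqrt (1/2)) ^ k)"
      by (intro summable_mult summable_geometric) (use s in auto)
    then have "summable (\<lambda>k. f (Suc k) x - f k x)"
      by (rule summable_comparison_test'[where N=0]) (use b in auto)
    then have "(\<lambda>n. \<Sum>k<n. f (Suc k) x - f k x) \<longlonglongrightarrow> (\<Sum>k. f (Suc k) x - f k x)"
      by (rule summable_LIMSEQ)
    then have "(\<lambda>n. f n x - f 0 x) \<longlonglongrightarrow> (\<Sum>k. f (Suc k) x - f k x)"
      using sum_lessThan_telescope[of "\<lambda>k. f k x"] by simp
    then have "convergent (\<lambda>n. f n x - f 0 x)" by (auto simp: convergent_def)
    then have "convergent (\<lambda>n. (f n x - f 0 x) + f 0 x)" by (intro convergent_add convergent_const)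
    then show "(\<lambda>k. f k x) \<longlonglongrightarrow> lim (\<lambda>k. f k x)" by (simp add: convergent_LIMSEQ_iff)
  qed
  define g where "g = (\<lambda>x. lim (\<lambda>k. f k x))"
  have [measurable]: "g \<in> borel_measurable borel"
    unfolding g_def by (rule borel_measurable_lim_metric) simp
  \<comment> \<open>The subsequence is shifted by \<open>N j\<close> so that all its indices lie
    beyond the Cauchy threshold for \<open>j\<close>.\<close>
  have close: "(\<integral>\<^sup>+x. ennreal ((cmod (g x - rep_L2 (X n) x))\<^sup>2) \<partial>lborel) \<le> ennreal (((1/2) ^ j)\<^sup>2)"
    if n: "N j \<le> n" for n j
  proof (rule nn_integral_limit_le[where f="\<lambda>k x. ennreal ((cmod (f (k + N j) x - rep_L2 (X n) x))\<^sup>2)"])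
    show "(\<lambda>x. ennreal ((cmod (f (k + N j) x - rep_L2 (X n) x))\<^sup>2)) \<in> borel_measurable lborel" for k by simp
    show "(\<integral>\<^sup>+x. ennreal ((cmod (f (k + N j) x - rep_L2 (X n) x))\<^sup>2) \<partial>lborel) \<le> ennreal (((1/2) ^ j)\<^sup>2)" for k
    proof -
      have "N j \<le> r (k + N j)" using rk[of "k + N j"] by linarith
      from N[OF this n] show ?thesis
        unfolding f_def norm_diff_L2_nn by (intro ennreal_leI power_mono) (auto simp: dist_norm)
    qed
    show "AE x in lborel. (\<lambda>k. ennreal ((cmod (f (k + N j) x - rep_L2 (X n) x))\<^sup>2))
        \<longlonglongrightarrow> ennreal ((cmod (g x - rep_L2 (X n) x))\<^sup>2)"
      using AEconv
    proof eventually_elim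
      case (elim x)
      then have "(\<lambda>k. f (k + N j) x) \<longlonglongrightarrow> g x" unfolding g_def by (rule LIMSEQ_ignore_initial_segment)
      then show ?case by (intro tendsto_ennrealI tendsto_intros)
    qed
  qed
  have sqd: "sq_integrable (\<lambda>x. g x - rep_L2 (X n) x)" if "N j \<le> n" for n j
    by (rule sq_integrableI) (use close[OF that] in \<open>auto intro: le_less_trans simp: ennreal_less_top\<close>)
  have "sq_integrable (\<lambda>x. (g x - rep_L2 (X (N 0)) x) + rep_L2 (X (N 0)) x)"
    by (intro sq_integrable_add sqd[of 0] sq_integrable_rep) simp
  then have sg: "sq_integrable g" by simp
  have dj: "dist (X n) (abs_L2 g) \<le> (1/2) ^ j" if "N j \<le> n" for n j
  proof -
    have "ennreal ((norm (abs_L2 g - X n))\<^sup>2) = (\<integral>\<^sup>+x. ennreal ((cmod (g x - rep_L2 (X n) x))\<^sup>2) \<partial>lborel)"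
      unfolding norm_diff_L2_nn[symmetric]
      by (rule nn_integral_cong_AE, use rep_abs_L2[OF sg] in eventually_elim) simp
    with close[OF that] have "ennreal ((norm (abs_L2 g - X n))\<^sup>2) \<le> ennreal (((1/2) ^ j)\<^sup>2)"
      by (simp only:)
    then have "(norm (abs_L2 g - X n))\<^sup>2 \<le> ((1/2) ^ j)\<^sup>2"
      by (subst (asm) ennreal_le_iff) auto
    then have "norm (abs_L2 g - X n) \<le> (1/2) ^ j" by (rule power2_le_imp_le) simp
    then show ?thesis by (simp add: dist_norm norm_minus_commute)
  qed
  have "X \<longlonglongrightarrow> abs_L2 g"
  proof (rule metric_LIMSEQ_I)
    fix e :: real assume "0 < e"
    then obtain j where "(1/2) ^ j < e" using real_arch_pow_inv[of e "1/2"] by auto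
    then show "\<exists>no. \<forall>n\<ge>no. dist (X n) (abs_L2 g) < e"
      using dj[of j] by (intro exI[of _ "N j"]) force
  qed
  then show "convergent X" by (auto simp: convergent_def)
qed

section \<open>Multiplication operators\<close>

text \<open>Meaningful for bounded Borel \<open>m\<close>, for which the product stays square
  integrable; complex scalars, phases and Sobolev weights cut off to a ball are all of this
  kind.\<close>

definition mulL :: "('a::euclidean_space \<Rightarrow> complex) \<Rightarrow> 'a L2 \<Rightarrow> 'a L2" where
  "mulL m u = abs_L2 (\<lambda>x. m x * rep_L2 u x)"

lemma sq_integrable_mult:
  assumes [measurable]: "m \<in> borel_measurable borel" and m: "\<And>x. cmod (m x) \<le> c"
    and f: "sq_integrable f"
  shows "sq_integrable (\<lambda>x. m x * f x)"
proof -
  have [measurable]: "f \<in> borel_measurable borel" using f by (simp add: sq_integrable_def)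
  have "(cmod (m x * f x))\<^sup>2 \<le> c\<^sup>2 * (cmod (f x))\<^sup>2" for x
    by (simp add: norm_mult power_mult_distrib mult_right_mono power_mono m)
  then have le: "norm ((cmod (m x * f x))\<^sup>2) \<le> norm (c\<^sup>2 * (cmod (f x))\<^sup>2)" for x
    by (metis abs_of_nonneg order_trans real_norm_def zero_le_power2)
  have "integrable lborel (\<lambda>x. c\<^sup>2 * (cmod (f x))\<^sup>2)"
    using f unfolding sq_integrable_def by (intro integrable_mult_right) blast
  then have "integrable lborel (\<lambda>x. (cmod (m x * f x))\<^sup>2)"
    by (rule Bochner_Integration.integrable_bound) (measurable, rule AE_I2, rule le)
  then show ?thesis by (simp add: sq_integrable_def)
qed

lemma rep_mulL:
  assumes "m \<in> borel_measurable borel" "\<And>x. cmod (m x) \<le> c"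
  shows "AE x in lborel. rep_L2 (mulL m u) x = m x * rep_L2 u x"
  unfolding mulL_def by (rule rep_abs_L2[OF sq_integrable_mult[OF assms sq_integrable_rep]])

lemma norm_mulL_nn:
  assumes "m \<in> borel_measurable borel" "\<And>x. cmod (m x) \<le> c"
  shows "ennreal ((norm (mulL m u))\<^sup>2) = (\<integral>\<^sup>+x. ennreal ((cmod (m x))\<^sup>2 * (cmod (rep_L2 u x))\<^sup>2) \<partial>lborel)"
  unfolding norm_L2_nn[symmetric]
  by (rule nn_integral_cong_AE, use rep_mulL[OF assms, of u] in eventually_elim)
     (simp add: norm_mult power_mult_distrib)

lemma norm_mulL_le:
  assumes "m \<in> borel_measurable borel" "\<And>x. cmod (m x) \<le> c"
  shows "norm (mulL m u) \<le> c * norm u"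
proof -
  have c: "0 \<le> c" using assms(2)[of undefined] norm_ge_zero order_trans by blast
  have "ennreal ((norm (mulL m u))\<^sup>2) \<le> (\<integral>\<^sup>+x. ennreal (c\<^sup>2) * ennreal ((cmod (rep_L2 u x))\<^sup>2) \<partial>lborel)"
    unfolding norm_mulL_nn[OF assms]
    by (intro nn_integral_mono) (auto simp: ennreal_mult[symmetric] intro!: ennreal_leI mult_right_mono power_mono assms)
  also have "\<dots> = ennreal ((c * norm u)\<^sup>2)"
    by (subst nn_integral_cmult) (auto simp: norm_L2_nn power_mult_distrib ennreal_mult)
  finally have "(norm (mulL m u))\<^sup>2 \<le> (c * norm u)\<^sup>2" by (simp add: ennreal_le_iff)
  then show ?thesis by (rule power2_le_imp_le) (simp add: c)
qed

lemma bounded_linear_mulL: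
  assumes "m \<in> borel_measurable borel" "\<And>x. cmod (m x) \<le> c"
  shows "bounded_linear (mulL m)"
proof (rule bounded_linear_intro[of _ c])
  note r = rep_mulL[OF assms]
  show "mulL m (u + v) = mulL m u + mulL m v" for u v
    by (rule L2_eqI, use r[of "u + v"] rep_L2_plus[of u v] r[of u] r[of v]
        rep_L2_plus[of "mulL m u" "mulL m v"] in eventually_elim)
       (simp add: distrib_left)
  show "mulL m (a *\<^sub>R u) = a *\<^sub>R mulL m u" for a u
    by (rule L2_eqI, use r[of "a *\<^sub>R u"] rep_L2_scaleR[of a u] r[of u]
        rep_L2_scaleR[of a "mulL m u"] in eventually_elim) simp
  show "norm (mulL m u) \<le> norm u * c" for u
    using norm_mulL_le[OF assms, of u] by (simp add: mult.commute)
qed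

lemma cscale_mulL: "cscale c = mulL (\<lambda>_. c)"
proof (rule ext, rule L2_eqI)
  show "AE x in lborel. rep_L2 (cscale c u) x = rep_L2 (mulL (\<lambda>_. c) u) x" for u :: "'a L2"
    using rep_L2_cscale[of c u] rep_mulL[OF borel_measurable_const order_refl, of c u] by eventually_elim simp
qed

lemma cscale_linear: "bounded_linear (cscale c)"
  unfolding cscale_mulL by (rule bounded_linear_mulL[of _ "cmod c"]) auto

lemma cscale_of_real: "cscale (of_real c) u = c *\<^sub>R u"
  by (rule L2_eqI, use rep_L2_cscale[of "of_real c" u] rep_L2_scaleR[of c u] in eventually_elim) simp

section \<open>Gaussian regularisation of the Fourier integral\<close>

text \<open>Rescaling by \<open>s\<close> turns the integral into the characteristic function of the
  standard normal law.\<close>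

lemma normal_density_char:
  assumes s: "0 < s"
  shows "(LINT x|lborel. of_real (normal_density 0 s x) * exp (- (\<i> * of_real (z * x))))
    = complex_of_real (exp (- (s * z)\<^sup>2 / 2))"
proof -
  have "(LINT x|lborel. of_real (normal_density 0 s x) * exp (- (\<i> * of_real (z * x))))
      = \<bar>s\<bar> *\<^sub>R (LINT x|lborel. complex_of_real (normal_density 0 s (0 + s * x)) * exp (- (\<i> * of_real (z * (0 + s * x)))))"
    by (rule lborel_integral_real_affine) (use s in simp)
  also have "\<dots> = (LINT x|lborel. \<bar>s\<bar> *\<^sub>R (complex_of_real (normal_density 0 s (0 + s * x)) * exp (- (\<i> * of_real (z * (0 + s * x))))))"
    by simp
  also have "\<dots> = (LINT x|lborel. std_normal_density x *\<^sub>R iexp (- (s * z) * x))"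
    by (intro Bochner_Integration.integral_cong refl)
       (use s in \<open>simp add: normal_density_def real_sqrt_mult power_mult_distrib scaleR_conv_of_real mult_ac\<close>)
  also have "\<dots> = char std_normal_distribution (- (s * z))"
    unfolding char_def by (subst integral_density) auto
  also have "\<dots> = complex_of_real (exp (- (s * z)\<^sup>2 / 2))"
    by (simp add: char_std_normal_distribution)
  finally show ?thesis .
qed

lemma lborel_integral_prod:
  fixes f :: "'a::euclidean_space \<Rightarrow> real \<Rightarrow> complex"
  assumes f: "\<And>b. b \<in> Basis \<Longrightarrow> integrable lborel (f b)"
  shows "(LINT x|lborel. (\<Prod>b\<in>Basis. f b (x \<bullet> b))) = (\<Prod>b\<in>Basis. LINT t|lborel. f b t)"
proof -
  interpret product_sigma_finite "\<lambda>_. lborel :: real measure" by standard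
  have [measurable]: "f b \<in> borel_measurable borel" if "b \<in> Basis" for b
    using borel_measurable_integrable[OF f[OF that]] by simp
  have "(LINT x|lborel. (\<Prod>b\<in>Basis. f b (x \<bullet> b)))
      = (LINT y|(\<Pi>\<^sub>M b\<in>(Basis::'a set). (lborel::real measure)). (\<Prod>b\<in>Basis. f b ((\<Sum>b\<in>Basis. y b *\<^sub>R b) \<bullet> b)))"
    by (subst lborel_eq, subst integral_distr) simp_all
  also have "\<dots> = (LINT y|(\<Pi>\<^sub>M b\<in>(Basis::'a set). (lborel::real measure)). (\<Prod>b\<in>Basis. f b (y b)))"
    by (intro Bochner_Integration.integral_cong refl prod.cong)
       (simp add: inner_sum_left inner_Basis if_distrib[of "\<lambda>z. _ * z"] cong: if_cong)
  also have "\<dots> = (\<Prod>b\<in>Basis. LINT t|lborel. f b t)"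
    by (rule product_integral_prod) (use f in auto)
  finally show ?thesis .
qed

text \<open>Supplies the integrable majorant for the two Fubini exchanges in the weighted
  bound.\<close>

lemma integrable_pair_scaleR:
  fixes f :: "'a::euclidean_space \<Rightarrow> real" and g :: "'b::euclidean_space \<Rightarrow> complex"
  assumes f: "integrable lborel f" and g: "integrable lborel g"
  shows "integrable (lborel \<Otimes>\<^sub>M lborel) (\<lambda>(x, y). f x *\<^sub>R g y)"
proof (rule integrableI_bounded)
  have [measurable]: "f \<in> borel_measurable borel" "g \<in> borel_measurable borel" using f g by auto
  show "(\<lambda>(x, y). f x *\<^sub>R g y) \<in> borel_measurable (lborel \<Otimes>\<^sub>M lborel)" by measurable
  have "(\<integral>\<^sup>+p. ennreal (norm (case p of (x, y) \<Rightarrow> f x *\<^sub>R g y)) \<partial>(lborel \<Otimes>\<^sub>M lborel))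
      = (\<integral>\<^sup>+x. \<integral>\<^sup>+y. ennreal (norm (f x)) * ennreal (norm (g y)) \<partial>lborel \<partial>lborel)"
    by (subst lborel.nn_integral_fst[symmetric]) (measurable, simp add: ennreal_mult)
  also have "\<dots> = (\<integral>\<^sup>+x. ennreal (norm (f x)) \<partial>lborel) * (\<integral>\<^sup>+y. ennreal (norm (g y)) \<partial>lborel)"
    by (simp add: nn_integral_cmult nn_integral_multc)
  also have "\<dots> < \<infinity>"
    using f g by (simp add: integrable_iff_bounded ennreal_mult_less_top)
  finally show "(\<integral>\<^sup>+p. ennreal (norm (case p of (x, y) \<Rightarrow> f x *\<^sub>R g y)) \<partial>(lborel \<Otimes>\<^sub>M lborel)) < \<infinity>" .
qed

text \<open>A Gaussian weight \<open>\<phi>\<close> regularises the \<open>L\<^sup>2\<close> norm of the transform; its own transform \<open>\<kappa>\<close> is a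
  nonnegative kernel of known mass, to which Schur's test applies.\<close>

lemma fourier_integral_weighted_bound:
  fixes f :: "'a::euclidean_space \<Rightarrow> complex"
  assumes f: "integrable lborel f" and sq: "sq_integrable f" and s: "0 < s"
  defines "A \<equiv> \<lambda>\<xi>. LINT x|lborel. exp (- \<i> * of_real (x \<bullet> \<xi>)) * f x"
  shows "(\<integral>\<^sup>+\<xi>. ennreal ((\<Prod>b\<in>Basis. normal_density 0 s (\<xi> \<bullet> b)) * (cmod (A \<xi>))\<^sup>2) \<partial>lborel)
    \<le> ennreal ((sqrt (2 * pi) / s) ^ DIM('a)) * (\<integral>\<^sup>+x. ennreal ((cmod (f x))\<^sup>2) \<partial>lborel)"
proof -
  have fm [measurable]: "f \<in> borel_measurable borel" using f by auto
  define E where "E = (\<lambda>x \<xi>::'a. exp (- \<i> * complex_of_real (x \<bullet> \<xi>)))"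
  have Em [measurable]: "(\<lambda>p. E (fst p) (snd p)) \<in> borel_measurable borel"
    unfolding E_def by (intro borel_measurable_continuous_onI continuous_intros)
  have [measurable]: "cnj \<in> borel_measurable borel"
    by (intro borel_measurable_continuous_onI continuous_intros)
  have nE: "cmod (E x \<xi>) = 1" for x \<xi> unfolding E_def by (simp add: norm_exp_eq_Re)
  have E_meas1 [measurable]: "(\<lambda>x. E x \<xi>) \<in> borel_measurable borel" "(\<lambda>\<xi>. E x \<xi>) \<in> borel_measurable borel" for x \<xi>
    unfolding E_def by (intro borel_measurable_continuous_onI continuous_intros)+
  have A_def': "A \<xi> = (LINT x|lborel. E x \<xi> * f x)" for \<xi> by (simp add: A_def E_def)
  have iEf: "integrable lborel (\<lambda>x. E x \<xi> * f x)" for \<xi>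
    by (rule Bochner_Integration.integrable_bound[OF f]) (auto simp: norm_mult nE)
  have Em2 [measurable]: "(\<lambda>(\<xi>, x). E x \<xi>) \<in> borel_measurable (lborel \<Otimes>\<^sub>M lborel)"
    unfolding lborel_prod E_def case_prod_beta
    by (simp, intro borel_measurable_continuous_onI continuous_intros)
  have Am [measurable]: "A \<in> borel_measurable borel"
  proof -
    have "(\<lambda>\<xi>. LINT x|lborel. E x \<xi> * f x) \<in> borel_measurable lborel"
      by (rule lborel.borel_measurable_lebesgue_integral) measurable
    then show ?thesis by (simp add: A_def'[abs_def])
  qed
  define a where "a = (LINT x|lborel. cmod (f x))"
  have Aa: "cmod (A \<xi>) \<le> a" for \<xi>
  proof -
    have "cmod (A \<xi>) \<le> (LINT x|lborel. cmod (E x \<xi> * f x))"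
      unfolding A_def' by (rule integral_norm_bound)
    then show ?thesis by (simp add: a_def norm_mult nE)
  qed
  have a0: "0 \<le> a" unfolding a_def by simp
  define \<phi> where "\<phi> = (\<lambda>\<xi>::'a. \<Prod>b\<in>Basis. normal_density 0 s (\<xi> \<bullet> b))"
  have \<phi>m [measurable]: "\<phi> \<in> borel_measurable borel" unfolding \<phi>_def by measurable
  have \<phi>0: "0 \<le> \<phi> \<xi>" for \<xi> unfolding \<phi>_def by (intro prod_nonneg) simp
  have \<phi>nn: "(\<integral>\<^sup>+\<xi>. ennreal (\<phi> \<xi>) \<partial>lborel) = 1"
  proof -
    have "(\<integral>\<^sup>+\<xi>. ennreal (\<phi> \<xi>) \<partial>lborel) = (\<integral>\<^sup>+\<xi>. (\<Prod>b\<in>Basis. ennreal (normal_density 0 s (\<xi> \<bullet> b))) \<partial>(lborel::'a measure))"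
      by (simp add: \<phi>_def prod_ennreal)
    also have "\<dots> = (\<Prod>b\<in>(Basis::'a set). \<integral>\<^sup>+x. ennreal (normal_density 0 s x) \<partial>lborel)"
      by (rule nn_integral_lborel_prod) auto
    also have "(\<integral>\<^sup>+x. ennreal (normal_density 0 s x) \<partial>lborel) = 1"
      by (subst nn_integral_eq_integral) (use s in auto)
    finally show ?thesis by simp
  qed
  have i\<phi>: "integrable lborel \<phi>"
    by (rule integrableI_nonneg) (use \<phi>nn \<phi>0 in auto)
  define \<kappa> where "\<kappa> = (\<lambda>z::'a. \<Prod>b\<in>Basis. exp (- (s * (z \<bullet> b))\<^sup>2 / 2))"
  let ?g = "\<lambda>x. LINT y|lborel. cnj (f y) * of_real (\<kappa> (x - y))"
  have \<kappa>m [measurable]: "\<kappa> \<in> borel_measurable borel" unfolding \<kappa>_def by measurable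
  have \<kappa>0: "0 \<le> \<kappa> z" for z unfolding \<kappa>_def by (intro prod_nonneg) simp
  \<comment> \<open>Weight and character are products over the coordinates, so the transform is a
    product of one-dimensional ones.\<close>
  have \<kappa>: "(LINT \<xi>|lborel. of_real (\<phi> \<xi>) * E z \<xi>) = of_real (\<kappa> z)" for z
  proof -
    have "of_real (\<phi> \<xi>) * E z \<xi> = (\<Prod>b\<in>Basis. of_real (normal_density 0 s (\<xi> \<bullet> b)) * exp (- (\<i> * of_real ((z \<bullet> b) * (\<xi> \<bullet> b)))))" for \<xi>
      unfolding \<phi>_def E_def euclidean_inner[of z \<xi>]
      by (simp add: prod.distrib exp_sum[symmetric] sum_distrib_left sum_negf)
    then have "(LINT \<xi>|lborel. of_real (\<phi> \<xi>) * E z \<xi>) = (LINT \<xi>|lborel.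
        (\<Prod>b\<in>Basis. of_real (normal_density 0 s (\<xi> \<bullet> b)) * exp (- (\<i> * of_real ((z \<bullet> b) * (\<xi> \<bullet> b))))))"
      by simp
    also have "\<dots> = (\<Prod>b\<in>Basis. LINT t|lborel. of_real (normal_density 0 s t) * exp (- (\<i> * of_real ((z \<bullet> b) * t))))"
    proof (rule lborel_integral_prod)
      fix b :: 'a
      show "integrable lborel (\<lambda>t. of_real (normal_density 0 s t) * exp (- (\<i> * of_real ((z \<bullet> b) * t))))"
        by (rule Bochner_Integration.integrable_bound[OF integrable_normal_density[OF s, of 0]])
           (auto simp: norm_mult norm_exp_eq_Re)
    qed
    also have "\<dots> = of_real (\<kappa> z)"
      unfolding normal_density_char[OF s] \<kappa>_def by simp
    finally show ?thesis .
  qed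
  have \<kappa>mass: "(\<integral>\<^sup>+z. ennreal (\<kappa> z) \<partial>lborel) = ennreal ((sqrt (2 * pi) / s) ^ DIM('a))"
  proof -
    have nd: "exp (- (s * t)\<^sup>2 / 2) = sqrt (2 * pi) / s * normal_density 0 (1 / s) t" for t
      using s by (simp add: normal_density_def power_mult_distrib real_sqrt_divide real_sqrt_mult field_simps)
    have "(\<integral>\<^sup>+z. ennreal (\<kappa> z) \<partial>lborel) = (\<integral>\<^sup>+z. (\<Prod>b\<in>Basis. ennreal (exp (- (s * (z \<bullet> b))\<^sup>2 / 2))) \<partial>(lborel::'a measure))"
      by (simp add: \<kappa>_def prod_ennreal)
    also have "\<dots> = (\<Prod>b\<in>(Basis::'a set). \<integral>\<^sup>+t. ennreal (exp (- (s * t)\<^sup>2 / 2)) \<partial>lborel)"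
      by (rule nn_integral_lborel_prod) auto
    also have "(\<integral>\<^sup>+t. ennreal (exp (- (s * t)\<^sup>2 / 2)) \<partial>lborel) = ennreal (sqrt (2 * pi) / s)"
    proof -
      have "(\<integral>\<^sup>+t. ennreal (exp (- (s * t)\<^sup>2 / 2)) \<partial>lborel)
          = ennreal (LINT t|lborel. sqrt (2 * pi) / s * normal_density 0 (1 / s) t)"
        unfolding nd using s by (intro nn_integral_eq_integral integrable_mult_right) auto
      then show ?thesis using s by simp
    qed
    finally show ?thesis using s by (simp add: ennreal_power)
  qed
  have EE: "E x \<xi> * cnj (E y \<xi>) = E (x - y) \<xi>" for x y \<xi>
    unfolding E_def by (simp add: exp_cnj exp_add[symmetric] inner_diff_left algebra_simps)
  \<comment> \<open>By Fubini the frequency is integrated first: the two characters combine to one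
    at \<open>x - y\<close>, whose integral against the weight is the kernel.\<close>
  have inner_int: "(LINT \<xi>|lborel. of_real (\<phi> \<xi>) * E x \<xi> * cnj (A \<xi>)) = ?g x" for x
  proof -
    have "(LINT \<xi>|lborel. of_real (\<phi> \<xi>) * E x \<xi> * cnj (A \<xi>))
        = (LINT \<xi>|lborel. LINT y|lborel. of_real (\<phi> \<xi>) * E x \<xi> * cnj (E y \<xi> * f y))"
      unfolding A_def' by (simp add: Bochner_Integration.integral_cnj[symmetric])
    also have "\<dots> = (LINT y|lborel. LINT \<xi>|lborel. of_real (\<phi> \<xi>) * E x \<xi> * cnj (E y \<xi> * f y))"
    proof (rule lborel_pair.Fubini_integral[symmetric])
      have "integrable (lborel \<Otimes>\<^sub>M lborel) (\<lambda>(\<xi>::'a, y::'a). \<phi> \<xi> *\<^sub>R f y)"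
        by (rule integrable_pair_scaleR[OF i\<phi> f])
      then show "integrable (lborel \<Otimes>\<^sub>M lborel) (\<lambda>(\<xi>, y). of_real (\<phi> \<xi>) * E x \<xi> * cnj (E y \<xi> * f y))"
        by (rule Bochner_Integration.integrable_bound) (measurable, auto simp: norm_mult nE)
    qed
    also have "\<dots> = (LINT y|lborel. cnj (f y) * (LINT \<xi>|lborel. of_real (\<phi> \<xi>) * E (x - y) \<xi>))"
      by (simp add: EE[symmetric] mult_ac flip: Bochner_Integration.integral_mult_right_zero)
    finally show ?thesis by (simp add: \<kappa>)
  qed
  \<comment> \<open>One factor of the square is expanded here and its conjugate in
    \<open>inner_int\<close>; the weighted square integral becomes the quadratic form of the kernel
    \<open>\<kappa> (x - y)\<close>.\<close>
  have main: "(LINT \<xi>|lborel. of_real (\<phi> \<xi> * (cmod (A \<xi>))\<^sup>2))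
      = (LINT x|lborel. f x * ?g x)"
  proof -
    have "(LINT \<xi>|lborel. complex_of_real (\<phi> \<xi> * (cmod (A \<xi>))\<^sup>2))
        = (LINT \<xi>|lborel. of_real (\<phi> \<xi>) * cnj (A \<xi>) * A \<xi>)"
      by (intro Bochner_Integration.integral_cong refl) (simp add: complex_norm_square mult_ac del: of_real_power)
    also have "\<dots> = (LINT \<xi>|lborel. LINT x|lborel. of_real (\<phi> \<xi>) * cnj (A \<xi>) * (E x \<xi> * f x))"
      by (simp add: A_def')
    also have "\<dots> = (LINT x|lborel. LINT \<xi>|lborel. of_real (\<phi> \<xi>) * cnj (A \<xi>) * (E x \<xi> * f x))"
    proof (rule lborel_pair.Fubini_integral[symmetric])
      have "integrable (lborel \<Otimes>\<^sub>M lborel) (\<lambda>(\<xi>::'a, y::'a). (a * \<phi> \<xi>) *\<^sub>R f y)"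
        by (rule integrable_pair_scaleR[OF integrable_mult_right[OF i\<phi>] f])
      then show "integrable (lborel \<Otimes>\<^sub>M lborel) (\<lambda>(\<xi>, x). of_real (\<phi> \<xi>) * cnj (A \<xi>) * (E x \<xi> * f x))"
      proof (rule Bochner_Integration.integrable_bound)
        show "AE p in lborel \<Otimes>\<^sub>M lborel. norm (case p of (\<xi>, x) \<Rightarrow> of_real (\<phi> \<xi>) * cnj (A \<xi>) * (E x \<xi> * f x))
           \<le> norm (case p of (\<xi>, y) \<Rightarrow> (a * \<phi> \<xi>) *\<^sub>R f y)"
        proof (rule AE_I2)
          fix p :: "'a \<times> 'a"
          have "\<phi> (fst p) * cmod (A (fst p)) * cmod (f (snd p)) \<le> a * \<phi> (fst p) * cmod (f (snd p))"
            unfolding mult.commute[of a] by (intro mult_right_mono mult_left_mono Aa \<phi>0) auto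
          then show "norm (case p of (\<xi>, x) \<Rightarrow> of_real (\<phi> \<xi>) * cnj (A \<xi>) * (E x \<xi> * f x))
              \<le> norm (case p of (\<xi>, y) \<Rightarrow> (a * \<phi> \<xi>) *\<^sub>R f y)"
            using a0 \<phi>0[of "fst p"] by (simp add: case_prod_beta norm_mult nE abs_mult)
        qed
      qed measurable
    qed
    also have "\<dots> = (LINT x|lborel. f x * (LINT \<xi>|lborel. of_real (\<phi> \<xi>) * E x \<xi> * cnj (A \<xi>)))"
      by (simp add: mult_ac flip: Bochner_Integration.integral_mult_right_zero)
    finally show ?thesis by (simp add: inner_int)
  qed
  \<comment> \<open>Schur's test in its symmetric form: each half depends on one variable only, so
    integrating out the other one produces the mass of the kernel.\<close>
  have half: "ennreal (cmod (f x) * cmod (f y)) \<le> ennreal ((cmod (f x))\<^sup>2 / 2) + ennreal ((cmod (f y))\<^sup>2 / 2)" for x y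
  proof -
    have "cmod (f x) * cmod (f y) \<le> (cmod (f x))\<^sup>2 / 2 + (cmod (f y))\<^sup>2 / 2"
      using zero_le_power2[of "cmod (f x) - cmod (f y)"] unfolding power2_diff by linarith
    then have "ennreal (cmod (f x) * cmod (f y)) \<le> ennreal ((cmod (f x))\<^sup>2 / 2 + (cmod (f y))\<^sup>2 / 2)"
      by (rule ennreal_leI)
    then show ?thesis by (subst (asm) ennreal_plus) auto
  qed
  have trans1: "(\<integral>\<^sup>+y. ennreal (\<kappa> (x - y)) \<partial>lborel) = (\<integral>\<^sup>+z. ennreal (\<kappa> z) \<partial>lborel)" for x
  proof -
    have sym: "\<kappa> (x - y) = \<kappa> (- x + y)" for y unfolding \<kappa>_def
      by (intro prod.cong refl) (simp add: inner_diff_left power2_commute power_mult_distrib inner_add_left)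
    have "(\<integral>\<^sup>+z. ennreal (\<kappa> z) \<partial>lborel) = (\<integral>\<^sup>+z. ennreal (\<kappa> z) \<partial>distr lborel borel ((+) (- x)))"
      by (simp add: lborel_distr_plus)
    also have "\<dots> = (\<integral>\<^sup>+y. ennreal (\<kappa> (- x + y)) \<partial>lborel)" by (rule nn_integral_distr) auto
    finally show ?thesis by (simp add: sym)
  qed
  have sym: "\<kappa> (x - y) = \<kappa> (y - x)" for x y unfolding \<kappa>_def
    by (intro prod.cong refl) (simp add: inner_diff_left power2_commute power_mult_distrib)
  let ?m = "\<integral>\<^sup>+z. ennreal (\<kappa> z) \<partial>lborel" and ?n = "\<integral>\<^sup>+x. ennreal ((cmod (f x))\<^sup>2) \<partial>lborel"
  have "(\<integral>\<^sup>+\<xi>. ennreal (\<phi> \<xi> * (cmod (A \<xi>))\<^sup>2) \<partial>lborel) = ennreal (cmod (LINT \<xi>|lborel. of_real (\<phi> \<xi> * (cmod (A \<xi>))\<^sup>2)))"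
  proof -
    have "integrable lborel (\<lambda>\<xi>. a\<^sup>2 * \<phi> \<xi>)" using i\<phi> by simp
    then have i: "integrable lborel (\<lambda>\<xi>. \<phi> \<xi> * (cmod (A \<xi>))\<^sup>2)"
    proof (rule Bochner_Integration.integrable_bound)
      show "AE \<xi> in lborel. norm (\<phi> \<xi> * (cmod (A \<xi>))\<^sup>2) \<le> norm (a\<^sup>2 * \<phi> \<xi>)"
        using Aa \<phi>0 a0 by (auto simp: abs_mult mult.commute[of "a\<^sup>2"] intro!: mult_left_mono power_mono)
    qed measurable
    then show ?thesis
      using \<phi>0 by (subst nn_integral_eq_integral) (auto simp del: of_real_mult of_real_power)
  qed
  \<comment> \<open>Without integrability the Bochner integral is 0 by default and the bound is
    trivial; the same split recurs for the inner integral.\<close>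
  also have "\<dots> \<le> (\<integral>\<^sup>+x. ennreal (cmod (f x * ?g x)) \<partial>lborel)"
    unfolding main
  proof (cases "integrable lborel (\<lambda>x. f x * ?g x)")
    case True
    then show "ennreal (cmod (LINT x|lborel. f x * ?g x))
      \<le> (\<integral>\<^sup>+x. ennreal (cmod (f x * ?g x)) \<partial>lborel)"
      by (rule integral_norm_bound_ennreal)
  qed (simp add: not_integrable_integral_eq)
  also have "\<dots> \<le> (\<integral>\<^sup>+x. (\<integral>\<^sup>+y. ennreal (cmod (f x) * cmod (f y)) * ennreal (\<kappa> (x - y)) \<partial>lborel) \<partial>lborel)"
  proof (intro nn_integral_mono)
    fix x
    have "ennreal (cmod (?g x))
        \<le> (\<integral>\<^sup>+y. ennreal (cmod (cnj (f y) * of_real (\<kappa> (x - y)))) \<partial>lborel)"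
    proof (cases "integrable lborel (\<lambda>y. cnj (f y) * of_real (\<kappa> (x - y)))")
      case True then show ?thesis by (rule integral_norm_bound_ennreal)
    qed (simp add: not_integrable_integral_eq)
    then have "ennreal (cmod (f x)) * ennreal (cmod (?g x))
        \<le> ennreal (cmod (f x)) * (\<integral>\<^sup>+y. ennreal (cmod (cnj (f y) * of_real (\<kappa> (x - y)))) \<partial>lborel)"
      by (intro mult_left_mono) auto
    also have "\<dots> = (\<integral>\<^sup>+y. ennreal (cmod (f x) * cmod (f y)) * ennreal (\<kappa> (x - y)) \<partial>lborel)"
      using \<kappa>0 by (subst nn_integral_cmult[symmetric]) (auto simp: norm_mult ennreal_mult mult.assoc)
    finally show "ennreal (cmod (f x * ?g x))
        \<le> (\<integral>\<^sup>+y. ennreal (cmod (f x) * cmod (f y)) * ennreal (\<kappa> (x - y)) \<partial>lborel)"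
      by (simp add: norm_mult ennreal_mult)
  qed
  also have "\<dots> \<le> (\<integral>\<^sup>+x. (\<integral>\<^sup>+y. ennreal ((cmod (f x))\<^sup>2 / 2) * ennreal (\<kappa> (x - y))
      + ennreal ((cmod (f y))\<^sup>2 / 2) * ennreal (\<kappa> (x - y)) \<partial>lborel) \<partial>lborel)"
    unfolding distrib_right[symmetric] by (intro nn_integral_mono mult_right_mono half) auto
  also have "\<dots> = (\<integral>\<^sup>+x. ennreal ((cmod (f x))\<^sup>2 / 2) * ?m \<partial>lborel)
      + (\<integral>\<^sup>+x. (\<integral>\<^sup>+y. ennreal ((cmod (f y))\<^sup>2 / 2) * ennreal (\<kappa> (x - y)) \<partial>lborel) \<partial>lborel)"
    by (simp add: nn_integral_add nn_integral_cmult trans1)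
  also have "(\<integral>\<^sup>+x. (\<integral>\<^sup>+y. ennreal ((cmod (f y))\<^sup>2 / 2) * ennreal (\<kappa> (x - y)) \<partial>lborel) \<partial>lborel)
      = (\<integral>\<^sup>+y. (\<integral>\<^sup>+x. ennreal ((cmod (f y))\<^sup>2 / 2) * ennreal (\<kappa> (x - y)) \<partial>lborel) \<partial>lborel)"
    by (rule lborel_pair.Fubini'[symmetric]) measurable
  also have "\<dots> = (\<integral>\<^sup>+y. ennreal ((cmod (f y))\<^sup>2 / 2) * ?m \<partial>lborel)"
    by (subst sym) (simp add: nn_integral_cmult trans1)
  also have "(\<integral>\<^sup>+x. ennreal ((cmod (f x))\<^sup>2 / 2) * ?m \<partial>lborel) + \<dots> = (\<integral>\<^sup>+x. ennreal ((cmod (f x))\<^sup>2) * ?m \<partial>lborel)"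
    by (subst nn_integral_add[symmetric]) (auto simp: distrib_right[symmetric] ennreal_plus[symmetric] simp del: ennreal_plus)
  also have "\<dots> = ?m * ?n" by (subst nn_integral_multc) (auto simp: mult.commute)
  finally show ?thesis by (simp add: \<phi>_def \<kappa>mass)
qed

text \<open>The weighted bound is used with standard deviation n + 1, rescaled so that the weight
  has value 1 at the origin. It then tends to 1 pointwise, and Fatou's lemma removes it.\<close>

lemma fourier_integral_bound:
  fixes f :: "'a::euclidean_space \<Rightarrow> complex"
  assumes f: "integrable lborel f" and sq: "sq_integrable f"
  shows "(\<integral>\<^sup>+\<xi>. ennreal ((cmod (fourier_integral f \<xi>))\<^sup>2) \<partial>lborel) \<le> (\<integral>\<^sup>+x. ennreal ((cmod (f x))\<^sup>2) \<partial>lborel)"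
    and "fourier_integral f \<in> borel_measurable borel"
proof -
  let ?n = "\<integral>\<^sup>+x. ennreal ((cmod (f x))\<^sup>2) \<partial>lborel" and ?F = "\<lambda>\<xi>. (cmod (fourier_integral f \<xi>))\<^sup>2"
  let ?w = "\<lambda>n \<xi>. ennreal ((\<Prod>b\<in>Basis. exp (- (\<xi> \<bullet> b / real (Suc n))\<^sup>2 / 2)) * ?F \<xi>)"
  have [measurable]: "f \<in> borel_measurable borel" using f by auto
  define A where "A = (\<lambda>\<xi>::'a. LINT x|lborel. exp (- \<i> * of_real (x \<bullet> \<xi>)) * f x)"
  have [measurable]: "(\<lambda>(\<xi>::'a, x::'a). exp (- \<i> * complex_of_real (x \<bullet> \<xi>))) \<in> borel_measurable (lborel \<Otimes>\<^sub>M lborel)"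
    unfolding lborel_prod case_prod_beta
    by (simp, intro borel_measurable_continuous_onI continuous_intros)
  have Am [measurable]: "A \<in> borel_measurable borel"
  proof -
    have "A \<in> borel_measurable lborel"
      unfolding A_def by (rule lborel.borel_measurable_lebesgue_integral) measurable
    then show ?thesis by simp
  qed
  define K where "K = (2 * pi) powr (- real DIM('a) / 2)"
  have FA: "fourier_integral f \<xi> = of_real K * A \<xi>" for \<xi>
    by (simp add: fourier_integral_def K_def A_def)
  then show "fourier_integral f \<in> borel_measurable borel"
    by (simp add: FA[abs_def])
  have K2: "K\<^sup>2 * (sqrt (2 * pi)) ^ (2 * DIM('a)) = 1"
  proof -
    have "K\<^sup>2 = (2 * pi) powr (- real DIM('a))"
      unfolding K_def power2_eq_square by (subst powr_add[symmetric]) simp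
    moreover have "(sqrt (2 * pi)) ^ (2 * DIM('a)) = (2 * pi) powr (real DIM('a))"
      by (simp add: power_mult powr_realpow)
    ultimately show ?thesis by (simp add: powr_add[symmetric])
  qed
  show "(\<integral>\<^sup>+\<xi>. ennreal (?F \<xi>) \<partial>lborel) \<le> ?n"
  proof (rule nn_integral_limit_le[where f="?w"])
    fix n
    show "(\<lambda>\<xi>. ?w n \<xi>) \<in> borel_measurable lborel"
      unfolding FA by measurable
    define s where "s = real (Suc n)"
    have s: "0 < s" by (simp add: s_def)
    define c where "c = (sqrt (2 * pi) / s) ^ DIM('a)"
    \<comment> \<open>\<open>q\<close> collects the normalisation of the normal density and of the
      Fourier integral; against the mass \<open>c\<close> of the kernel the powers of
      \<open>s\<close> cancel and \<open>2 * pi\<close> drops out, so the final constant is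
      1.\<close>
    define q where "q = (sqrt (2 * pi) * s) ^ DIM('a) * K\<^sup>2"
    have c: "0 \<le> c" and q: "0 \<le> q" using s by (simp_all add: c_def q_def)
    have qc: "q * c = 1"
    proof -
      have "q * c = K\<^sup>2 * ((sqrt (2 * pi) * s) * (sqrt (2 * pi) / s)) ^ DIM('a)"
        by (simp add: q_def c_def power_mult_distrib[symmetric] mult_ac)
      also have "(sqrt (2 * pi) * s) * (sqrt (2 * pi) / s) = (sqrt (2 * pi))\<^sup>2"
        using s by (simp add: power2_eq_square)
      finally show ?thesis using K2 by (simp add: power_mult)
    qed
    have "exp (- (t / s)\<^sup>2 / 2) = (sqrt (2 * pi) * s) * normal_density 0 s t" for t
      using s by (simp add: normal_density_def real_sqrt_mult power_divide field_simps)
    then have "(\<Prod>b\<in>Basis. exp (- (\<xi> \<bullet> b / s)\<^sup>2 / 2)) * ?F \<xi>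
        = q * ((\<Prod>b\<in>Basis. normal_density 0 s (\<xi> \<bullet> b)) * (cmod (A \<xi>))\<^sup>2)" for \<xi>
      by (simp add: prod.distrib FA norm_mult power_mult_distrib q_def)
    then have "(\<integral>\<^sup>+\<xi>. ennreal ((\<Prod>b\<in>Basis. exp (- (\<xi> \<bullet> b / s)\<^sup>2 / 2)) * ?F \<xi>) \<partial>lborel)
        = ennreal q * (\<integral>\<^sup>+\<xi>. ennreal ((\<Prod>b\<in>Basis. normal_density 0 s (\<xi> \<bullet> b)) * (cmod (A \<xi>))\<^sup>2) \<partial>lborel)"
      using q by (subst nn_integral_cmult[symmetric]) (auto simp: ennreal_mult' simp flip: prod_ennreal)
    also have "\<dots> \<le> ennreal q * (ennreal c * ?n)"
      unfolding c_def A_def by (intro mult_left_mono fourier_integral_weighted_bound f sq s) auto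
    also have "\<dots> = ?n"
      using q c by (simp add: mult.assoc[symmetric] ennreal_mult[symmetric] qc)
    finally show "(\<integral>\<^sup>+\<xi>. ?w n \<xi> \<partial>lborel)
        \<le> ?n" by (simp add: s_def)
  next
    have "(\<lambda>n. ?w n \<xi>)
        \<longlonglongrightarrow> ennreal ((\<Prod>b\<in>(Basis::'a set). exp (- (\<xi> \<bullet> b * 0)\<^sup>2 / 2)) * ?F \<xi>)" for \<xi>
      unfolding divide_inverse[of "\<xi> \<bullet> _"]
      by (intro tendsto_ennrealI tendsto_intros LIMSEQ_inverse_real_of_nat) auto
    then show "AE \<xi> in lborel. (\<lambda>n. ?w n \<xi>)
        \<longlonglongrightarrow> ennreal (?F \<xi>)" by simp
  qed
qed

section \<open>The Fourier-Plancherel transform as a bounded linear map\<close>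

definition truncate :: "real \<Rightarrow> 'a::euclidean_space L2 \<Rightarrow> 'a \<Rightarrow> complex" where
  "truncate r u x = indicator (cball 0 r) x * rep_L2 u x"

definition truncated_fourier :: "real \<Rightarrow> 'a::euclidean_space L2 \<Rightarrow> 'a L2" where
  "truncated_fourier r u = abs_L2 (fourier_integral (truncate r u))"

lemma truncate_sq_integrable: "sq_integrable (truncate r u)"
  unfolding truncate_def[abs_def]
  by (rule sq_integrable_mult[where c=1, OF _ _ sq_integrable_rep]) (auto simp: indicator_def)

text \<open>A ball has finite measure, and there \<open>t \<le> 1 + t\<^sup>2\<close> bounds the
  function by an integrable one.\<close>

lemma truncate_integrable: "integrable lborel (truncate r u)"
proof (rule Bochner_Integration.integrable_bound)
  have "integrable lborel (indicat_real (cball (0::'a) r))"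
    by (rule integrable_real_indicator) (use emeasure_bounded_finite[OF bounded_cball[of "0::'a" r]] in auto)
  moreover have "integrable lborel (\<lambda>x. (cmod (rep_L2 u x))\<^sup>2)"
    using sq_integrable_rep[of u] by (simp add: sq_integrable_def)
  ultimately show "integrable lborel (\<lambda>x. indicat_real (cball 0 r) x + (cmod (rep_L2 u x))\<^sup>2)"
    by (rule Bochner_Integration.integrable_add)
  show "truncate r u \<in> borel_measurable lborel" by (rule sq_integrable_measurable[OF truncate_sq_integrable])
  have "cmod (truncate r u x) \<le> indicat_real (cball 0 r) x + (cmod (rep_L2 u x))\<^sup>2" for x
  proof -
    have "t \<le> 1 + t\<^sup>2" for t :: real
      using zero_le_power2[of "t - 1 / 2"] by (simp add: power2_eq_square algebra_simps)
    then show ?thesis by (simp add: truncate_def indicator_def)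
  qed
  then show "AE x in lborel. norm (truncate r u x) \<le> norm (indicat_real (cball 0 r) x + (cmod (rep_L2 u x))\<^sup>2)"
    by (intro AE_I2) (smt (verit) real_norm_def)
qed

lemma fourier_integral_sq_integrable:
  assumes "integrable lborel f" "sq_integrable f"
  shows "sq_integrable (fourier_integral f)"
proof (rule sq_integrableI)
  show "(\<integral>\<^sup>+x. ennreal ((cmod (fourier_integral f x))\<^sup>2) \<partial>lborel) < \<infinity>"
    using fourier_integral_bound(1)[OF assms] sq_integrable_nn[OF assms(2)]
    by (auto intro: le_less_trans simp: ennreal_less_top)
qed (rule fourier_integral_bound(2)[OF assms])

lemma rep_truncated_fourier:
  "AE \<xi> in lborel. rep_L2 (truncated_fourier r u) \<xi> = fourier_integral (truncate r u) \<xi>"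
  unfolding truncated_fourier_def
  by (rule rep_abs_L2[OF fourier_integral_sq_integrable[OF truncate_integrable truncate_sq_integrable]])

lemma integrable_exp_mult:
  fixes f :: "'a::euclidean_space \<Rightarrow> complex"
  assumes f: "integrable lborel f"
  shows "integrable lborel (\<lambda>x. exp (- \<i> * of_real (x \<bullet> \<xi>)) * f x)"
proof (rule Bochner_Integration.integrable_bound[OF f])
  have [measurable]: "f \<in> borel_measurable borel" using f by auto
  have [measurable]: "(\<lambda>x. exp (- \<i> * complex_of_real (x \<bullet> \<xi>))) \<in> borel_measurable borel"
    by (intro borel_measurable_continuous_onI continuous_intros)
  show "(\<lambda>x. exp (- \<i> * complex_of_real (x \<bullet> \<xi>)) * f x) \<in> borel_measurable lborel" by measurable
qed (auto simp: norm_mult norm_exp_eq_Re)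

lemma fourier_integral_add:
  assumes "integrable lborel f" "integrable lborel g"
  shows "fourier_integral (\<lambda>x. f x + g x) \<xi> = fourier_integral f \<xi> + fourier_integral g \<xi>"
  unfolding fourier_integral_def
  using integrable_exp_mult[OF assms(1), of \<xi>] integrable_exp_mult[OF assms(2), of \<xi>]
  by (simp add: distrib_left)

lemma fourier_integral_cmult:
  "fourier_integral (\<lambda>x. c * f x) \<xi> = c * fourier_integral f \<xi>"
  unfolding fourier_integral_def by (simp add: mult.left_commute[of _ c])

lemma fourier_integral_cong_AE:
  assumes [measurable]: "f \<in> borel_measurable borel" "g \<in> borel_measurable borel"
    and "AE x in lborel. f x = g x"
  shows "fourier_integral f \<xi> = fourier_integral g \<xi>"
proof -
  have [measurable]: "(\<lambda>x. exp (- \<i> * complex_of_real (x \<bullet> \<xi>))) \<in> borel_measurable borel"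
    by (intro borel_measurable_continuous_onI continuous_intros)
  show ?thesis
    unfolding fourier_integral_def
    by (intro arg_cong2[where f="(*)"] refl integral_cong_AE) (use assms(3) in \<open>auto\<close>)
qed

lemma truncate_measurable [measurable]: "truncate r u \<in> borel_measurable borel"
  using borel_measurable_integrable[OF truncate_integrable] by simp

lemma truncated_fourier_add: "truncated_fourier r (u + v) = truncated_fourier r u + truncated_fourier r v"
proof (rule L2_eqI)
  have "fourier_integral (truncate r (u + v)) \<xi> = fourier_integral (\<lambda>x. truncate r u x + truncate r v x) \<xi>" for \<xi>
  proof (rule fourier_integral_cong_AE)
    show "AE x in lborel. truncate r (u + v) x = truncate r u x + truncate r v x"
      using rep_L2_plus[of u v] by eventually_elim (simp add: truncate_def distrib_left)
  qed measurable
  then have *: "fourier_integral (truncate r (u + v)) \<xi> = fourier_integral (truncate r u) \<xi> + fourier_integral (truncate r v) \<xi>" for \<xi>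
    using fourier_integral_add[OF truncate_integrable truncate_integrable] by simp
  show "AE x in lborel. rep_L2 (truncated_fourier r (u + v)) x = rep_L2 (truncated_fourier r u + truncated_fourier r v) x"
    using rep_truncated_fourier[of r "u + v"] rep_truncated_fourier[of r u] rep_truncated_fourier[of r v]
      rep_L2_plus[of "truncated_fourier r u" "truncated_fourier r v"]
    by eventually_elim (simp add: *)
qed

lemma truncated_fourier_cscale: "truncated_fourier r (cscale c u) = cscale c (truncated_fourier r u)"
proof (rule L2_eqI)
  have "fourier_integral (truncate r (cscale c u)) \<xi> = fourier_integral (\<lambda>x. c * truncate r u x) \<xi>" for \<xi>
  proof (rule fourier_integral_cong_AE)
    show "AE x in lborel. truncate r (cscale c u) x = c * truncate r u x"
      using rep_L2_cscale[of c u] by eventually_elim (simp add: truncate_def)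
  qed measurable
  then have *: "fourier_integral (truncate r (cscale c u)) \<xi> = c * fourier_integral (truncate r u) \<xi>" for \<xi>
    by (simp add: fourier_integral_cmult)
  show "AE x in lborel. rep_L2 (truncated_fourier r (cscale c u)) x = rep_L2 (cscale c (truncated_fourier r u)) x"
    using rep_truncated_fourier[of r "cscale c u"] rep_truncated_fourier[of r u]
      rep_L2_cscale[of c "truncated_fourier r u"]
    by eventually_elim (simp add: *)
qed

lemma truncated_fourier_diff_bound:
  assumes "s \<le> r"
  shows "ennreal ((norm (truncated_fourier r u - truncated_fourier s u))\<^sup>2)
    \<le> (\<integral>\<^sup>+x. ennreal (indicat_real (- cball 0 s) x * (cmod (rep_L2 u x))\<^sup>2) \<partial>lborel)"
proof -
  let ?g = "\<lambda>x. truncate r u x + (-1) * truncate s u x"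
  have ig: "integrable lborel ?g" by (intro Bochner_Integration.integrable_add integrable_mult_right truncate_integrable)
  have sg: "sq_integrable ?g" by (intro sq_integrable_add sq_integrable_cmult truncate_sq_integrable)
  have *: "fourier_integral ?g \<xi> = fourier_integral (truncate r u) \<xi> - fourier_integral (truncate s u) \<xi>" for \<xi>
    using fourier_integral_add[OF truncate_integrable[of r u] integrable_mult_right[OF truncate_integrable[of s u], of "-1"]]
      fourier_integral_cmult[of "-1" "truncate s u"] by simp
  have "ennreal ((norm (truncated_fourier r u - truncated_fourier s u))\<^sup>2)
      = (\<integral>\<^sup>+\<xi>. ennreal ((cmod (fourier_integral ?g \<xi>))\<^sup>2) \<partial>lborel)"
    unfolding norm_diff_L2_nn[symmetric]
    by (rule nn_integral_cong_AE, use rep_truncated_fourier[of r u] rep_truncated_fourier[of s u] in eventually_elim)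
       (simp only: *)
  also have "\<dots> \<le> (\<integral>\<^sup>+x. ennreal ((cmod (?g x))\<^sup>2) \<partial>lborel)"
    by (rule fourier_integral_bound(1)[OF ig sg])
  also have "\<dots> \<le> (\<integral>\<^sup>+x. ennreal (indicat_real (- cball 0 s) x * (cmod (rep_L2 u x))\<^sup>2) \<partial>lborel)"
    by (intro nn_integral_mono ennreal_leI) (use assms in \<open>auto simp: truncate_def indicator_def\<close>)
  finally show ?thesis .
qed

lemma norm_truncated_fourier_le: "norm (truncated_fourier r u) \<le> norm u"
proof -
  have "ennreal ((norm (truncated_fourier r u))\<^sup>2) = (\<integral>\<^sup>+\<xi>. ennreal ((cmod (fourier_integral (truncate r u) \<xi>))\<^sup>2) \<partial>lborel)"
    unfolding norm_L2_nn[symmetric]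
    by (rule nn_integral_cong_AE, use rep_truncated_fourier[of r u] in eventually_elim) simp
  also have "\<dots> \<le> (\<integral>\<^sup>+x. ennreal ((cmod (truncate r u x))\<^sup>2) \<partial>lborel)"
    by (rule fourier_integral_bound(1)[OF truncate_integrable truncate_sq_integrable])
  also have "\<dots> \<le> (\<integral>\<^sup>+x. ennreal ((cmod (rep_L2 u x))\<^sup>2) \<partial>lborel)"
    by (intro nn_integral_mono ennreal_leI) (auto simp: truncate_def indicator_def)
  finally have "(norm (truncated_fourier r u))\<^sup>2 \<le> (norm u)\<^sup>2" by (simp add: norm_L2_nn ennreal_le_iff)
  then show ?thesis by (rule power2_le_imp_le) simp
qed

text \<open>Two transforms differ by at most the mass of \<open>u\<close> outside the smaller ball,
  and this tail \<open>\<tau>\<close> tends to 0 by dominated convergence. Integer radii give a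
  Cauchy sequence; a real radius is compared with its integer part.\<close>

lemma truncated_fourier_convergent: "\<exists>v. ((\<lambda>r. truncated_fourier r u) \<longlongrightarrow> v) at_top"
proof -
  define \<tau> where "\<tau> = (\<lambda>n. LINT x|lborel. indicat_real (- cball 0 (real n)) x * (cmod (rep_L2 u x))\<^sup>2)"
  have iu: "integrable lborel (\<lambda>x. (cmod (rep_L2 u x))\<^sup>2)"
    using sq_integrable_rep[of u] by (simp add: sq_integrable_def)
  have "(\<lambda>n. indicat_real (- cball 0 (real n)) x * (cmod (rep_L2 u x))\<^sup>2) \<longlonglongrightarrow> 0" for x
  proof (rule tendsto_eventually)
    obtain n0 where n0: "norm x \<le> real n0" using real_arch_simple by blast
    show "\<forall>\<^sub>F n in sequentially. indicat_real (- cball 0 (real n)) x * (cmod (rep_L2 u x))\<^sup>2 = 0"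
      using eventually_ge_at_top[of n0]
    proof eventually_elim
      case (elim n)
      then have "norm x \<le> real n" using n0 by simp
      then show ?case by simp
    qed
  qed
  then have "\<tau> \<longlonglongrightarrow> (LINT x|(lborel :: 'a measure). (0::real))"
    unfolding \<tau>_def
    by (intro integral_dominated_convergence[OF _ _ iu]) (auto simp: indicator_def)
  then have \<tau>: "\<tau> \<longlonglongrightarrow> 0" by simp
  have bd: "(norm (truncated_fourier r u - truncated_fourier (real n) u))\<^sup>2 \<le> \<tau> n" if "real n \<le> r" for r n
  proof -
    have "integrable lborel (\<lambda>x. indicat_real (- cball 0 (real n)) x * (cmod (rep_L2 u x))\<^sup>2)"
      by (rule Bochner_Integration.integrable_bound[OF iu]) (auto simp: indicator_def)
    then have "(\<integral>\<^sup>+x. ennreal (indicat_real (- cball 0 (real n)) x * (cmod (rep_L2 u x))\<^sup>2) \<partial>lborel) = ennreal (\<tau> n)"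
      unfolding \<tau>_def by (intro nn_integral_eq_integral) auto
    moreover have "0 \<le> \<tau> n" unfolding \<tau>_def by simp
    ultimately show ?thesis
      using truncated_fourier_diff_bound[OF that, of u] by (simp add: ennreal_le_iff)
  qed
  have "Cauchy (\<lambda>n. truncated_fourier (real n) u)"
  proof (rule metric_CauchyI)
    fix e :: real assume e: "0 < e"
    with \<tau> have "\<forall>\<^sub>F n in sequentially. \<tau> n < (e / 2)\<^sup>2" by (intro order_tendstoD) auto
    then obtain n where n: "\<tau> n < (e / 2)\<^sup>2" by (auto simp: eventually_sequentially)
    have *: "dist (truncated_fourier (real m) u) (truncated_fourier (real n) u) < e / 2" if "n \<le> m" for m
    proof (rule power_less_imp_less_base)
      show "(dist (truncated_fourier (real m) u) (truncated_fourier (real n) u))\<^sup>2 < (e / 2)\<^sup>2"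
        unfolding dist_norm using that by (intro le_less_trans[OF bd n]) simp
    qed (use e in simp)
    show "\<exists>N. \<forall>m\<ge>N. \<forall>k\<ge>N. dist (truncated_fourier (real m) u) (truncated_fourier (real k) u) < e"
      by (rule exI[of _ n]) (blast intro: dist_triangle_half_l *)
  qed
  then obtain v where v: "(\<lambda>n. truncated_fourier (real n) u) \<longlonglongrightarrow> v"
    using Cauchy_convergent_iff convergent_def by blast
  have fl: "filterlim (\<lambda>r::real. nat \<lfloor>r\<rfloor>) sequentially at_top"
    by (rule filterlim_compose[OF filterlim_nat_sequentially filterlim_floor_sequentially])
  have "((\<lambda>r. truncated_fourier r u - truncated_fourier (real (nat \<lfloor>r\<rfloor>)) u) \<longlongrightarrow> 0) at_top"
  proof (rule tendsto_norm_zero_cancel, rule tendsto_sandwich[where f="\<lambda>_. 0"])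
    have "((\<lambda>r::real. sqrt (\<tau> (nat \<lfloor>r\<rfloor>))) \<longlongrightarrow> sqrt 0) at_top"
      by (rule tendsto_real_sqrt[OF filterlim_compose[OF \<tau> fl]])
    then show "((\<lambda>r::real. sqrt (\<tau> (nat \<lfloor>r\<rfloor>))) \<longlongrightarrow> 0) at_top" unfolding real_sqrt_zero .
    show "\<forall>\<^sub>F r in at_top. norm (truncated_fourier r u - truncated_fourier (real (nat \<lfloor>r\<rfloor>)) u) \<le> sqrt (\<tau> (nat \<lfloor>r\<rfloor>))"
      using eventually_ge_at_top[of 0] by eventually_elim (intro real_le_rsqrt bd, simp)
  qed auto
  from tendsto_add[OF this filterlim_compose[OF v fl]] have "((\<lambda>r. truncated_fourier r u) \<longlongrightarrow> v) at_top" by simp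
  then show ?thesis ..
qed

text \<open>Translates the definite description, which is phrased with integrals of representatives,
  into convergence in norm, where a limit exists and is unique.\<close>

lemma fourier_tendsto: "((\<lambda>r. truncated_fourier r u) \<longlongrightarrow> fourier u) at_top"
proof -
  have eq: "(\<integral>\<^sup>+\<xi>. ennreal ((cmod (fourier_integral (\<lambda>x. indicator (cball 0 r) x * rep_L2 u x) \<xi> - rep_L2 v \<xi>))\<^sup>2) \<partial>lborel)
      = ennreal ((norm (truncated_fourier r u - v))\<^sup>2)" for r v
    unfolding norm_diff_L2_nn[symmetric] truncate_def[symmetric]
    by (rule nn_integral_cong_AE, use rep_truncated_fourier[of r u] in eventually_elim) simp
  have iff: "((\<lambda>r. ennreal ((norm (truncated_fourier r u - v))\<^sup>2)) \<longlongrightarrow> 0) at_top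
      \<longleftrightarrow> ((\<lambda>r. truncated_fourier r u) \<longlongrightarrow> v) at_top" for v
  proof
    assume "((\<lambda>r. ennreal ((norm (truncated_fourier r u - v))\<^sup>2)) \<longlongrightarrow> 0) at_top"
    then have "((\<lambda>r. (norm (truncated_fourier r u - v))\<^sup>2) \<longlongrightarrow> 0) at_top"
      by (subst (asm) ennreal_0[symmetric], subst (asm) tendsto_ennreal_iff) auto
    then have "((\<lambda>r. sqrt ((norm (truncated_fourier r u - v))\<^sup>2)) \<longlongrightarrow> sqrt 0) at_top"
      by (intro tendsto_intros)
    then show "((\<lambda>r. truncated_fourier r u) \<longlongrightarrow> v) at_top"
      by (simp add: tendsto_norm_zero_iff LIM_zero_iff)
  next
    assume "((\<lambda>r. truncated_fourier r u) \<longlongrightarrow> v) at_top"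
    then have "((\<lambda>r. ennreal ((norm (truncated_fourier r u - v))\<^sup>2)) \<longlongrightarrow> ennreal ((norm (v - v))\<^sup>2)) at_top"
      by (intro tendsto_ennrealI tendsto_intros)
    then show "((\<lambda>r. ennreal ((norm (truncated_fourier r u - v))\<^sup>2)) \<longlongrightarrow> 0) at_top" by simp
  qed
  have "fourier u = (THE v. ((\<lambda>r. truncated_fourier r u) \<longlongrightarrow> v) at_top)"
    unfolding fourier_def eq iff ..
  moreover obtain v where v: "((\<lambda>r. truncated_fourier r u) \<longlongrightarrow> v) at_top"
    using truncated_fourier_convergent by blast
  moreover have "(THE v. ((\<lambda>r. truncated_fourier r u) \<longlongrightarrow> v) at_top) = v"
    using v by (intro the_equality) (auto intro: tendsto_unique[OF trivial_limit_at_top_linorder])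
  ultimately show ?thesis by simp
qed

lemma fourier_add: "fourier (u + v) = fourier u + fourier v"
  using tendsto_add[OF fourier_tendsto fourier_tendsto, of u v] fourier_tendsto[of "u + v"]
  unfolding truncated_fourier_add by (rule tendsto_unique[OF trivial_limit_at_top_linorder, rotated])

lemma fourier_cscale: "fourier (cscale c u) = cscale c (fourier u)"
  using bounded_linear.tendsto[OF cscale_linear fourier_tendsto, of c u] fourier_tendsto[of "cscale c u"]
  unfolding truncated_fourier_cscale by (rule tendsto_unique[OF trivial_limit_at_top_linorder, rotated])

lemma norm_fourier_le: "norm (fourier u) \<le> norm u"
  by (rule tendsto_upperbound[OF tendsto_norm[OF fourier_tendsto]])
     (auto simp: norm_truncated_fourier_le)

lemma bounded_linear_fourier: "bounded_linear fourier"
  by (rule bounded_linear_intro[of _ 1])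
     (auto simp: fourier_add norm_fourier_le fourier_cscale simp flip: cscale_of_real)

section \<open>The Schroedinger group in Fourier space\<close>

instance L2 :: (euclidean_space) banach ..

section \<open>The generator and its dense domain\<close>

lemma difference_quotient_tendsto:
  fixes f :: "real \<Rightarrow> 'b::real_normed_vector"
  assumes "(f has_vector_derivative v) (at x)"
  shows "((\<lambda>h. (1 / h) *\<^sub>R (f (x + h) - f x)) \<longlongrightarrow> v) (at 0)"
proof (rule LIM_zero_cancel, rule tendsto_norm_zero_cancel)
  have "((\<lambda>h. norm (f (x + h) - f x - h *\<^sub>R v) / norm h) \<longlongrightarrow> 0) (at 0)"
    using assms by (simp add: has_vector_derivative_def has_derivative_at)
  moreover have "\<forall>\<^sub>F h in at 0. norm (f (x + h) - f x - h *\<^sub>R v) / norm h = norm ((1 / h) *\<^sub>R (f (x + h) - f x) - v)"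
    unfolding eventually_at_filter
  proof (rule always_eventually, intro allI impI)
    fix h :: real assume "h \<noteq> 0"
    then have "(1 / h) *\<^sub>R (f (x + h) - f x) - v = (1 / h) *\<^sub>R (f (x + h) - f x - h *\<^sub>R v)"
      by (simp add: scaleR_diff_right)
    then show "norm (f (x + h) - f x - h *\<^sub>R v) / norm h = norm ((1 / h) *\<^sub>R (f (x + h) - f x) - v)"
      by simp
  qed
  ultimately show "((\<lambda>h. norm ((1 / h) *\<^sub>R (f (x + h) - f x) - v)) \<longlongrightarrow> 0) (at 0)"
    by (rule Lim_transform_eventually)
qed

definition generator_graph :: "(real \<Rightarrow> 'b::real_normed_vector \<Rightarrow>\<^sub>L 'b) \<Rightarrow> 'b \<Rightarrow> 'b \<Rightarrow> bool" where
  "generator_graph S u v \<longleftrightarrow> ((\<lambda>h. (1 / h) *\<^sub>R (S h u - u)) \<longlongrightarrow> v) (at 0)"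

text \<open>Time averages of the orbit of \<open>u\<close> over short intervals lie in the domain by
  the fundamental theorem of calculus, and they tend to \<open>u\<close> as the interval
  shrinks.\<close>

lemma generator_domain_dense:
  fixes S :: "real \<Rightarrow> 'b::banach \<Rightarrow>\<^sub>L 'b"
  assumes S0: "S 0 = id_blinfun" and Sadd: "\<And>s t. S (s + t) = S s o\<^sub>L S t"
    and cont: "\<And>u. continuous_on UNIV (\<lambda>t. S t u)" and e: "0 < e"
  shows "\<exists>u' v. generator_graph S u' v \<and> norm (u' - u) < e"
proof -
  define f where "f = (\<lambda>s. S s u)"
  have fc: "continuous_on A f" for A unfolding f_def using cont continuous_on_subset by blast
  have fi: "f integrable_on {a..b}" for a b by (intro integrable_continuous_real fc)
  \<comment> \<open>The primitive starts at -1 so that 0 is an interior point: the limit that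
    defines the generator is two-sided.\<close>
  define \<Phi> where "\<Phi> = (\<lambda>x. integral {-1..x} f)"
  have \<Phi>': "(\<Phi> has_vector_derivative f x) (at x)" if "-1 < x" "x < 2" for x
    using integral_has_vector_derivative[OF fc, of x "-1" 2] that
    by (simp add: \<Phi>_def at_within_Icc_at)
  note dq = difference_quotient_tendsto[OF \<Phi>']
  have \<Phi>int: "integral {a..b} f = \<Phi> b - \<Phi> a" if "-1 \<le> a" "a \<le> b" for a b
    using Henstock_Kurzweil_Integration.integral_combine[OF that fi] by (simp add: \<Phi>_def algebra_simps)
  have "((\<lambda>h. (1 / h) *\<^sub>R (\<Phi> (0 + h) - \<Phi> 0)) \<longlongrightarrow> f 0) (at 0)" by (rule dq) auto
  moreover have "f 0 = u" by (simp add: f_def S0)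
  ultimately have lim: "((\<lambda>h. (1 / h) *\<^sub>R (\<Phi> h - \<Phi> 0)) \<longlongrightarrow> u) (at 0)" by simp
  from LIM_D[OF lim e] obtain \<delta> where \<delta>: "0 < \<delta>" "\<And>h. h \<noteq> 0 \<Longrightarrow> \<bar>h\<bar> < \<delta> \<Longrightarrow> norm ((1 / h) *\<^sub>R (\<Phi> h - \<Phi> 0) - u) < e"
    by auto
  define h where "h = min (\<delta> / 2) 1"
  have h: "0 < h" "h \<le> 1" "h < \<delta>" using \<delta>(1) by (auto simp: h_def min_def)
  define u' where "u' = (1 / h) *\<^sub>R (\<Phi> h - \<Phi> 0)"
  have close: "norm (u' - u) < e" unfolding u'_def using \<delta>(2)[of h] h by auto
  \<comment> \<open>The group shifts the window of the average, so only boundary contributions at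
    \<open>h\<close> and 0 remain, and each is a difference of \<open>\<Phi>\<close>.\<close>
  have shift: "S r u' - u' = (1 / h) *\<^sub>R ((\<Phi> (h + r) - \<Phi> h) - (\<Phi> (0 + r) - \<Phi> 0))" if r: "\<bar>r\<bar> < 1" for r
  proof -
    have "S r (\<Phi> h - \<Phi> 0) = S r (integral {0..h} f)" using \<Phi>int[of 0 h] h by simp
    also have "\<dots> = integral {0..h} (blinfun_apply (S r) \<circ> f)"
      by (rule integral_linear[symmetric, OF fi blinfun.bounded_linear_right])
    also have "blinfun_apply (S r) \<circ> f = f \<circ> ((+) r)" by (auto simp: f_def Sadd)
    also have "integral {0..h} (f \<circ> ((+) r)) = integral {0 + r..h + r} f" by (rule integral_shift_Icc_real)
    also have "\<dots> = \<Phi> (h + r) - \<Phi> (0 + r)" by (rule \<Phi>int) (use r h in auto)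
    finally have eq: "S r (\<Phi> h - \<Phi> 0) = \<Phi> (h + r) - \<Phi> (0 + r)" .
    show ?thesis
      unfolding u'_def blinfun.scaleR_right eq by (simp add: scaleR_diff_right)
  qed
  have "((\<lambda>r. (1 / h) *\<^sub>R ((1 / r) *\<^sub>R (\<Phi> (h + r) - \<Phi> h) - (1 / r) *\<^sub>R (\<Phi> (0 + r) - \<Phi> 0)))
      \<longlongrightarrow> (1 / h) *\<^sub>R (f h - f 0)) (at 0)"
    by (intro tendsto_intros dq) (use h in auto)
  moreover have "\<forall>\<^sub>F r in at 0. (1 / h) *\<^sub>R ((1 / r) *\<^sub>R (\<Phi> (h + r) - \<Phi> h) - (1 / r) *\<^sub>R (\<Phi> (0 + r) - \<Phi> 0))
      = (1 / r) *\<^sub>R (S r u' - u')"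
    using eventually_at_ball[of 1 0 UNIV]
    by (rule eventually_mono) (auto simp: shift scaleR_diff_right dist_norm mult.commute)
  ultimately have "generator_graph S u' ((1 / h) *\<^sub>R (f h - f 0))"
    unfolding generator_graph_def by (rule Lim_transform_eventually)
  with close show ?thesis by blast
qed

section \<open>The Fourier symbol of the group\<close>

text \<open>The Laplacian has symbol \<open>- (norm \<xi>)\<^sup>2\<close>, so the generator becomes
  multiplication by \<open>\<i> * (norm \<xi>)\<^sup>2\<close>, and this is its exponential.\<close>

definition phase :: "real \<Rightarrow> 'a::euclidean_space \<Rightarrow> complex" where
  "phase t \<xi> = iexp (t * (norm \<xi>)\<^sup>2)"

lemma phase_measurable [measurable]: "phase t \<in> borel_measurable borel"
  unfolding phase_def[abs_def] by measurable

lemma norm_phase [simp]: "cmod (phase t \<xi>) = 1"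
  by (simp add: phase_def)

lemma phase_add: "phase (s + t) \<xi> = phase s \<xi> * phase t \<xi>"
  by (simp add: phase_def exp_add[symmetric] distrib_right algebra_simps)

lemma phase_0 [simp]: "phase 0 \<xi> = 1" by (simp add: phase_def)

lemma rep_mulL_phase: "AE \<xi> in lborel. rep_L2 (mulL (phase t) u) \<xi> = phase t \<xi> * rep_L2 u \<xi>"
  by (rule rep_mulL[where c=1]) auto

lemma rep_fourier_generator:
  assumes S: "schroedinger_group S" and D: "generator_graph S u v"
  shows "AE \<xi> in lborel. rep_L2 (fourier v) \<xi> = \<i> * of_real ((norm \<xi>)\<^sup>2) * rep_L2 (fourier u) \<xi>"
proof -
  obtain w where w: "has_laplacian u w" "v = cscale (- \<i>) w"
    using S D unfolding schroedinger_group_def generator_graph_def by blast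
  from w(1) have "AE \<xi> in lborel. rep_L2 (fourier w) \<xi> = - of_real ((norm \<xi>)\<^sup>2) * rep_L2 (fourier u) \<xi>"
    by (simp add: has_laplacian_def)
  then show ?thesis
    unfolding w(2) fourier_cscale using rep_L2_cscale[of "- \<i>" "fourier w"]
    by eventually_elim simp
qed

text \<open>The group leaves the domain invariant and commutes with its generator; this carries the
  derivative at time 0 to every time \<open>t\<close>.\<close>

lemma generator_graph_group:
  assumes S: "schroedinger_group S" and D: "generator_graph S u v"
  shows "generator_graph S (S t u) (S t v)"
proof -
  have Sadd: "S (s + t) = S s o\<^sub>L S t" for s t
    using S by (auto simp: schroedinger_group_def unitary_group_def)
  have "((\<lambda>h. S t ((1 / h) *\<^sub>R (S h u - u))) \<longlongrightarrow> S t v) (at 0)"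
    using D unfolding generator_graph_def by (rule blinfun.tendsto[OF tendsto_const])
  moreover have "S t ((1 / h) *\<^sub>R (S h u - u)) = (1 / h) *\<^sub>R (S h (S t u) - S t u)" for h
    using Sadd[of t h] Sadd[of h t] by (simp add: blinfun.scaleR_right blinfun.diff_right add.commute)
       (metis blinfun_apply_blinfun_compose)
  ultimately show ?thesis by (simp add: generator_graph_def)
qed

text \<open>On the range of a spectral cutoff, \<open>exp (- \<i> t |\<xi>|\<^sup>2)\<close> times the transform of \<open>S t u\<close> has derivative
  zero in \<open>t\<close>, so it is constant.\<close>

lemma fourier_group_domain:
  assumes S: "schroedinger_group (S :: real \<Rightarrow> 'a::euclidean_space L2 \<Rightarrow>\<^sub>L 'a L2)" and D: "generator_graph S u v"
  shows "fourier (S t u) = mulL (phase t) (fourier u)"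
proof -
  interpret F: bounded_linear fourier by (rule bounded_linear_fourier)
  have S0: "S 0 = id_blinfun" and Sadd: "\<And>s t. S (s + t) = S s o\<^sub>L S t" and Sn: "\<And>t u. norm (S t u) = norm u"
    using S by (auto simp: schroedinger_group_def unitary_group_def)
  have cut: "AE \<xi> in lborel. indicator (cball 0 \<rho>) \<xi> * phase (- t) \<xi> * rep_L2 (fourier (S t u)) \<xi>
      = indicator (cball 0 \<rho>) \<xi> * rep_L2 (fourier u) \<xi>" if \<rho>: "0 \<le> \<rho>" for \<rho> :: real
  proof -
    define m where "m = (\<lambda>t \<xi>::'a. indicator (cball 0 \<rho>) \<xi> * phase (- t) \<xi>)"
    have mm: "m t \<in> borel_measurable borel" "cmod (m t \<xi>) \<le> 1" for t \<xi>
      unfolding m_def by (auto simp: norm_mult indicator_def)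
    define y where "y = (\<lambda>t. mulL (m t) (fourier (S t u)))"
    have "(y has_derivative (\<lambda>h. 0)) (at t within UNIV)" for t
    proof -
      let ?f = "fourier (S t u)"
      let ?a = "\<lambda>h. fourier (S (t + h) u) - ?f - h *\<^sub>R fourier (S t v)"
      \<comment> \<open>First-order Taylor remainder of the phase. The cutoff built into
        \<open>m\<close> bounds it by a multiple of \<open>h\<^sup>2\<close> uniformly in the
        frequency, which is why the argument runs on balls.\<close>
      define m2 where "m2 = (\<lambda>h \<xi>. m (t + h) \<xi> * (1 + \<i> * of_real (h * (norm \<xi>)\<^sup>2) - phase h \<xi>))"
      have m2: "m2 h \<in> borel_measurable borel" "cmod (m2 h \<xi>) \<le> h\<^sup>2 * \<rho> ^ 4" for h \<xi>
      proof -
        show "m2 h \<in> borel_measurable borel"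
          unfolding m2_def using mm(1) by measurable
        show "cmod (m2 h \<xi>) \<le> h\<^sup>2 * \<rho> ^ 4"
        proof (cases "norm \<xi> \<le> \<rho>")
          case True
          have "cmod (iexp (h * (norm \<xi>)\<^sup>2) - (\<Sum>k\<le>1. (\<i> * of_real (h * (norm \<xi>)\<^sup>2)) ^ k / fact k))
              \<le> \<bar>h * (norm \<xi>)\<^sup>2\<bar> ^ Suc 1 / fact (Suc 1)"
            by (rule iexp_approx1)
          then have "cmod (1 + \<i> * of_real (h * (norm \<xi>)\<^sup>2) - phase h \<xi>) \<le> (h * (norm \<xi>)\<^sup>2)\<^sup>2 / 2"
            by (simp add: phase_def norm_minus_commute numeral_2_eq_2)
          also have "\<dots> \<le> (h * (norm \<xi>)\<^sup>2)\<^sup>2" by simp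
          also have "\<dots> = h\<^sup>2 * norm \<xi> ^ 4" by (simp add: power_mult_distrib)
          also have "\<dots> \<le> h\<^sup>2 * \<rho> ^ 4" by (intro mult_left_mono power_mono True) auto
          finally have b: "cmod (1 + \<i> * of_real (h * (norm \<xi>)\<^sup>2) - phase h \<xi>) \<le> h\<^sup>2 * \<rho> ^ 4" .
          have "cmod (m2 h \<xi>) \<le> 1 * cmod (1 + \<i> * of_real (h * (norm \<xi>)\<^sup>2) - phase h \<xi>)"
            unfolding m2_def norm_mult by (intro mult_right_mono mm) auto
          with b show ?thesis by simp
        qed (use \<rho> in \<open>simp add: m2_def m_def\<close>)
      qed
      \<comment> \<open>The increment splits into the first-order error of the group, which is
        controlled by the generator, and that of the phase; the two linear terms cancel because the
        generator has the symbol of the phase.\<close>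
      have eq: "y (t + h) - y t = mulL (m (t + h)) (?a h) + mulL (m2 h) ?f" for h
      proof (rule L2_eqI)
        have rv: "AE \<xi> in lborel. rep_L2 (fourier (S t v)) \<xi> = \<i> * of_real ((norm \<xi>)\<^sup>2) * rep_L2 ?f \<xi>"
          by (rule rep_fourier_generator[OF S generator_graph_group[OF S D]])
        have ry: "AE \<xi> in lborel. rep_L2 (y t) \<xi> = m t \<xi> * rep_L2 (fourier (S t u)) \<xi>" for t
          unfolding y_def by (rule rep_mulL[OF mm])
        show "AE \<xi> in lborel. rep_L2 (y (t + h) - y t) \<xi> = rep_L2 (mulL (m (t + h)) (?a h) + mulL (m2 h) ?f) \<xi>"
          using rep_L2_diff[of "y (t + h)" "y t"] ry[of "t + h"] ry[of t] rep_L2_plus[of "mulL (m (t + h)) (?a h)" "mulL (m2 h) ?f"]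
            rep_mulL[OF mm, of "t + h" "?a h"] rep_mulL[OF m2, of h ?f]
            rep_L2_diff[of "fourier (S (t + h) u) - ?f" "h *\<^sub>R fourier (S t v)"]
            rep_L2_diff[of "fourier (S (t + h) u)" ?f] rep_L2_scaleR[of h "fourier (S t v)"] rv
        proof eventually_elim
          case (elim \<xi>)
          have p: "m t \<xi> = m (t + h) \<xi> * phase h \<xi>"
            by (simp add: m_def mult.assoc phase_add[symmetric])
          have q: "m2 h \<xi> = m (t + h) \<xi> * (1 + \<i> * of_real (h * (norm \<xi>)\<^sup>2) - phase h \<xi>)"
            by (simp add: m2_def)
          show ?case
            by (simp only: elim p q) (simp add: algebra_simps)
        qed
      qed
      have bd: "norm (y (t + h) - y t) / norm h \<le> norm ((1 / h) *\<^sub>R (S h u - u) - v) + \<bar>h\<bar> * (\<rho> ^ 4 * norm ?f)"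
        if h: "h \<noteq> 0" for h
      proof -
        have Sth: "S (t + h) u = S t (S h u)" by (simp add: Sadd)
        have "norm (?a h) = norm (fourier (S t (S h u - u - h *\<^sub>R v)))"
          by (simp add: Sth F.diff F.scaleR blinfun.diff_right blinfun.scaleR_right)
        also have "\<dots> \<le> norm (S h u - u - h *\<^sub>R v)"
          using norm_fourier_le[of "S t (S h u - u - h *\<^sub>R v)"] by (simp add: Sn)
        also have "S h u - u - h *\<^sub>R v = h *\<^sub>R ((1 / h) *\<^sub>R (S h u - u) - v)"
          using h by (simp add: scaleR_diff_right)
        finally have a: "norm (?a h) \<le> \<bar>h\<bar> * norm ((1 / h) *\<^sub>R (S h u - u) - v)" by simp
        have "norm (y (t + h) - y t) \<le> 1 * norm (?a h) + (h\<^sup>2 * \<rho> ^ 4) * norm ?f"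
          unfolding eq by (intro order_trans[OF norm_triangle_ineq] add_mono norm_mulL_le mm m2)
        also have "\<dots> \<le> \<bar>h\<bar> * (norm ((1 / h) *\<^sub>R (S h u - u) - v) + \<bar>h\<bar> * (\<rho> ^ 4 * norm ?f))"
          using a by (simp add: distrib_left power2_eq_square mult.assoc[symmetric])
        finally show ?thesis using h by (simp add: divide_le_eq mult.commute)
      qed
      have "((\<lambda>h. norm (y (t + h) - y t) / norm h) \<longlongrightarrow> 0) (at 0)"
      proof (rule tendsto_sandwich[where f="\<lambda>_. 0"])
        have "((\<lambda>h. norm ((1 / h) *\<^sub>R (S h u - u) - v) + \<bar>h\<bar> * (\<rho> ^ 4 * norm ?f)) \<longlongrightarrow> norm (v - v) + \<bar>0\<bar> * (\<rho> ^ 4 * norm ?f)) (at 0)"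
          using D unfolding generator_graph_def by (intro tendsto_intros)
        then show "((\<lambda>h. norm ((1 / h) *\<^sub>R (S h u - u) - v) + \<bar>h\<bar> * (\<rho> ^ 4 * norm ?f)) \<longlongrightarrow> 0) (at 0)" by simp
        show "\<forall>\<^sub>F h in at 0. norm (y (t + h) - y t) / norm h \<le> norm ((1 / h) *\<^sub>R (S h u - u) - v) + \<bar>h\<bar> * (\<rho> ^ 4 * norm ?f)"
          unfolding eventually_at_filter by (rule always_eventually) (use bd in blast)
      qed auto
      then show ?thesis by (simp add: has_derivative_at)
    qed
    from has_derivative_zero_constant[OF convex_UNIV this] have "y t = y 0" by (metis UNIV_I)
    then have eqm: "mulL (m t) (fourier (S t u)) = mulL (m 0) (fourier u)" by (simp add: y_def S0)
    show ?thesis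
      using rep_mulL[OF mm, of t "fourier (S t u)"] rep_mulL[OF mm, of 0 "fourier u"]
    proof eventually_elim
      case (elim \<xi>)
      then have "m t \<xi> * rep_L2 (fourier (S t u)) \<xi> = m 0 \<xi> * rep_L2 (fourier u) \<xi>"
        unfolding eqm by simp
      then show ?case by (simp add: m_def)
    qed
  qed
  \<comment> \<open>Balls of integer radius exhaust the space, and their countably many null sets
    can be discarded together.\<close>
  have "AE \<xi> in lborel. \<forall>n::nat. indicator (cball 0 (real n)) \<xi> * phase (- t) \<xi> * rep_L2 (fourier (S t u)) \<xi>
      = indicator (cball 0 (real n)) \<xi> * rep_L2 (fourier u) \<xi>"
    unfolding AE_all_countable using cut by simp
  then have ae: "AE \<xi> in lborel. rep_L2 (fourier (S t u)) \<xi> = phase t \<xi> * rep_L2 (fourier u) \<xi>"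
  proof eventually_elim
    case (elim \<xi>)
    obtain n where "norm \<xi> \<le> real n" using real_arch_simple by blast
    with spec[OF elim, of n] have *: "phase (- t) \<xi> * rep_L2 (fourier (S t u)) \<xi> = rep_L2 (fourier u) \<xi>" by simp
    show ?case unfolding *[symmetric] mult.assoc[symmetric] phase_add[symmetric] by simp
  qed
  show ?thesis
    by (rule L2_eqI, use ae rep_mulL_phase[of t "fourier u"] in eventually_elim) simp
qed

text \<open>Both sides are contractions in \<open>u\<close> and agree on the domain, so their
  difference at \<open>u\<close> is at most twice the distance from \<open>u\<close> to the domain,
  which is zero by density.\<close>

lemma fourier_group:
  assumes S: "schroedinger_group (S :: real \<Rightarrow> 'a::euclidean_space L2 \<Rightarrow>\<^sub>L 'a L2)"
  shows "fourier (S t u) = mulL (phase t) (fourier u)"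
proof (rule ccontr)
  have S0: "S 0 = id_blinfun" and Sadd: "\<And>s t. S (s + t) = S s o\<^sub>L S t" and Sn: "\<And>t u. norm (S t u) = norm u"
    and Sc: "\<And>u. continuous_on UNIV (\<lambda>t. S t u)"
    using S by (auto simp: schroedinger_group_def unitary_group_def)
  interpret F: bounded_linear fourier by (rule bounded_linear_fourier)
  interpret P: bounded_linear "mulL (phase t)" by (rule bounded_linear_mulL[of _ 1]) auto
  let ?L = "\<lambda>u. fourier (S t u) - mulL (phase t) (fourier u)"
  assume "fourier (S t u) \<noteq> mulL (phase t) (fourier u)"
  then have pos: "0 < norm (?L u) / 2" by simp
  from generator_domain_dense[OF S0 Sadd Sc this] obtain u' v
    where u': "generator_graph S u' v" "norm (u' - u) < norm (?L u) / 2" by blast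
  have "?L u = - ?L (u' - u)"
    using fourier_group_domain[OF S u'(1), of t]
    by (simp add: F.diff P.diff blinfun.diff_right)
  then have "norm (?L u) = norm (?L (u' - u))" by (metis norm_minus_cancel)
  also have "\<dots> \<le> norm (fourier (S t (u' - u))) + norm (mulL (phase t) (fourier (u' - u)))"
    by (rule norm_triangle_ineq4)
  also have "\<dots> \<le> norm (u' - u) + 1 * norm (u' - u)"
  proof (intro add_mono)
    show "norm (fourier (S t (u' - u))) \<le> norm (u' - u)"
      using norm_fourier_le[of "S t (u' - u)"] by (simp add: Sn)
    have "norm (mulL (phase t) (fourier (u' - u))) \<le> 1 * norm (fourier (u' - u))"
      by (rule norm_mulL_le) auto
    also have "\<dots> \<le> 1 * norm (u' - u)" using norm_fourier_le by simp
    finally show "norm (mulL (phase t) (fourier (u' - u))) \<le> 1 * norm (u' - u)" .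
  qed
  finally show False using u'(2) by linarith
qed

section \<open>Truncated Sobolev norms\<close>

text \<open>The cutoff makes the weight bounded, so \<open>trunc_sobolev\<close> is a bounded
  operator on \<open>L2\<close> and its coordinates may be applied to a stochastic integral that
  converges in \<open>L2\<close> only.\<close>

definition sobolev_weight :: "real \<Rightarrow> real \<Rightarrow> 'a::euclidean_space \<Rightarrow> complex" where
  "sobolev_weight \<sigma> \<rho> \<xi> = indicator (cball 0 \<rho>) \<xi> * of_real ((1 + (norm \<xi>)\<^sup>2) powr (\<sigma> / 2))"

definition trunc_sobolev :: "real \<Rightarrow> real \<Rightarrow> 'a::euclidean_space L2 \<Rightarrow> 'a L2" where
  "trunc_sobolev \<sigma> \<rho> u = mulL (sobolev_weight \<sigma> \<rho>) (fourier u)"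

lemma cball_borel [measurable]: "cball x r \<in> sets borel"
  by simp

lemma sobolev_weight_measurable [measurable]: "sobolev_weight \<sigma> \<rho> \<in> borel_measurable borel"
  unfolding sobolev_weight_def[abs_def] by measurable

lemma sobolev_weight_bound:
  assumes "0 \<le> \<sigma>"
  shows "cmod (sobolev_weight \<sigma> \<rho> \<xi>) \<le> (1 + \<rho>\<^sup>2) powr (\<sigma> / 2)"
proof (cases "norm \<xi> \<le> \<rho>")
  case True
  then have "(norm \<xi>)\<^sup>2 \<le> \<rho>\<^sup>2" by (intro power_mono) auto
  then show ?thesis using True assms
    by (auto simp: sobolev_weight_def norm_mult intro!: powr_mono2 add_nonneg_nonneg)
qed (simp add: sobolev_weight_def)

lemma bounded_linear_trunc_sobolev: "0 \<le> \<sigma> \<Longrightarrow> bounded_linear (trunc_sobolev \<sigma> \<rho>)"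
  unfolding trunc_sobolev_def[abs_def]
  by (rule bounded_linear_compose[OF bounded_linear_mulL[OF sobolev_weight_measurable sobolev_weight_bound]
        bounded_linear_fourier])

lemma norm_trunc_sobolev_nn:
  assumes "0 \<le> \<sigma>"
  shows "ennreal ((norm (trunc_sobolev \<sigma> \<rho> u))\<^sup>2)
    = (\<integral>\<^sup>+\<xi>. ennreal ((1 + (norm \<xi>)\<^sup>2) powr \<sigma> * (cmod (rep_L2 (fourier u) \<xi>))\<^sup>2) * indicator (cball 0 \<rho>) \<xi> \<partial>lborel)"
proof -
  have "(cmod (sobolev_weight \<sigma> \<rho> \<xi>))\<^sup>2 = (1 + (norm \<xi>)\<^sup>2) powr \<sigma> * indicator (cball 0 \<rho>) \<xi>" for \<xi> :: 'a
    by (simp add: sobolev_weight_def norm_mult power_mult_distrib indicator_def power2_eq_square powr_add[symmetric])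
  then show ?thesis
    unfolding trunc_sobolev_def norm_mulL_nn[OF sobolev_weight_measurable sobolev_weight_bound[OF assms]]
    by (intro nn_integral_cong) (simp add: indicator_def)
qed

lemma esqrt_sq: "(esqrt x)\<^sup>2 = x"
  by (cases x) (auto simp: esqrt_def ennreal_power)

lemma sobolev_norm_sq: "(sobolev_norm \<sigma> u)\<^sup>2
    = (\<integral>\<^sup>+\<xi>. ennreal ((1 + (norm \<xi>)\<^sup>2) powr \<sigma> * (cmod (rep_L2 (fourier u) \<xi>))\<^sup>2) \<partial>lborel)"
  by (simp add: sobolev_norm_def esqrt_sq)

lemma trunc_sobolev_le:
  "0 \<le> \<sigma> \<Longrightarrow> ennreal ((norm (trunc_sobolev \<sigma> \<rho> u))\<^sup>2) \<le> (sobolev_norm \<sigma> u)\<^sup>2"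
  unfolding norm_trunc_sobolev_nn sobolev_norm_sq
  by (intro nn_integral_mono) (auto simp: indicator_def)

text \<open>Monotone convergence, valid in the extended reals, so finiteness of the Sobolev norm of
  the error need not be known beforehand.\<close>

lemma trunc_sobolev_tendsto:
  assumes "0 \<le> \<sigma>"
  shows "(\<lambda>n. ennreal ((norm (trunc_sobolev \<sigma> (real n) u))\<^sup>2)) \<longlonglongrightarrow> (sobolev_norm \<sigma> u)\<^sup>2"
  unfolding norm_trunc_sobolev_nn[OF assms] sobolev_norm_sq
proof (rule nn_integral_LIMSEQ)
  show "incseq (\<lambda>n \<xi>. ennreal ((1 + (norm \<xi>)\<^sup>2) powr \<sigma> * (cmod (rep_L2 (fourier u) \<xi>))\<^sup>2) * indicator (cball 0 (real n)) \<xi>)"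
    by (auto simp: incseq_def le_fun_def indicator_def)
  show "(\<lambda>\<xi>. ennreal ((1 + (norm \<xi>)\<^sup>2) powr \<sigma> * (cmod (rep_L2 (fourier u) \<xi>))\<^sup>2) * indicator (cball 0 (real n)) \<xi>)
      \<in> borel_measurable lborel" for n by measurable
  show "(\<lambda>n. ennreal ((1 + (norm \<xi>)\<^sup>2) powr \<sigma> * (cmod (rep_L2 (fourier u) \<xi>))\<^sup>2) * indicator (cball 0 (real n)) \<xi>)
      \<longlonglongrightarrow> ennreal ((1 + (norm \<xi>)\<^sup>2) powr \<sigma> * (cmod (rep_L2 (fourier u) \<xi>))\<^sup>2)" for \<xi>
  proof (rule tendsto_eventually)
    obtain n0 where n0: "norm \<xi> \<le> real n0" using real_arch_simple by blast
    show "\<forall>\<^sub>F n in sequentially. ennreal ((1 + (norm \<xi>)\<^sup>2) powr \<sigma> * (cmod (rep_L2 (fourier u) \<xi>))\<^sup>2)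
        * indicator (cball 0 (real n)) \<xi> = ennreal ((1 + (norm \<xi>)\<^sup>2) powr \<sigma> * (cmod (rep_L2 (fourier u) \<xi>))\<^sup>2)"
      using eventually_ge_at_top[of n0]
    proof eventually_elim
      case (elim n)
      then have "norm \<xi> \<le> real n" using n0 by simp
      then show ?case by simp
    qed
  qed
qed

lemma sobolev_norm_group:
  assumes "schroedinger_group S"
  shows "sobolev_norm \<sigma> (S t u) = sobolev_norm \<sigma> u"
proof -
  have "AE \<xi> in lborel. rep_L2 (fourier (S t u)) \<xi> = phase t \<xi> * rep_L2 (fourier u) \<xi>"
    unfolding fourier_group[OF assms] by (rule rep_mulL_phase)
  then show ?thesis
    unfolding sobolev_norm_def
    by (intro arg_cong[where f=esqrt] nn_integral_cong_AE) (elim eventually_mono, simp add: norm_mult)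
qed

lemma sobolev_norm_cscale_unit:
  assumes "cmod c = 1"
  shows "sobolev_norm \<sigma> (cscale c u) = sobolev_norm \<sigma> u"
proof -
  have "AE \<xi> in lborel. rep_L2 (fourier (cscale c u)) \<xi> = c * rep_L2 (fourier u) \<xi>"
    unfolding fourier_cscale by (rule rep_L2_cscale)
  then show ?thesis
    unfolding sobolev_norm_def
    by (intro arg_cong[where f=esqrt] nn_integral_cong_AE) (elim eventually_mono, simp add: norm_mult assms)
qed

text \<open>The source of the rate: the group is Lipschitz in time at the price of two derivatives.\<close>

lemma trunc_sobolev_group_diff:
  assumes S: "schroedinger_group S" and \<sigma>: "0 \<le> \<sigma>"
  shows "norm (trunc_sobolev \<sigma> \<rho> (S s u - S r u)) \<le> \<bar>s - r\<bar> * norm (trunc_sobolev (\<sigma> + 2) \<rho> u)"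
proof -
  interpret F: bounded_linear fourier by (rule bounded_linear_fourier)
  have ph: "AE \<xi> in lborel. rep_L2 (fourier (S t u)) \<xi> = phase t \<xi> * rep_L2 (fourier u) \<xi>" for t
    unfolding fourier_group[OF S] by (rule rep_mulL_phase)
  have pd: "cmod (phase s \<xi> - phase r \<xi>) \<le> \<bar>s - r\<bar> * (1 + (norm \<xi>)\<^sup>2)" for \<xi> :: 'a
  proof -
    have "phase s \<xi> - phase r \<xi> = phase r \<xi> * (phase (s - r) \<xi> - 1)"
      using phase_add[of r "s - r" \<xi>] by (simp add: right_diff_distrib)
    then have "cmod (phase s \<xi> - phase r \<xi>) = cmod (phase (s - r) \<xi> - 1)" by (simp add: norm_mult)
    also have "\<dots> \<le> \<bar>(s - r) * (norm \<xi>)\<^sup>2\<bar>"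
      using iexp_approx1[of "(s - r) * (norm \<xi>)\<^sup>2" 0] by (simp add: phase_def)
    also have "\<dots> \<le> \<bar>s - r\<bar> * (1 + (norm \<xi>)\<^sup>2)"
      by (simp add: abs_mult mult_left_mono)
    finally show ?thesis .
  qed
  have "ennreal ((norm (trunc_sobolev \<sigma> \<rho> (S s u - S r u)))\<^sup>2)
      \<le> (\<integral>\<^sup>+\<xi>. ennreal (\<bar>s - r\<bar>\<^sup>2) * (ennreal ((1 + (norm \<xi>)\<^sup>2) powr (\<sigma> + 2) * (cmod (rep_L2 (fourier u) \<xi>))\<^sup>2)
          * indicator (cball 0 \<rho>) \<xi>) \<partial>lborel)"
    unfolding norm_trunc_sobolev_nn[OF \<sigma>] F.diff
  proof (rule nn_integral_mono_AE, use ph[of s] ph[of r] rep_L2_diff[of "fourier (S s u)" "fourier (S r u)"] in eventually_elim)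
    case (elim \<xi>)
    \<comment> \<open>The two extra orders: the phases differ by at most
      \<open>\<bar>s - r\<bar> * (1 + (norm \<xi>)\<^sup>2)\<close>, and the square of the second
      factor raises the exponent of the weight by 2.\<close>
    have p2: "(1 + (norm \<xi>)\<^sup>2) powr (\<sigma> + 2) = (1 + (norm \<xi>)\<^sup>2) powr \<sigma> * (1 + (norm \<xi>)\<^sup>2)\<^sup>2"
      by (simp add: powr_add add_pos_nonneg)
    have "(cmod (rep_L2 (fourier (S s u) - fourier (S r u)) \<xi>))\<^sup>2
        = (cmod (phase s \<xi> - phase r \<xi>))\<^sup>2 * (cmod (rep_L2 (fourier u) \<xi>))\<^sup>2"
      by (simp add: elim left_diff_distrib[symmetric] norm_mult power_mult_distrib)
    also have "\<dots> \<le> (\<bar>s - r\<bar> * (1 + (norm \<xi>)\<^sup>2))\<^sup>2 * (cmod (rep_L2 (fourier u) \<xi>))\<^sup>2"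
      by (intro mult_right_mono power_mono pd) auto
    finally have "(1 + (norm \<xi>)\<^sup>2) powr \<sigma> * (cmod (rep_L2 (fourier (S s u) - fourier (S r u)) \<xi>))\<^sup>2
        \<le> (1 + (norm \<xi>)\<^sup>2) powr \<sigma> * ((\<bar>s - r\<bar> * (1 + (norm \<xi>)\<^sup>2))\<^sup>2 * (cmod (rep_L2 (fourier u) \<xi>))\<^sup>2)"
      by (intro mult_left_mono) auto
    also have "\<dots> = \<bar>s - r\<bar>\<^sup>2 * ((1 + (norm \<xi>)\<^sup>2) powr (\<sigma> + 2) * (cmod (rep_L2 (fourier u) \<xi>))\<^sup>2)"
      unfolding p2 by (simp add: power_mult_distrib)
    finally show ?case
      by (auto simp: indicator_def ennreal_mult[symmetric] intro: ennreal_leI)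
  qed
  also have "\<dots> = ennreal ((\<bar>s - r\<bar> * norm (trunc_sobolev (\<sigma> + 2) \<rho> u))\<^sup>2)"
  proof -
    have "(\<lambda>\<xi>. ennreal ((1 + (norm \<xi>)\<^sup>2) powr (\<sigma> + 2) * (cmod (rep_L2 (fourier u) \<xi>))\<^sup>2) * indicator (cball 0 \<rho>) \<xi>)
        \<in> borel_measurable lborel" by measurable
    then show ?thesis
      unfolding power_mult_distrib ennreal_mult'[OF zero_le_power2]
      using norm_trunc_sobolev_nn[of "\<sigma> + 2" \<rho> u] \<sigma> by (subst nn_integral_cmult) simp_all
  qed
  finally have "(norm (trunc_sobolev \<sigma> \<rho> (S s u - S r u)))\<^sup>2 \<le> (\<bar>s - r\<bar> * norm (trunc_sobolev (\<sigma> + 2) \<rho> u))\<^sup>2"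
    by (subst (asm) ennreal_le_iff) auto
  then show ?thesis by (rule power2_le_imp_le) simp
qed

section \<open>The error estimate\<close>

lemma tendsto_Max:
  fixes f :: "'i \<Rightarrow> 'b \<Rightarrow> 'c::linorder_topology"
  assumes "finite A" "A \<noteq> {}" "\<And>n. n \<in> A \<Longrightarrow> (f n \<longlongrightarrow> l n) G"
  shows "((\<lambda>x. MAX n\<in>A. f n x) \<longlongrightarrow> (MAX n\<in>A. l n)) G"
  using assms
proof (induction A rule: finite_ne_induct)
  case (insert a A)
  then show ?case by (auto intro!: tendsto_max)
qed simp

text \<open>Multiplication of extended reals is discontinuous only where 0 meets \<infinity>, and
  \<open>l\<close> and \<open>l ^ p\<close> never form such a pair.\<close>

lemma tendsto_power_ennreal:
  fixes f :: "'b \<Rightarrow> ennreal"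
  assumes "(f \<longlongrightarrow> l) G"
  shows "((\<lambda>x. f x ^ p) \<longlongrightarrow> l ^ p) G"
proof (induction p)
  case (Suc p)
  have "\<not> (l = 0 \<and> l ^ p = \<top>)" "\<not> (l ^ p = 0 \<and> l = \<top>)"
    by (auto simp: top_power_ennreal power_0_left split: if_splits)
  then show ?case
    unfolding power_Suc by (intro tendsto_mult_ennreal assms Suc) auto
qed simp

text \<open>Used for all three limits: refinement of the mesh, number of coordinates, and radius of
  the frequency cutoff.\<close>

lemma nn_integral_Max_limit_le:
  fixes f :: "nat \<Rightarrow> 'i \<Rightarrow> 'b \<Rightarrow> ennreal"
  assumes A: "finite A" "A \<noteq> {}" and f: "\<And>l n. n \<in> A \<Longrightarrow> f l n \<in> borel_measurable M"
    and C: "\<And>l. (\<integral>\<^sup>+x. (MAX n\<in>A. f l n x) \<partial>M) \<le> C"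
    and g: "\<And>n. n \<in> A \<Longrightarrow> AE x in M. (\<lambda>l. f l n x) \<longlonglongrightarrow> g n x"
  shows "(\<integral>\<^sup>+x. (MAX n\<in>A. g n x) \<partial>M) \<le> C"
proof (rule nn_integral_limit_le[OF _ C])
  have "AE x in M. \<forall>n\<in>A. (\<lambda>l. f l n x) \<longlonglongrightarrow> g n x" by (intro AE_finite_allI A g)
  then show "AE x in M. (\<lambda>l. MAX n\<in>A. f l n x) \<longlonglongrightarrow> (MAX n\<in>A. g n x)"
    by eventually_elim (intro tendsto_Max A, blast)
qed (intro borel_measurable_Max A f)

text \<open>The second moments are summable, so the series of squares has finite expectation and its
  terms vanish almost surely; the whole sequence converges and no subsequence is extracted.\<close>

lemma (in prob_space) AE_tendsto_of_second_moment:
  fixes X :: "'a \<Rightarrow> real"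
  assumes [measurable]: "X \<in> borel_measurable M" "\<And>l. Y l \<in> borel_measurable M"
    and C: "0 \<le> C" "\<And>l. (\<integral>\<^sup>+\<omega>. ennreal ((X \<omega> - Y l \<omega>)\<^sup>2) \<partial>M) \<le> ennreal (C / (real (Suc l))\<^sup>2)"
  shows "AE \<omega> in M. (\<lambda>l. Y l \<omega>) \<longlonglongrightarrow> X \<omega>"
proof -
  have "(\<integral>\<^sup>+\<omega>. (\<Sum>l. ennreal ((X \<omega> - Y l \<omega>)\<^sup>2)) \<partial>M) = (\<Sum>l. \<integral>\<^sup>+\<omega>. ennreal ((X \<omega> - Y l \<omega>)\<^sup>2) \<partial>M)"
    by (rule nn_integral_suminf) simp
  also have "\<dots> \<le> (\<Sum>l. ennreal (C / (real (Suc l))\<^sup>2))"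
    by (intro suminf_le C) auto
  also have "\<dots> < \<infinity>"
  proof -
    have "summable (\<lambda>l. C * inverse ((real (Suc l)) ^ 2))"
      using inverse_power_summable[of 2, where 'a=real]
      by (intro summable_mult) (subst summable_Suc_iff[of "\<lambda>l. inverse (real l ^ 2)"], simp)
    then have "summable (\<lambda>l. C / (real (Suc l))\<^sup>2)" by (simp add: divide_inverse)
    then show ?thesis using C by (subst suminf_ennreal2) (auto simp: ennreal_less_top)
  qed
  finally have "AE \<omega> in M. (\<Sum>l. ennreal ((X \<omega> - Y l \<omega>)\<^sup>2)) \<noteq> \<infinity>"
    by (intro nn_integral_noteq_infinite) auto
  then show ?thesis
  proof eventually_elim
    case (elim \<omega>)
    then have "summable (\<lambda>l. (X \<omega> - Y l \<omega>)\<^sup>2)"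
      by (intro summable_suminf_not_top) auto
    then have "(\<lambda>l. (X \<omega> - Y l \<omega>)\<^sup>2) \<longlonglongrightarrow> 0" by (rule summable_LIMSEQ_zero)
    then have "(\<lambda>l. sqrt ((X \<omega> - Y l \<omega>)\<^sup>2)) \<longlonglongrightarrow> sqrt 0" by (intro tendsto_intros)
    then have "(\<lambda>l. X \<omega> - Y l \<omega>) \<longlonglongrightarrow> 0" by (simp add: tendsto_rabs_zero_iff)
    then have "(\<lambda>l. X \<omega> - (X \<omega> - Y l \<omega>)) \<longlonglongrightarrow> X \<omega> - 0" by (intro tendsto_intros)
    then show ?case by simp
  qed
qed

context wiener
begin

lemma incr_sum:
  assumes "a \<le> b"
  shows "(\<Sum>i=a..<b. incr (g i) (g (Suc i)) h \<omega>) = incr (g a) (g b) h \<omega>"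
  using assms
proof (induction rule: dec_induct)
  case base
  show ?case by (simp add: incr_def)
next
  case (step n)
  then show ?case by (simp add: incr_add)
qed

lemma incr_diff_vec: "incr a b (h - h') \<omega> = incr a b h \<omega> - incr a b h' \<omega>"
  by (simp add: incr_def inner_diff_right)

text \<open>The vectors \<open>h i\<close> may vary with the step but not with chance, which keeps
  every step Gaussian.\<close>

lemma incr_gaussian_walk:
  assumes "0 \<le> \<delta>"
  shows "gaussian_walk M (\<lambda>i. F (real i * \<delta>)) (\<lambda>i. incr (real i * \<delta>) (real (Suc i) * \<delta>) (h i))
    (\<lambda>i. \<delta> * (norm (R (h i)))\<^sup>2)"
proof -
  have m: "0 \<le> real i * \<delta>" "real i * \<delta> \<le> real (Suc i) * \<delta>" for i
    using assms by (auto simp: mult_right_mono)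
  show ?thesis
  proof (unfold_locales, goal_cases)
    case (1 i) then show ?case by (rule F_subalgebra[OF m(1)])
  next
    case (2 i) then show ?case using F_sets_mono[OF m(1) m(2)] by blast
  next
    case (3 i) then show ?case by (rule incr_adapted[OF m])
  next
    case (4 i) then show ?case using incr_normal[OF m, of i "h i"] by (simp add: algebra_simps)
  next
    case (5 X i) then show ?case by (rule incr_indep_var[OF m])
  qed
qed

lemma norm_R_sq: "ennreal ((norm (R h))\<^sup>2) = (\<Sum>l. ennreal ((inner (R (e l)) h)\<^sup>2))"
proof -
  have "inner (R h) (e l) = inner (R (e l)) h" for l by (metis R_selfadjoint inner_commute)
  then show ?thesis unfolding orthonormal_basis_parseval_ennreal[OF onb, symmetric] by simp
qed

end

section \<open>Coordinates of the integrand and their Lipschitz bound\<close>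

locale schroedinger = wiener M F Q R W e
  for M :: "'w measure" and F and Q R :: "'a::euclidean_space L2 \<Rightarrow>\<^sub>L 'a L2" and W e +
  fixes S :: "real \<Rightarrow> 'a L2 \<Rightarrow>\<^sub>L 'a L2" and \<sigma> A :: real
  assumes grp: "schroedinger_group S" and \<sigma>: "0 \<le> \<sigma>" and A: "0 \<le> A"
    and hs: "(\<Sum>j. (sobolev_norm (\<sigma> + 2) (R (e j)))\<^sup>2) \<le> ennreal A"
begin

lemma S_add: "S s (S t x) = S (s + t) x"
  using grp by (auto simp: schroedinger_group_def unitary_group_def)

lemma S_0: "S 0 x = x"
  using grp by (auto simp: schroedinger_group_def unitary_group_def)

lemma S_cscale: "S t (cscale c x) = cscale c (S t x)"
  using grp by (auto simp: schroedinger_group_def unitary_group_def)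

definition \<psi> :: "real \<Rightarrow> nat \<Rightarrow> 'a L2 \<Rightarrow> real" where
  "\<psi> \<rho> m x = inner (trunc_sobolev \<sigma> \<rho> x) (e m)"

lemma bounded_linear_\<psi>: "bounded_linear (\<psi> \<rho> m)"
  unfolding \<psi>_def[abs_def]
  by (rule bounded_linear_compose[OF bounded_linear_inner_left bounded_linear_trunc_sobolev[OF \<sigma>]])

lemma bounded_linear_\<psi>_S: "bounded_linear (\<lambda>x. \<psi> \<rho> m (S t x))"
  by (rule bounded_linear_compose[OF bounded_linear_\<psi> blinfun.bounded_linear_right])

text \<open>Pairing an increment of \<open>W\<close> with this vector gives coordinate
  \<open>m\<close> of the increment transported by \<open>S (- s)\<close>, so integrands are handled
  as vectors.\<close>

definition H :: "real \<Rightarrow> nat \<Rightarrow> real \<Rightarrow> 'a L2" where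
  "H \<rho> m s = rep_vec (\<lambda>x. \<psi> \<rho> m (S (- s) x))"

lemma inner_H: "inner x (H \<rho> m s) = \<psi> \<rho> m (S (- s) x)"
  unfolding H_def by (rule inner_rep_vec[OF bounded_linear_\<psi>_S])

text \<open>Free of \<open>\<rho>\<close>, because the truncated norm of order
  \<open>\<sigma> + 2\<close> is at most the full one, whose squares sum to at most
  \<open>A\<close>.\<close>

lemma sum_trunc_sobolev_group_diff:
  "(\<Sum>j. ennreal ((norm (trunc_sobolev \<sigma> \<rho> (S s (R (e j)) - S r (R (e j)))))\<^sup>2)) \<le> ennreal (\<bar>s - r\<bar>\<^sup>2 * A)"
proof -
  have "(\<Sum>j. ennreal ((norm (trunc_sobolev \<sigma> \<rho> (S s (R (e j)) - S r (R (e j)))))\<^sup>2))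
      \<le> (\<Sum>j. ennreal (\<bar>s - r\<bar>\<^sup>2) * (sobolev_norm (\<sigma> + 2) (R (e j)))\<^sup>2)"
  proof (intro suminf_le)
    fix j
    have "ennreal ((norm (trunc_sobolev \<sigma> \<rho> (S s (R (e j)) - S r (R (e j)))))\<^sup>2)
        \<le> ennreal ((\<bar>s - r\<bar> * norm (trunc_sobolev (\<sigma> + 2) \<rho> (R (e j))))\<^sup>2)"
      by (intro ennreal_leI power_mono trunc_sobolev_group_diff grp \<sigma>) auto
    also have "\<dots> = ennreal (\<bar>s - r\<bar>\<^sup>2) * ennreal ((norm (trunc_sobolev (\<sigma> + 2) \<rho> (R (e j))))\<^sup>2)"
      by (simp only: power_mult_distrib ennreal_mult'[OF zero_le_power2])
    also have "\<dots> \<le> ennreal (\<bar>s - r\<bar>\<^sup>2) * (sobolev_norm (\<sigma> + 2) (R (e j)))\<^sup>2"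
      using \<sigma> by (intro mult_left_mono trunc_sobolev_le) auto
    finally show "ennreal ((norm (trunc_sobolev \<sigma> \<rho> (S s (R (e j)) - S r (R (e j)))))\<^sup>2)
        \<le> ennreal (\<bar>s - r\<bar>\<^sup>2) * (sobolev_norm (\<sigma> + 2) (R (e j)))\<^sup>2" .
  qed auto
  also have "\<dots> = ennreal (\<bar>s - r\<bar>\<^sup>2) * (\<Sum>j. (sobolev_norm (\<sigma> + 2) (R (e j)))\<^sup>2)"
    by (rule ennreal_suminf_cmult)
  also have "\<dots> \<le> ennreal (\<bar>s - r\<bar>\<^sup>2) * ennreal A" by (intro mult_left_mono hs) auto
  also have "\<dots> = ennreal (\<bar>s - r\<bar>\<^sup>2 * A)" by (simp only: ennreal_mult'[OF zero_le_power2])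
  finally show ?thesis .
qed

lemma \<psi>_diff: "\<psi> \<rho> m x - \<psi> \<rho> m y = inner (trunc_sobolev \<sigma> \<rho> (x - y)) (e m)"
proof -
  interpret bounded_linear "\<psi> \<rho> m" by (rule bounded_linear_\<psi>)
  show ?thesis unfolding diff[symmetric] by (simp add: \<psi>_def)
qed

lemma sum_\<psi>_le: "(\<Sum>m<J. ennreal ((inner x (e m))\<^sup>2)) \<le> ennreal ((norm x)\<^sup>2)"
  unfolding orthonormal_basis_parseval_ennreal[OF onb, symmetric]
  by (rule sum_le_suminf) auto

text \<open>Self-adjointness of \<open>R\<close> and Parseval expand each norm over
  \<open>l\<close>. After exchanging the sums, the one over \<open>m\<close> is bounded by Bessel's
  inequality and the one over \<open>l\<close> by the Hilbert--Schmidt estimate, so nothing depends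
  on \<open>J\<close>.\<close>

lemma sum_norm_R_H_diff:
  "(\<Sum>m<J. (norm (R (H \<rho> m s - H \<rho> m r)))\<^sup>2) \<le> \<bar>s - r\<bar>\<^sup>2 * A"
proof -
  let ?d = "\<lambda>l. trunc_sobolev \<sigma> \<rho> (S (- s) (R (e l)) - S (- r) (R (e l)))"
  have "ennreal (\<Sum>m<J. (norm (R (H \<rho> m s - H \<rho> m r)))\<^sup>2) = (\<Sum>m<J. \<Sum>l. ennreal ((inner (?d l) (e m))\<^sup>2))"
    by (subst sum_ennreal[symmetric]) (simp_all add: norm_R_sq inner_diff_right inner_H \<psi>_diff)
  also have "\<dots> = (\<Sum>l. \<Sum>m<J. ennreal ((inner (?d l) (e m))\<^sup>2))"
    by (rule suminf_sum[symmetric]) simp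
  also have "\<dots> \<le> (\<Sum>l. ennreal ((norm (?d l))\<^sup>2))"
    by (intro suminf_le sum_\<psi>_le) auto
  also have "\<dots> \<le> ennreal (\<bar>- s - - r\<bar>\<^sup>2 * A)" by (rule sum_trunc_sobolev_group_diff)
  also have "\<bar>- s - - r\<bar> = \<bar>s - r\<bar>" by simp
  finally show ?thesis using A by (subst (asm) ennreal_le_iff) auto
qed

text \<open>The noise accumulated by the scheme, pulled back to time 0: an increment that starts at
  node \<open>j\<close> is carried to node \<open>n\<close> by the group over n - j steps.\<close>

definition drift_sum :: "real \<Rightarrow> nat \<Rightarrow> 'w \<Rightarrow> 'a L2" where
  "drift_sum k n \<omega> = (\<Sum>j<n. S (- (real j * k)) (W (real (Suc j) * k) \<omega> - W (real j * k) \<omega>))"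

lemma exp_integrator_eq:
  "exp_integrator S W u0 k n \<omega> = S (real n * k) (u0 \<omega>) - cscale \<i> (S (real n * k) (drift_sum k n \<omega>))"
proof (induction n)
  case 0
  interpret c: bounded_linear "cscale \<i>" by (rule cscale_linear)
  show ?case by (simp add: drift_sum_def S_0 c.zero)
next
  case (Suc n)
  interpret c: bounded_linear "cscale \<i>" by (rule cscale_linear)
  have 1: "k + real n * k = real (Suc n) * k" "real (Suc n) * k + - (real n * k) = k"
    by (auto simp: algebra_simps)
  have "S (real (Suc n) * k) (drift_sum k (Suc n) \<omega>)
      = S (real (Suc n) * k) (drift_sum k n \<omega>) + S k (W (real (Suc n) * k) \<omega> - W (real n * k) \<omega>)"
    by (simp only: drift_sum_def sum.lessThan_Suc blinfun.add_right S_add 1)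
  then show ?case
    by (simp only: exp_integrator.simps Suc.IH blinfun.diff_right S_cscale S_add 1 c.add) simp
qed

section \<open>The error as a limit of fine random walks\<close>

context
  fixes T k :: real and N :: nat and I :: "nat \<Rightarrow> 'w \<Rightarrow> 'a L2"
  assumes T: "0 < T" and N: "1 \<le> N" and k: "k = T / real N"
    and I: "\<And>n. n \<in> {1..N} \<Longrightarrow> has_stochastic_integral M F W R e (real n * k) (\<lambda>r \<omega>. S (real n * k - r)) (I n)"
begin

lemma k_pos: "0 < k" using T N by (simp add: k)

lemma Nk: "real N * k = T" using N by (simp add: k)

text \<open>Each \<open>I n\<close> is a separately chosen version with its own integrand
  \<open>S (real n * k - r)\<close>. Pulling back by the group makes the integrand
  \<open>S (- r)\<close> for all \<open>n\<close>, so a common walk can approximate all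
  errors.\<close>

definition err :: "nat \<Rightarrow> 'w \<Rightarrow> 'a L2" where
  "err n \<omega> = drift_sum k n \<omega> - S (- (real n * k)) (I n \<omega>)"

lemma \<psi>_drift_sum: "\<psi> \<rho> m (drift_sum k n \<omega>) = (\<Sum>j<n. incr (real j * k) (real (Suc j) * k) (H \<rho> m (real j * k)) \<omega>)"
proof -
  interpret bounded_linear "\<psi> \<rho> m" by (rule bounded_linear_\<psi>)
  show ?thesis by (simp add: drift_sum_def sum incr_def inner_H)
qed

lemma \<psi>_err_measurable:
  assumes n: "n \<in> {1..N}"
  shows "(\<lambda>\<omega>. \<psi> \<rho> m (err n \<omega>)) \<in> borel_measurable M"
proof -
  interpret b: bounded_linear "\<psi> \<rho> m" by (rule bounded_linear_\<psi>)
  have "I n \<in> borel_measurable M" using I[OF n] by (simp add: has_stochastic_integral_def)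
  moreover have "(\<lambda>x. \<psi> \<rho> m (S (- (real n * k)) x)) \<in> borel_measurable borel"
    by (intro borel_measurable_continuous_onI linear_continuous_on bounded_linear_\<psi>_S)
  ultimately have "(\<lambda>\<omega>. \<psi> \<rho> m (S (- (real n * k)) (I n \<omega>))) \<in> borel_measurable M"
    by (rule measurable_compose)
  then show ?thesis
    unfolding err_def b.diff \<psi>_drift_sum
    using k_pos by (intro borel_measurable_diff borel_measurable_sum incr_measurable) (auto simp: mult_right_mono)
qed

definition mesh :: "nat \<Rightarrow> real" where "mesh L = k / real L"

definition walk_vec :: "nat \<Rightarrow> real \<Rightarrow> nat \<Rightarrow> nat \<Rightarrow> 'a L2" where
  "walk_vec L \<rho> m i = H \<rho> m (real (i div L) * k) - H \<rho> m (real i * mesh L)"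

definition fine_walk :: "nat \<Rightarrow> real \<Rightarrow> nat \<Rightarrow> nat \<Rightarrow> 'w \<Rightarrow> real" where
  "fine_walk L \<rho> m n \<omega> = (\<Sum>i<n. incr (real i * mesh L) (real (Suc i) * mesh L) (walk_vec L \<rho> m i) \<omega>)"

lemma mesh_nonneg: "0 \<le> mesh L" using k_pos by (simp add: mesh_def)

lemma fine_walk_eq:
  assumes L: "0 < L"
  shows "fine_walk L \<rho> m (n * L) \<omega> = \<psi> \<rho> m (drift_sum k n \<omega>)
    - (\<Sum>i<n * L. incr (real i * mesh L) (real (Suc i) * mesh L) (H \<rho> m (real i * mesh L)) \<omega>)"
proof -
  let ?g = "\<lambda>i. real i * mesh L"
  have fk: "real (j * L) * mesh L = real j * k" for j using L by (simp add: mesh_def)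
  have "(\<Sum>i<n * L. incr (?g i) (?g (Suc i)) (H \<rho> m (real (i div L) * k)) \<omega>)
      = (\<Sum>j<n. \<Sum>i=j * L..<j * L + L. incr (?g i) (?g (Suc i)) (H \<rho> m (real (i div L) * k)) \<omega>)"
    by (rule sum.nat_group[symmetric])
  \<comment> \<open>Throughout one coarse cell the vector is constant, so the fine increments
    telescope to the coarse one.\<close>
  also have "\<dots> = (\<Sum>j<n. \<Sum>i=j * L..<j * L + L. incr (?g i) (?g (Suc i)) (H \<rho> m (real j * k)) \<omega>)"
  proof (intro sum.cong refl)
    fix i j assume i: "i \<in> {j * L..<j * L + L}"
    then have "i div L = j"
      by (intro div_nat_eqI) (auto simp: mult.commute)
    then show "incr (?g i) (?g (Suc i)) (H \<rho> m (real (i div L) * k)) \<omega> = incr (?g i) (?g (Suc i)) (H \<rho> m (real j * k)) \<omega>"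
      by simp
  qed
  also have "\<dots> = (\<Sum>j<n. incr (real j * k) (real (Suc j) * k) (H \<rho> m (real j * k)) \<omega>)"
  proof (intro sum.cong refl)
    fix j
    have "j * L + L = Suc j * L" by simp
    then show "(\<Sum>i=j * L..<j * L + L. incr (?g i) (?g (Suc i)) (H \<rho> m (real j * k)) \<omega>)
      = incr (real j * k) (real (Suc j) * k) (H \<rho> m (real j * k)) \<omega>"
      using incr_sum[of "j * L" "j * L + L" ?g] by (simp only: fk le_add1)
  qed
  finally show ?thesis
    by (simp add: fine_walk_def walk_vec_def incr_diff_vec sum_subtractf \<psi>_drift_sum)
qed

text \<open>By the Lipschitz bound the fine Riemann sum misses the integrand by at most one mesh
  width per cell. The resulting decay in \<open>L\<close> is quadratic, hence summable, as almost
  sure convergence requires.\<close>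

lemma fine_walk_approx:
  assumes L: "0 < L" and n: "n \<in> {1..N}"
  shows "(\<integral>\<^sup>+\<omega>. ennreal ((\<psi> \<rho> m (err n \<omega>) - fine_walk L \<rho> m (n * L) \<omega>)\<^sup>2) \<partial>M) \<le> ennreal (4 * k\<^sup>2 * A * T / (real L)\<^sup>2)"
proof -
  interpret b: bounded_linear "\<psi> \<rho> m" by (rule bounded_linear_\<psi>)
  let ?t = "real n * k" and ?g = "\<lambda>i. real i * mesh L"
  have t0: "0 \<le> ?t" using k_pos by simp
  have "(\<integral>\<^sup>+\<omega>. ennreal ((\<psi> \<rho> m (S (- ?t) (I n \<omega>)) - (\<Sum>i<n * L. incr (?g i) (?g (Suc i)) (H \<rho> m (?g i)) \<omega>))\<^sup>2) \<partial>M)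
      \<le> ennreal (4 * ((mesh L)\<^sup>2 * A) * ?t)"
  proof (rule stochastic_integral_riemann_sum[OF I[OF n] bounded_linear_\<psi>_S t0])
    show "0 \<le> (mesh L)\<^sup>2 * A" using A by simp
    show "?g 0 = 0" by simp
    show "?g (n * L) = ?t" using L by (simp add: mesh_def)
    show "?g i \<le> ?g (Suc i)" for i using mesh_nonneg by (simp add: mult_right_mono)
    fix i r assume r: "?g i < r" "r \<le> ?g (Suc i)"
    let ?d = "\<lambda>j. trunc_sobolev \<sigma> \<rho> (S (- r) (R (e j)) - S (- ?g i) (R (e j)))"
    \<comment> \<open>\<open>S (- ?t)\<close> and \<open>S (?t - r)\<close> compose to
      \<open>S (- r)\<close>, which removes the final time from the integrand.\<close>
    have "\<psi> \<rho> m (S (- ?t) (S (?t - r) (R (e j)))) - inner (R (e j)) (H \<rho> m (?g i)) = inner (?d j) (e m)" for j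
      by (simp add: S_add inner_H \<psi>_diff)
    then have "(\<Sum>j. ennreal ((\<psi> \<rho> m (S (- ?t) (S (?t - r) (R (e j)))) - inner (R (e j)) (H \<rho> m (?g i)))\<^sup>2))
        = (\<Sum>j. ennreal ((inner (?d j) (e m))\<^sup>2))" by simp
    also have "\<dots> \<le> (\<Sum>j. ennreal ((norm (?d j))\<^sup>2))"
    proof (intro suminf_le)
      fix j
      have "ennreal ((inner (?d j) (e m))\<^sup>2) \<le> (\<Sum>m<Suc m. ennreal ((inner (?d j) (e m))\<^sup>2))" by simp
      also have "\<dots> \<le> ennreal ((norm (?d j))\<^sup>2)" by (rule sum_\<psi>_le)
      finally show "ennreal ((inner (?d j) (e m))\<^sup>2) \<le> ennreal ((norm (?d j))\<^sup>2)" .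
    qed auto
    also have "\<dots> \<le> ennreal (\<bar>- r - - ?g i\<bar>\<^sup>2 * A)" by (rule sum_trunc_sobolev_group_diff)
    also have "\<dots> \<le> ennreal ((mesh L)\<^sup>2 * A)"
      using r A by (intro ennreal_leI mult_right_mono power_mono) (auto simp: algebra_simps)
    finally show "(\<Sum>j. ennreal ((\<psi> \<rho> m (S (- ?t) (S (?t - r) (R (e j)))) - inner (R (e j)) (H \<rho> m (?g i)))\<^sup>2))
        \<le> ennreal ((mesh L)\<^sup>2 * A)" .
  qed
  also have "\<dots> \<le> ennreal (4 * k\<^sup>2 * A * T / (real L)\<^sup>2)"
  proof (rule ennreal_leI)
    have "?t \<le> T" using n k_pos by (simp add: Nk[symmetric] mult_right_mono)
    then have "4 * ((mesh L)\<^sup>2 * A) * ?t \<le> 4 * ((mesh L)\<^sup>2 * A) * T"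
      using A by (intro mult_left_mono) auto
    then show "4 * ((mesh L)\<^sup>2 * A) * ?t \<le> 4 * k\<^sup>2 * A * T / (real L)\<^sup>2"
      by (simp add: mesh_def power_divide mult.assoc)
  qed
  also have "(\<integral>\<^sup>+\<omega>. ennreal ((\<psi> \<rho> m (S (- ?t) (I n \<omega>)) - (\<Sum>i<n * L. incr (?g i) (?g (Suc i)) (H \<rho> m (?g i)) \<omega>))\<^sup>2) \<partial>M)
      = (\<integral>\<^sup>+\<omega>. ennreal ((\<psi> \<rho> m (err n \<omega>) - fine_walk L \<rho> m (n * L) \<omega>)\<^sup>2) \<partial>M)"
    unfolding err_def b.diff fine_walk_eq[OF L] by (simp add: power2_commute)
  finally show ?thesis .
qed

text \<open>The maximum over all fine times dominates the one over coarse nodes, so Doob's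
  inequality for each coordinate and Minkowski's for their squares apply. The bound is free of
  \<open>L\<close>, \<open>J\<close> and \<open>\<rho>\<close> and therefore survives the
  limits.\<close>

lemma fine_walk_max:
  assumes L: "0 < L" and p: "p \<ge> 1"
  shows "(\<integral>\<^sup>+\<omega>. (MAX n\<in>{1..N}. ennreal ((\<Sum>m<J. (fine_walk L \<rho> m (n * L) \<omega>)\<^sup>2) ^ p)) \<partial>M)
    \<le> ennreal (4 * gauss_moment p * (T * k\<^sup>2 * A) ^ p)"
proof -
  define v where "v = (\<lambda>m. \<Sum>i<N * L. mesh L * (norm (R (walk_vec L \<rho> m i)))\<^sup>2)"
  define X where "X = (\<lambda>m \<omega>. (running_max (\<lambda>i. \<bar>fine_walk L \<rho> m i \<omega>\<bar> ^ p) (N * L))\<^sup>2)"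
  note gw = incr_gaussian_walk[OF mesh_nonneg, of L]
  show ?thesis
  proof (rule nn_integral_Max_sum_power_le[where X=X and v=v])
    show "integrable M (X m)" for m
      unfolding X_def fine_walk_def
      by (rule has_moments_integrable[OF gaussian_walk.walk_max_expectation(1)[OF gw p]])
    show "(\<integral>\<omega>. X m \<omega> \<partial>M) \<le> 4 * gauss_moment p * v m ^ p" for m
      unfolding X_def fine_walk_def v_def by (rule gaussian_walk.walk_max_expectation(2)[OF gw p])
    show "0 \<le> v m" for m unfolding v_def using mesh_nonneg by (intro sum_nonneg) simp
    \<comment> \<open>Summing over coordinates before time steps makes the bound for each step
      independent of their number.\<close>
    have "(\<Sum>m<J. v m) = (\<Sum>i<N * L. mesh L * (\<Sum>m<J. (norm (R (walk_vec L \<rho> m i)))\<^sup>2))"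
      unfolding v_def sum_distrib_left by (rule sum.swap)
    also have "\<dots> \<le> (\<Sum>i<N * L. mesh L * (k\<^sup>2 * A))"
    proof (intro sum_mono mult_left_mono mesh_nonneg)
      fix i
      have "(\<Sum>m<J. (norm (R (walk_vec L \<rho> m i)))\<^sup>2) \<le> \<bar>real (i div L) * k - real i * mesh L\<bar>\<^sup>2 * A"
        unfolding walk_vec_def by (rule sum_norm_R_H_diff)
      also have "\<dots> \<le> k\<^sup>2 * A"
      proof (intro mult_right_mono power_mono A)
        \<comment> \<open>Fine node \<open>i\<close> lies a fraction \<open>(i mod L) / L\<close> of
          a step after its coarse node, hence at distance less than \<open>k\<close>.\<close>
        have "real i * mesh L = (real (i div L) * real L + real (i mod L)) * mesh L"
          by (metis div_mult_mod_eq of_nat_add of_nat_mult)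
        then have "real (i div L) * k - real i * mesh L = - (real (i mod L) / real L) * k"
          using L by (simp add: mesh_def field_simps)
        moreover have "real (i mod L) / real L * k \<le> 1 * k"
          using L k_pos mod_less_divisor[OF L, of i] by (intro mult_right_mono) auto
        ultimately show "\<bar>real (i div L) * k - real i * mesh L\<bar> \<le> k"
          using k_pos by (simp add: abs_mult)
      qed auto
      finally show "(\<Sum>m<J. (norm (R (walk_vec L \<rho> m i)))\<^sup>2) \<le> k\<^sup>2 * A" .
    qed
    also have "\<dots> = T * k\<^sup>2 * A"
      using L by (simp add: mesh_def Nk[symmetric])
    finally show "(\<Sum>m<J. v m) \<le> T * k\<^sup>2 * A" .
    show "(fine_walk L \<rho> m (n * L) \<omega>)\<^sup>2 ^ p \<le> X m \<omega>" if "n \<in> {1..N}" for m n \<omega>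
    proof -
      have "\<bar>fine_walk L \<rho> m (n * L) \<omega>\<bar> ^ p \<le> running_max (\<lambda>i. \<bar>fine_walk L \<rho> m i \<omega>\<bar> ^ p) (N * L)"
        using that by (intro le_running_max[of _ _ "\<lambda>i. \<bar>fine_walk L \<rho> m i \<omega>\<bar> ^ p"]) simp
      then have "(\<bar>fine_walk L \<rho> m (n * L) \<omega>\<bar> ^ p)\<^sup>2 \<le> X m \<omega>"
        unfolding X_def by (intro power_mono) auto
      moreover have "(fine_walk L \<rho> m (n * L) \<omega>)\<^sup>2 ^ p = \<bar>fine_walk L \<rho> m (n * L) \<omega>\<bar>\<^sup>2 ^ p" by simp
      moreover have "\<dots> = (\<bar>fine_walk L \<rho> m (n * L) \<omega>\<bar> ^ p)\<^sup>2"
        by (simp only: power_mult[symmetric] mult.commute)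
      ultimately show ?thesis by simp
    qed
  qed (use N p gauss_moment_nonneg in auto)
qed

lemma fine_walk_measurable: "fine_walk L \<rho> m n \<in> borel_measurable M"
  unfolding fine_walk_def using mesh_nonneg
  by (intro borel_measurable_sum incr_measurable) (auto simp: mult_right_mono)

lemma \<psi>_err_max:
  assumes p: "p \<ge> 1"
  shows "(\<integral>\<^sup>+\<omega>. (MAX n\<in>{1..N}. ennreal ((\<Sum>m<J. (\<psi> \<rho> m (err n \<omega>))\<^sup>2) ^ p)) \<partial>M)
    \<le> ennreal (4 * gauss_moment p * (T * k\<^sup>2 * A) ^ p)"
proof (rule nn_integral_Max_limit_le[OF _ _ _ fine_walk_max[OF zero_less_Suc p]])
  fix n assume n: "n \<in> {1..N}"
  have "AE \<omega> in M. (\<lambda>l. fine_walk (Suc l) \<rho> m (n * Suc l) \<omega>) \<longlonglongrightarrow> \<psi> \<rho> m (err n \<omega>)" for m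
  proof (rule AE_tendsto_of_second_moment[OF \<psi>_err_measurable[OF n] fine_walk_measurable _
        fine_walk_approx[OF zero_less_Suc n]])
    show "0 \<le> 4 * k\<^sup>2 * A * T" using A T by simp
  qed
  then have "AE \<omega> in M. \<forall>m. (\<lambda>l. fine_walk (Suc l) \<rho> m (n * Suc l) \<omega>) \<longlonglongrightarrow> \<psi> \<rho> m (err n \<omega>)"
    unfolding AE_all_countable ..
  then show "AE \<omega> in M. (\<lambda>l. ennreal ((\<Sum>m<J. (fine_walk (Suc l) \<rho> m (n * Suc l) \<omega>)\<^sup>2) ^ p))
      \<longlonglongrightarrow> ennreal ((\<Sum>m<J. (\<psi> \<rho> m (err n \<omega>))\<^sup>2) ^ p)"
    by eventually_elim (intro tendsto_ennrealI tendsto_power tendsto_sum, blast)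
qed (use N in \<open>auto intro!: measurable_compose[OF _ measurable_ennreal] borel_measurable_power
    borel_measurable_sum fine_walk_measurable\<close>)

lemma trunc_sobolev_err_sums: "(\<lambda>m. (\<psi> \<rho> m (err n \<omega>))\<^sup>2) sums (norm (trunc_sobolev \<sigma> \<rho> (err n \<omega>)))\<^sup>2"
  unfolding \<psi>_def by (rule orthonormal_basis_parseval[OF onb])

lemma trunc_sobolev_err_max:
  assumes p: "p \<ge> 1"
  shows "(\<integral>\<^sup>+\<omega>. (MAX n\<in>{1..N}. ennreal ((norm (trunc_sobolev \<sigma> \<rho> (err n \<omega>)))\<^sup>2 ^ p)) \<partial>M)
    \<le> ennreal (4 * gauss_moment p * (T * k\<^sup>2 * A) ^ p)"
proof (rule nn_integral_Max_limit_le[OF _ _ _ \<psi>_err_max[OF p]])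
  show "AE \<omega> in M. (\<lambda>J. ennreal ((\<Sum>m<J. (\<psi> \<rho> m (err n \<omega>))\<^sup>2) ^ p))
      \<longlonglongrightarrow> ennreal ((norm (trunc_sobolev \<sigma> \<rho> (err n \<omega>)))\<^sup>2 ^ p)" for n
    by (intro AE_I2 tendsto_ennrealI tendsto_power trunc_sobolev_err_sums[unfolded sums_def])
qed (use N in \<open>auto intro!: measurable_compose[OF _ measurable_ennreal] borel_measurable_power
    borel_measurable_sum \<psi>_err_measurable\<close>)

lemma sobolev_err_max:
  assumes p: "p \<ge> 1"
  shows "(\<integral>\<^sup>+\<omega>. (MAX n\<in>{1..N}. sobolev_norm \<sigma> (err n \<omega>) ^ (2 * p)) \<partial>M)
    \<le> ennreal (4 * gauss_moment p * (T * k\<^sup>2 * A) ^ p)"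
proof (rule nn_integral_Max_limit_le[OF _ _ _ trunc_sobolev_err_max[OF p]])
  show "AE \<omega> in M. (\<lambda>j. ennreal ((norm (trunc_sobolev \<sigma> (real j) (err n \<omega>)))\<^sup>2 ^ p))
      \<longlonglongrightarrow> sobolev_norm \<sigma> (err n \<omega>) ^ (2 * p)" for n
    unfolding power_mult ennreal_power[OF zero_le_power2, symmetric]
    by (intro AE_I2 tendsto_power_ennreal trunc_sobolev_tendsto \<sigma>)
  \<comment> \<open>Measurability of the norm is read off its Parseval series, since measurability
    was established for the coordinates.\<close>
  show "(\<lambda>\<omega>. ennreal ((norm (trunc_sobolev \<sigma> (real j) (err n \<omega>)))\<^sup>2 ^ p)) \<in> borel_measurable M"
    if "n \<in> {1..N}" for j n
    unfolding sums_unique[OF trunc_sobolev_err_sums]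
    by (intro measurable_compose[OF _ measurable_ennreal] borel_measurable_suminf borel_measurable_power
        \<psi>_err_measurable that)
qed (use N in auto)

end

end

theorem theorem3p1:
  fixes M :: "'w measure" and F :: "real \<Rightarrow> 'w measure"
    and Q R :: "(real^'d) L2 \<Rightarrow>\<^sub>L (real^'d) L2"
    and e :: "nat \<Rightarrow> (real^'d) L2"
    and W :: "real \<Rightarrow> 'w \<Rightarrow> (real^'d) L2"
    and S :: "real \<Rightarrow> (real^'d) L2 \<Rightarrow>\<^sub>L (real^'d) L2"
    and u0 :: "'w \<Rightarrow> (real^'d) L2" and u :: "real \<Rightarrow> 'w \<Rightarrow> (real^'d) L2"
    and T \<sigma> :: real and p :: nat
  assumes "T > 0" and "\<sigma> \<ge> 0" and "p \<ge> 1"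
    and "prob_space M" and "normal_filtration M F"
    and "orthonormal_basis e"
    and "nonneg_selfadjoint Q" and "trace_class e Q" and "is_sqrt_op R Q"
    and "wiener_process M F Q W"
    and "schroedinger_group S"
    and "u0 \<in> borel_measurable (F 0)"
    and "mild_solution M F W R e S u0 u"
    and "AE \<omega> in M. u0 \<omega> \<in> sobolev \<sigma>"
    and "hilbert_schmidt e (\<sigma> + 2) R"
  shows "\<exists>C::real. 0 \<le> C \<and> (\<forall>N::nat. 1 \<le> N \<longrightarrow>
           (let k = T / real N in
              (\<integral>\<^sup>+\<omega>. (MAX n\<in>{1..N}.
                  (sobolev_norm \<sigma> (exp_integrator S W u0 k n \<omega> - u (real n * k) \<omega>)) ^ (2 * p)) \<partial>M)
              \<le> ennreal (C * k ^ (2 * p)) * (hs_norm e (\<sigma> + 2) R) ^ (2 * p)))"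
proof -
  define h where "h = enn2real (hs_norm e (\<sigma> + 2) R)"
  have h: "hs_norm e (\<sigma> + 2) R = ennreal h"
    using assms(15) by (simp add: h_def hilbert_schmidt_def)
  have h0: "0 \<le> h" by (simp add: h_def)
  have "(\<Sum>j. (sobolev_norm (\<sigma> + 2) (R (e j)))\<^sup>2) = (hs_norm e (\<sigma> + 2) R)\<^sup>2"
    by (simp add: hs_norm_def esqrt_sq)
  then have hs: "(\<Sum>j. (sobolev_norm (\<sigma> + 2) (R (e j)))\<^sup>2) \<le> ennreal (h\<^sup>2)"
    by (simp add: h ennreal_power h0)
  interpret prob_space M by fact
  interpret schroedinger M F Q R W e S \<sigma> "h\<^sup>2"
    by unfold_locales (fact assms hs zero_le_power2)+
  show ?thesis
  \<comment> \<open>Doob's factor 4, the Gaussian moment of order 2p, and \<open>T ^ p\<close> from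
    the total variance \<open>T * k\<^sup>2 * h\<^sup>2\<close>, whose other factors give the rate
    and the Hilbert--Schmidt norm.\<close>
  proof (intro exI[of _ "4 * gauss_moment p * T ^ p"] conjI allI impI)
    show "0 \<le> 4 * gauss_moment p * T ^ p" using assms(1) gauss_moment_nonneg by simp
    fix N :: nat assume N: "1 \<le> N"
    define k where "k = T / real N"
    have k0: "0 < k" using N assms(1) by (simp add: k_def)
    \<comment> \<open>The mild solution provides an integral for each time separately; one version
      is chosen per node, and finitely many null sets are discarded afterwards.\<close>
    have "\<exists>J. has_stochastic_integral M F W R e (real n * k) (\<lambda>r \<omega>. S (real n * k - r)) J \<and>
        (AE \<omega> in M. u (real n * k) \<omega> = S (real n * k) (u0 \<omega>) - cscale \<i> (J \<omega>))" for n
      using assms(13) k0 unfolding mild_solution_def by simp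
    then have "\<exists>J. \<forall>n. has_stochastic_integral M F W R e (real n * k) (\<lambda>r \<omega>. S (real n * k - r)) (J n) \<and>
        (AE \<omega> in M. u (real n * k) \<omega> = S (real n * k) (u0 \<omega>) - cscale \<i> (J n \<omega>))"
      by (intro choice allI)
    then obtain J where J: "\<And>n. has_stochastic_integral M F W R e (real n * k) (\<lambda>r \<omega>. S (real n * k - r)) (J n)"
      "\<And>n. AE \<omega> in M. u (real n * k) \<omega> = S (real n * k) (u0 \<omega>) - cscale \<i> (J n \<omega>)"
      by blast
    let ?d = "\<lambda>n \<omega>. exp_integrator S W u0 k n \<omega> - u (real n * k) \<omega>"
    define E where "E = err k J"
    note err = err_def[OF assms(1) N k_def J(1)]
    have "AE \<omega> in M. \<forall>n\<in>{1..N}. u (real n * k) \<omega> = S (real n * k) (u0 \<omega>) - cscale \<i> (J n \<omega>)"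
      by (intro AE_finite_allI J) auto
    then have eq: "AE \<omega> in M. (MAX n\<in>{1..N}. (sobolev_norm \<sigma> (?d n \<omega>)) ^ (2 * p))
        = (MAX n\<in>{1..N}. sobolev_norm \<sigma> (E n \<omega>) ^ (2 * p))"
    proof eventually_elim
      case (elim \<omega>)
      interpret c: bounded_linear "cscale \<i>" by (rule cscale_linear)
      \<comment> \<open>The initial value cancels, and only unimodular scalars and the group
        separate the two vectors.\<close>
      have "sobolev_norm \<sigma> (?d n \<omega>) = sobolev_norm \<sigma> (E n \<omega>)"
        if n: "n \<in> {1..N}" for n
      proof -
        have Jn: "J n \<omega> = S (real n * k) (S (- (real n * k)) (J n \<omega>))" by (simp add: S_add S_0)
        have "?d n \<omega>
            = cscale \<i> (S (real n * k) (S (- (real n * k)) (J n \<omega>))) - cscale \<i> (S (real n * k) (drift_sum k n \<omega>))"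
          unfolding exp_integrator_eq bspec[OF elim n] Jn[symmetric] by simp
        also have "\<dots> = cscale \<i> (S (real n * k) (S (- (real n * k)) (J n \<omega>) - drift_sum k n \<omega>))"
          by (simp add: c.diff blinfun.diff_right)
        also have "S (- (real n * k)) (J n \<omega>) - drift_sum k n \<omega> = cscale (- 1) (E n \<omega>)"
          using cscale_of_real[of "- 1" "E n \<omega>"] by (simp add: E_def err)
        finally show ?thesis
          by (simp add: sobolev_norm_cscale_unit sobolev_norm_group[OF assms(11)] S_cscale)
      qed
      then show ?case by simp
    qed
    have "(\<integral>\<^sup>+\<omega>. (MAX n\<in>{1..N}. (sobolev_norm \<sigma> (?d n \<omega>)) ^ (2 * p)) \<partial>M)
        = (\<integral>\<^sup>+\<omega>. (MAX n\<in>{1..N}. sobolev_norm \<sigma> (E n \<omega>) ^ (2 * p)) \<partial>M)"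
      by (rule nn_integral_cong_AE[OF eq])
    also have "\<dots> \<le> ennreal (4 * gauss_moment p * (T * k\<^sup>2 * h\<^sup>2) ^ p)"
      unfolding E_def by (rule sobolev_err_max[OF assms(1) N k_def J(1) assms(3)])
    also have "4 * gauss_moment p * (T * k\<^sup>2 * h\<^sup>2) ^ p = 4 * gauss_moment p * T ^ p * k ^ (2 * p) * h ^ (2 * p)"
      by (simp add: power_mult_distrib power_mult)
    also have "ennreal \<dots> = ennreal (4 * gauss_moment p * T ^ p * k ^ (2 * p)) * (hs_norm e (\<sigma> + 2) R) ^ (2 * p)"
      using h0 k0 assms(1) gauss_moment_nonneg[of p] by (simp add: h ennreal_mult ennreal_power)
    finally show "let k = T / real N in
        (\<integral>\<^sup>+\<omega>. (MAX n\<in>{1..N}. (sobolev_norm \<sigma> (exp_integrator S W u0 k n \<omega> - u (real n * k) \<omega>)) ^ (2 * p)) \<partial>M)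
        \<le> ennreal (4 * gauss_moment p * T ^ p * k ^ (2 * p)) * (hs_norm e (\<sigma> + 2) R) ^ (2 * p)"
      by (simp add: Let_def k_def)
  qed
qed

end
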